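(* Let $\gamma\in A_1^{\rm loc}(\mathbb{R}^{n+1})$, $c_1,c_2\ge1$, let $\lambda=2^{-k_0}$ with $k_0\in\mathbb{Z}_+$, and write $\widetilde{Q}:=(1+\lambda)Q$ for cubes $Q\subset\mathbb{R}^n$. Assume that for a function $\varphi\in L_1^{\rm loc}(\mathbb{R}^n)$ there exists a system of tilings $T=\{T^s\}_{s=0}^\infty(c_1,c_2)$ of $\mathbb{R}^n$, admissible for the weight $\gamma$, such that $$\sum_{m\in\mathbb{Z}^n}\widehat{\gamma}_{0,m}\|\varphi|L_1(Q_{0,m})\|+\sum_{s=1}^\infty\sum_{\alpha\in\widetilde{A}^s}\widehat{\gamma}^s_\alpha\int_{\widetilde{Q}^s_\alpha}|\varphi^s_\alpha-\varphi(x)|\,dx<\infty .$$ Then there exists a function $f\in W^1_1(\mathbb{R}^{n+1}_+,\gamma)$ such that $\varphi=\operatorname{tr}|_{t=0}f$ and, moreover, $$C\,\|f|W^1_1(\mathbb{R}^{n+1}_+,\gamma)\|\le\sum_{m\in\mathbb{Z}^n}\widehat{\gamma}_{0,m}\|\varphi|L_1(Q_{0,m})\|+\sum_{s=1}^\infty\sum_{\alpha\in\widetilde{A}^s}\widehat{\gamma}^s_\alpha\int_{\widetilde{Q}^s_\alpha}|\varphi^s_\alpha-\varphi(x)|\,dx,$$ where the constant $C>0$ depends only on $n,C_\gamma,\lambda,c_1,c_2$.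
   Context: $n\in\mathbb{N}$ is fixed; points of $\mathbb{R}^{n+1}$ are $(x,t)$, $x\in\mathbb{R}^n$, $t\in\mathbb{R}$; $\mathbb{R}^{n+1}_+=\mathbb{R}^n\times(0,\infty)$; $\mathbb{Z}_+=\{0,1,2,\dots\}$. Cubes have sides parallel to the axes; $r(Q)$ is the side length; $cQ$ is the cube concentric with $Q$ of side length $c\,r(Q)$. For $k\in\mathbb{Z}_+$, $m\in\mathbb{Z}^n$, $Q_{k,m}=\prod_{i=1}^n(\frac{m_i}{2^k},\frac{m_i+1}{2^k})$ (open dyadic cube), $\overline{Q}_{k,m}$ is its closure. A weight is a function $\gamma\in L_1^{\rm loc}(\mathbb{R}^{n+1})$ positive a.e.; $\gamma\in A_1^{\rm loc}(\mathbb{R}^{n+1})$ means that there is a constant $C_\gamma\ge1$ with $\frac1{|Q|}\iint_Q\gamma\,dx\,dt\le C_\gamma\operatorname{ess\,inf}_Q\gamma$ for every cube $Q\subset\mathbb{R}^{n+1}$ with $r(Q)\le1$. $W^1_1(\mathbb{R}^{n+1}_+,\gamma)$ is the space of locally integrable $f$ on $\mathbb{R}^{n+1}_+$ (with generalized first-order derivatives) with finite norm $\sum_{|\alpha|\le1}\|\gamma D^\alpha f|L_1(\mathbb{R}^{n+1}_+)\|$. $\varphi=\operatorname{tr}|_{t=0}f$ means that $\int_Q|\varphi(x)-f(x,t)|\,dx\to0$ as $t\to+0$ for every open cube $Q\subset\mathbb{R}^n$. Tilings. A tiling of $\mathbb{R}^n$ is a family $\{\overline{Q}_\alpha\}_{\alpha\in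 A}$, $A\subset\mathbb{Z}_+\times\mathbb{Z}^n$, of closed dyadic cubes with pairwise disjoint interiors whose union is $\mathbb{R}^n$. A tiling $T'$ succeeds $T$ ($T'\succ T$) if each cube of $T'$ is contained in some cube of $T$. A system of tilings is a sequence $T=\{T^s\}_{s=0}^\infty$, $T^s=\{\overline{Q}^s_\alpha\}_{\alpha\in A^s}$, with $T^{s+1}\succ T^s$; here $Q^s_\alpha=Q_{k,m}$ if $\alpha=(k,m)$. The set $\widetilde{A}$. For a tiling $\{\overline{Q}_\alpha\}_{\alpha\in A}$ fix an enumeration $\alpha_1,\alpha_2,\dots$ of $A$, and run through the indices in this order, discarding $\alpha_i$ if $\widetilde{Q}_{\alpha_i}$ is contained in the union of $\widetilde{Q}_\alpha$ over all other indices $\alpha$ not yet discarded. $\widetilde{A}\subset A$ is the set of indices never discarded. $\widetilde{A}^s$ is the set obtained in this way from $T^s$. Weights and means. $\widehat{\gamma}_{k,m}:=\frac1{|\Pi_{k,m}|}\iint_{\Pi_{k,m}}\gamma\,dx\,dt$ with $\Pi_{k,m}=Q_{k,m}\times(0,r(Q_{k,m}))$; $\widehat{\gamma}^s_\alpha:=\widehat{\gamma}_{k,m}$ for $\alpha=(k,m)\in A^s$; $\varphi^s_\alpha:=\frac1{|\widetilde{Q}^s_\alpha|}\int_{\widetilde{Q}^s_\alpha}\varphi(x)\,dx$. Admissibility. For $c_1,c_2\ge1$, a system of tilings $T=\{T^s\}_{s=0}^\infty(c_1,c_2)$ is admissible for $\gamma$ if for each $s\in\mathbb{Z}_+$: (1)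 if $\alpha,\alpha'\in A^s$ and $\widetilde{Q}^s_\alpha\cap\widetilde{Q}^s_{\alpha'}\ne\varnothing$, then $\widehat{\gamma}^s_\alpha\le c_1\widehat{\gamma}^s_{\alpha'}$; (2) if $\alpha\in A^s$, $\alpha'\in A^{s+1}$ and $Q^{s+1}_{\alpha'}\subset Q^s_\alpha$, then $\widehat{\gamma}^s_\alpha\le c_2\widehat{\gamma}^{s+1}_{\alpha'}$ and $\widehat{\gamma}^{s+1}_{\alpha'}\le c_2\widehat{\gamma}^s_\alpha$; (3) for any $x\in\mathbb{R}^n$, $\max\{r(Q^{s+1}_{\alpha'}):\alpha'\in A^{s+1},\,x\in\widetilde{Q}^{s+1}_{\alpha'}\}\le\frac12\min\{r(Q^s_\alpha):\alpha\in A^s,\,x\in\widetilde{Q}^s_\alpha\}$; (4) $r(Q^s_\alpha)\ge2^{-l_s}$ for all $\alpha\in A^s$, for some strictly increasing sequence $\{l_j\}_{j=0}^\infty$ of nonnegative integers with $l_0=0$. *)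

theory Defs
  imports "HOL-Analysis.Analysis" "HOL-Probability.Essential_Supremum"
begin

section \<open>Means, cubes, local integrability\<close>

definition locally_integrable :: "'a::euclidean_space set \<Rightarrow> ('a \<Rightarrow> real) \<Rightarrow> bool" where
  "locally_integrable \<Omega> f \<longleftrightarrow> (\<forall>K. compact K \<and> K \<subseteq> \<Omega> \<longrightarrow> f absolutely_integrable_on K)"

definition mean :: "'a::euclidean_space set \<Rightarrow> ('a \<Rightarrow> real) \<Rightarrow> real" where
  "mean S f = (LINT x:S|lebesgue. f x) / measure lebesgue S"

definition ocube :: "'a::euclidean_space \<Rightarrow> real \<Rightarrow> 'a set" where \<comment> \<open>centre, side length\<close>
  "ocube z r = box (z - (r / 2) *\<^sub>R One) (z + (r / 2) *\<^sub>R One)"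

definition ess_inf :: "'a measure \<Rightarrow> ('a \<Rightarrow> ereal) \<Rightarrow> ereal" where
  "ess_inf M f = - esssup M (\<lambda>x. - f x)"


section \<open>Weights\<close>

definition weight :: "('a::euclidean_space \<Rightarrow> real) \<Rightarrow> bool" where
  "weight \<gamma> \<longleftrightarrow> locally_integrable UNIV \<gamma> \<and> (AE z in lebesgue. 0 < \<gamma> z)"

text \<open>The constant is kept explicit because estimates may depend on the weight only through it.
  Since both sides are insensitive to null sets, it suffices to consider open cubes.\<close>

definition A1_loc :: "real \<Rightarrow> ('a::euclidean_space \<Rightarrow> real) \<Rightarrow> bool" where
  "A1_loc C \<gamma> \<longleftrightarrow> weight \<gamma> \<and>
     (\<forall>z r. 0 < r \<and> r \<le> 1 \<longrightarrow>
        ereal (mean (ocube z r) \<gamma>)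
          \<le> ereal C * ess_inf (lebesgue_on (ocube z r)) (\<lambda>w. ereal (\<gamma> w)))"


section \<open>Generalized derivatives and the weighted Sobolev space\<close>

fun C_k :: "nat \<Rightarrow> ('a::euclidean_space \<Rightarrow> real) \<Rightarrow> bool" where
  "C_k 0 u \<longleftrightarrow> continuous_on UNIV u"
| "C_k (Suc k) u \<longleftrightarrow>
     u differentiable_on UNIV \<and> (\<forall>b\<in>Basis. C_k k (\<lambda>x. frechet_derivative u (at x) b))"

definition test_function :: "'a::euclidean_space set \<Rightarrow> ('a \<Rightarrow> real) \<Rightarrow> bool" where
  "test_function \<Omega> u \<longleftrightarrow>
     (\<forall>k. C_k k u) \<and> compact (closure {x. u x \<noteq> 0}) \<and> closure {x. u x \<noteq> 0} \<subseteq> \<Omega>"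

definition has_weak_deriv ::
  "'a::euclidean_space set \<Rightarrow> 'a \<Rightarrow> ('a \<Rightarrow> real) \<Rightarrow> ('a \<Rightarrow> real) \<Rightarrow> bool" where
  "has_weak_deriv \<Omega> b f g \<longleftrightarrow>
     locally_integrable \<Omega> f \<and> locally_integrable \<Omega> g \<and>
     (\<forall>u. test_function \<Omega> u \<longrightarrow>
        (LINT x:\<Omega>|lebesgue. f x * frechet_derivative u (at x) b) = - (LINT x:\<Omega>|lebesgue. g x * u x))"

text \<open>Weak derivatives are unique up to a null set, so the choice of a representative does not
  affect the norm below.\<close>

definition weak_deriv :: "'a::euclidean_space set \<Rightarrow> 'a \<Rightarrow> ('a \<Rightarrow> real) \<Rightarrow> 'a \<Rightarrow> real" where
  "weak_deriv \<Omega> b f = (SOME g. has_weak_deriv \<Omega> b f g)"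

definition W11_norm :: "'a::euclidean_space set \<Rightarrow> ('a \<Rightarrow> real) \<Rightarrow> ('a \<Rightarrow> real) \<Rightarrow> ennreal" where
  "W11_norm \<Omega> \<gamma> f =
     (\<integral>\<^sup>+ z\<in>\<Omega>. ennreal \<bar>\<gamma> z * f z\<bar> \<partial>lebesgue) +
     (\<Sum>b\<in>Basis. \<integral>\<^sup>+ z\<in>\<Omega>. ennreal \<bar>\<gamma> z * weak_deriv \<Omega> b f z\<bar> \<partial>lebesgue)"

definition W11 :: "'a::euclidean_space set \<Rightarrow> ('a \<Rightarrow> real) \<Rightarrow> ('a \<Rightarrow> real) set" where
  "W11 \<Omega> \<gamma> =
     {f. locally_integrable \<Omega> f \<and> (\<forall>b\<in>Basis. \<exists>g. has_weak_deriv \<Omega> b f g) \<and> W11_norm \<Omega> \<gamma> f < \<infinity>}"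

definition upper_half :: "((real^'n) \<times> real) set" where
  "upper_half = UNIV \<times> {0<..}"

text \<open>Integrability of the slices is required explicitly, because the Bochner integral of a
  non-integrable function is 0.\<close>

definition is_trace :: "(real^'n \<Rightarrow> real) \<Rightarrow> ((real^'n) \<times> real \<Rightarrow> real) \<Rightarrow> bool" where
  "is_trace \<phi> f \<longleftrightarrow>
     (\<forall>z r. 0 < r \<longrightarrow>
        (\<forall>\<^sub>F t in at_right 0. (\<lambda>x. \<phi> x - f (x, t)) absolutely_integrable_on ocube z r) \<and>
        ((\<lambda>t. LINT x:ocube z r|lebesgue. \<bar>\<phi> x - f (x, t)\<bar>) \<longlongrightarrow> 0) (at_right 0))"


section \<open>Dyadic cubes and tilings\<close>

type_synonym 'n dyadic = "nat \<times> (int^'n)"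

definition dyadic_side :: "'n dyadic \<Rightarrow> real" where
  "dyadic_side \<alpha> = 1 / 2 ^ fst \<alpha>"

definition dyadic_cube :: "'n::finite dyadic \<Rightarrow> (real^'n) set" where
  "dyadic_cube \<alpha> = box (\<chi> i. real_of_int (snd \<alpha> $ i) / 2 ^ fst \<alpha>)
                       (\<chi> i. (real_of_int (snd \<alpha> $ i) + 1) / 2 ^ fst \<alpha>)"

definition dyadic_centre :: "'n::finite dyadic \<Rightarrow> real^'n" where
  "dyadic_centre \<alpha> = (\<chi> i. (real_of_int (snd \<alpha> $ i) + 1 / 2) / 2 ^ fst \<alpha>)"

definition enlarged :: "real \<Rightarrow> 'n::finite dyadic \<Rightarrow> (real^'n) set" where
  \<comment> \<open>the concentric open cube \<open>(1 + \<lambda>)Q\<close>\<close>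
  "enlarged lam \<alpha> = ocube (dyadic_centre \<alpha>) ((1 + lam) * dyadic_side \<alpha>)"

lemma enlarged_0:
  fixes \<alpha> :: "'n::finite dyadic"
  shows "enlarged 0 \<alpha> = dyadic_cube \<alpha>"
proof -
  have "(One :: real^'n) $ i = 1" for i
    using cart_eq_inner_axis[of "One :: real^'n" i]
    by (simp add: inner_sum_left inner_Basis axis_in_Basis_iff del: sum_component)
  then show ?thesis
    unfolding enlarged_def ocube_def dyadic_cube_def dyadic_centre_def dyadic_side_def
    by (intro arg_cong2[where f = box]) (simp_all add: vec_eq_iff field_simps)
qed

definition tiling :: "'n::finite dyadic set \<Rightarrow> bool" where
  "tiling A \<longleftrightarrow>
     disjoint_family_on (\<lambda>\<alpha>. interior (closure (dyadic_cube \<alpha>))) A \<and>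
     (\<Union>\<alpha>\<in>A. closure (dyadic_cube \<alpha>)) = UNIV"

definition succeeds :: "'n::finite dyadic set \<Rightarrow> 'n dyadic set \<Rightarrow> bool" where
  "succeeds A' A \<longleftrightarrow> (\<forall>\<alpha>'\<in>A'. \<exists>\<alpha>\<in>A. closure (dyadic_cube \<alpha>') \<subseteq> closure (dyadic_cube \<alpha>))"

definition tiling_system :: "(nat \<Rightarrow> 'n::finite dyadic set) \<Rightarrow> bool" where
  "tiling_system A \<longleftrightarrow> (\<forall>s. tiling (A s) \<and> succeeds (A (Suc s)) (A s))"

text \<open>\<open>retained lam A e i\<close> is what is left of \<open>A\<close> after the indices \<open>e 0, ..., e (i - 1)\<close> have been
  examined. Tilings are countably infinite, so an enumeration of \<open>A\<close> is a bijection
  from the natural numbers.\<close>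

fun retained ::
  "real \<Rightarrow> 'n::finite dyadic set \<Rightarrow> (nat \<Rightarrow> 'n dyadic) \<Rightarrow> nat \<Rightarrow> 'n dyadic set" where
  "retained lam A e 0 = A"
| "retained lam A e (Suc i) =
     (let R = retained lam A e i
      in if enlarged lam (e i) \<subseteq> (\<Union>\<alpha>\<in>R - {e i}. enlarged lam \<alpha>) then R - {e i} else R)"

definition enumeration :: "(nat \<Rightarrow> 'a) \<Rightarrow> 'a set \<Rightarrow> bool" where
  "enumeration e A \<longleftrightarrow> bij_betw e UNIV A"

definition reduced :: "real \<Rightarrow> 'n::finite dyadic set \<Rightarrow> (nat \<Rightarrow> 'n dyadic) \<Rightarrow> 'n dyadic set" where
  "reduced lam A e = (\<Inter>i. retained lam A e i)"

definition weight_mean :: "((real^'n::finite) \<times> real \<Rightarrow> real) \<Rightarrow> 'n dyadic \<Rightarrow> real" where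
  "weight_mean \<gamma> \<alpha> = mean (dyadic_cube \<alpha> \<times> {0<..<dyadic_side \<alpha>}) \<gamma>"

text \<open>By the last clause the side lengths occurring at each level form a finite set, so that the
  maximum and the minimum exist.\<close>

definition admissible ::
  "real \<Rightarrow> real \<Rightarrow> real \<Rightarrow> ((real^'n::finite) \<times> real \<Rightarrow> real) \<Rightarrow> (nat \<Rightarrow> 'n dyadic set) \<Rightarrow> bool" where
  "admissible lam c1 c2 \<gamma> A \<longleftrightarrow>
     tiling_system A \<and>
     (\<forall>s. \<forall>\<alpha>\<in>A s. \<forall>\<alpha>'\<in>A s. enlarged lam \<alpha> \<inter> enlarged lam \<alpha>' \<noteq> {} \<longrightarrow>
        weight_mean \<gamma> \<alpha> \<le> c1 * weight_mean \<gamma> \<alpha>') \<and>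
     (\<forall>s. \<forall>\<alpha>\<in>A s. \<forall>\<alpha>'\<in>A (Suc s). dyadic_cube \<alpha>' \<subseteq> dyadic_cube \<alpha> \<longrightarrow>
        weight_mean \<gamma> \<alpha> \<le> c2 * weight_mean \<gamma> \<alpha>' \<and> weight_mean \<gamma> \<alpha>' \<le> c2 * weight_mean \<gamma> \<alpha>) \<and>
     (\<forall>s x. Max {dyadic_side \<alpha>' | \<alpha>'. \<alpha>' \<in> A (Suc s) \<and> x \<in> enlarged lam \<alpha>'}
        \<le> 1 / 2 * Min {dyadic_side \<alpha> | \<alpha>. \<alpha> \<in> A s \<and> x \<in> enlarged lam \<alpha>}) \<and>
     (\<exists>l::nat \<Rightarrow> nat. strict_mono l \<and> l 0 = 0 \<and> (\<forall>s. \<forall>\<alpha>\<in>A s. dyadic_side \<alpha> \<ge> 1 / 2 ^ l s))"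

definition trace_energy ::
  "real \<Rightarrow> ((real^'n::finite) \<times> real \<Rightarrow> real) \<Rightarrow> (nat \<Rightarrow> 'n dyadic set) \<Rightarrow> (nat \<Rightarrow> nat \<Rightarrow> 'n dyadic)
    \<Rightarrow> (real^'n \<Rightarrow> real) \<Rightarrow> ennreal" where
  "trace_energy lam \<gamma> A e \<phi> =
     (\<Sum>\<^sub>\<infinity>m\<in>UNIV. ennreal (weight_mean \<gamma> (0, m)) *
        (\<integral>\<^sup>+ x\<in>dyadic_cube (0, m). ennreal \<bar>\<phi> x\<bar> \<partial>lebesgue)) +
     (\<Sum>s. \<Sum>\<^sub>\<infinity>\<alpha>\<in>reduced lam (A (Suc s)) (e (Suc s)). ennreal (weight_mean \<gamma> \<alpha>) *
        (\<integral>\<^sup>+ x\<in>enlarged lam \<alpha>. ennreal \<bar>mean (enlarged lam \<alpha>) \<phi> - \<phi> x\<bar> \<partial>lebesgue))"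

end

theory Submission
  imports Defs
begin

text \<open>The function \<open>\<phi>\<close> is approximated, level by level, by smooth functions \<open>u\<^sub>s\<close> whose values are
  local averages of the means of \<open>\<phi>\<close> over the enlarged cubes of the reduced family of the tiling \<open>A s\<close>,
  with \<open>u\<^sub>0 = 0\<close>. The extension passes from \<open>u\<^sub>s\<close> to \<open>u\<^sub>s\<^sub>+\<^sub>1\<close> when \<open>t\<close> drops below a height \<open>H\<^sub>s\<^sub>+\<^sub>1(x)\<close>:
  \<open>f(x,t) = \<Sum>\<^sub>s \<psi>(t / H\<^sub>s\<^sub>+\<^sub>1(x)) (u\<^sub>s\<^sub>+\<^sub>1(x) - u\<^sub>s(x))\<close>,
  where \<open>\<psi>\<close>, below \<open>cutoff\<close>, is 1 up to 1 and 0 from 2 on. On each compact part of the half-space the sum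
  is finite and its terms are of class C1.

  The whole proof depends on the choice of the heights. Three requirements compete. A height may vary
  with \<open>x\<close> only at unit speed, up to a constant, or the cutoff would produce too large a gradient. It may
  not exceed the sides of the cubes around \<open>x\<close>. And it may not be too small: the A1 condition
  bounds the mean of the weight over a cube by the means over its parts, not conversely, so
  the mean over a thin slab above a cube can be far larger than the mean \<open>weight_mean\<close> that the energy
  contains. All three are met by a multiple of the largest Lipschitz minorant
  \<open>scale s x = inf (side \<alpha> + K * dist x \<alpha>)\<close> of the side lengths of the tiles. If \<open>\<alpha>'\<close> almost attains
  the infimum at \<open>x\<close>, then \<open>\<alpha>'\<close> meets the enlargement of the tile \<open>\<alpha>\<close> containing \<open>x\<close>, so that the
  weight means of \<open>\<alpha>'\<close> and \<open>\<alpha>\<close> are comparable by admissibility; and a cube whose side is comparable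
  with \<open>scale s x\<close> contains both the box over \<open>\<alpha>'\<close> and everything that \<open>f\<close> sees of level \<open>s\<close> above
  \<open>x\<close>. The A1 condition on this cube yields the bound \<open>weight_above_cell\<close>.

  The averages \<open>u\<^sub>s\<close> are taken over \<open>cells\<close>, dyadic cubes with side about \<open>\<delta> * scale s\<close> for a small
  constant \<open>\<delta>\<close>. Each cell, dilated, lies in one enlarged cube of the reduced family, although the
  reduced family covers only as a union (\<open>cell_inside_reduced\<close>): since \<open>lam\<close> is a power of 1/2, near
  the cell all faces of enlarged cubes lie on one dyadic grid, and the cube that contains the
  nearest grid point also contains the grid cells around that point. The value
  of a cell is the mean of \<open>\<phi>\<close> over this enlarged cube.

  Averages reproduce constants. Hence on a cell \<open>P\<close> the gradient of a term of \<open>f\<close> is at most a multiple of \<open>1 / side P\<close>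
  times the sum of \<open>\<bar>c - a\<bar>\<close> over the values \<open>c\<close> of neighbouring cells, \<open>a\<close> being the mean of \<open>\<phi>\<close> over \<open>P\<close>
  (\<open>layer_bounds\<close>), and the volume of \<open>P\<close> times \<open>\<bar>c - a\<bar>\<close> is at most the integral of \<open>\<bar>c - \<phi>\<bar>\<close> over \<open>P\<close>.
  With the bound on the weight, the part of the norm of \<open>f\<close> that lies above \<open>P\<close> is controlled by the energy
  density over \<open>P\<close> (\<open>osc_le\<close>), and the cells overlap boundedly, so that summation over cells and levels
  gives the estimate (\<open>suminf_majorant_le\<close>).

  Near \<open>t = 0\<close> only the levels beyond any prescribed \<open>S\<close> matter, and \<open>\<bar>f(x,t) - \<phi>(x)\<bar>\<close> is at most
  \<open>2 \<Sum>\<^sub>s\<^sub>\<ge>\<^sub>S \<bar>u\<^sub>s(x) - \<phi>(x)\<bar>\<close> (\<open>extension_minus_trace\<close>). On bounded sets the weight means are bounded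
  below, so that the integral of this sum is a tail of the energy and tends to 0.

  The weak derivative in the norm is an arbitrary choice among all functions with the defining
  property. It is identified with the classical one by the uniqueness of weak derivatives, for which
  smooth bumps supported in boxes are constructed (\<open>W11_norm_C1\<close>).\<close>

section \<open>Functions of class C1\<close>

definition C1_on :: "'a::euclidean_space set \<Rightarrow> ('a \<Rightarrow> real) \<Rightarrow> bool" where
  "C1_on S f \<longleftrightarrow> (\<exists>f'. (\<forall>x\<in>S. (f has_derivative f' x) (at x)) \<and>
     (\<forall>v. continuous_on S (\<lambda>x. f' x v)))"

lemma C1_onI:
  assumes "\<And>x. x \<in> S \<Longrightarrow> (f has_derivative f' x) (at x)" "\<And>v. continuous_on S (\<lambda>x. f' x v)"
  shows "C1_on S f"
  using assms unfolding C1_on_def by blast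

lemma C1_on_frechet:
  assumes "C1_on S f"
  shows "x \<in> S \<Longrightarrow> (f has_derivative frechet_derivative f (at x)) (at x)"
    and "continuous_on S (\<lambda>x. frechet_derivative f (at x) v)"
proof -
  obtain f' where f': "\<And>x. x \<in> S \<Longrightarrow> (f has_derivative f' x) (at x)"
    "\<And>v. continuous_on S (\<lambda>x. f' x v)"
    using assms unfolding C1_on_def by blast
  have eq: "frechet_derivative f (at x) = f' x" if "x \<in> S" for x
    using frechet_derivative_at[OF f'(1)[OF that]] by simp
  show "x \<in> S \<Longrightarrow> (f has_derivative frechet_derivative f (at x)) (at x)"
    using f'(1) eq by simp
  show "continuous_on S (\<lambda>x. frechet_derivative f (at x) v)"
    using f'(2)[of v] by (rule continuous_on_eq) (simp add: eq)
qed

lemma C1_on_continuous: "C1_on S f \<Longrightarrow> continuous_on S f"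
  by (metis C1_on_frechet(1) continuous_at_imp_continuous_on has_derivative_continuous)

lemma C1_on_subset: "C1_on S f \<Longrightarrow> T \<subseteq> S \<Longrightarrow> C1_on T f"
  unfolding C1_on_def by (meson continuous_on_subset subset_iff)

lemma C1_on_const: "C1_on S (\<lambda>_. c)"
  by (rule C1_onI[where f'="\<lambda>_ _. 0"]) auto

lemma C1_on_add:
  assumes "C1_on S f" "C1_on S g" shows "C1_on S (\<lambda>x. f x + g x)"
  by (rule C1_onI[where f'="\<lambda>x v. frechet_derivative f (at x) v + frechet_derivative g (at x) v"])
     (use assms in \<open>auto intro!: has_derivative_add continuous_on_add C1_on_frechet\<close>)

lemma C1_on_mult:
  assumes "C1_on S f" "C1_on S g" shows "C1_on S (\<lambda>x. f x * g x)"
  by (rule C1_onI[where f'="\<lambda>x v. f x * frechet_derivative g (at x) v + frechet_derivative f (at x) v * g x"])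
     (use C1_on_frechet[OF assms(1)] C1_on_frechet[OF assms(2)] assms[THEN C1_on_continuous] in
       \<open>auto intro!: has_derivative_mult continuous_intros\<close>)

lemma C1_on_diff:
  assumes "C1_on S f" "C1_on S g" shows "C1_on S (\<lambda>x. f x - g x)"
  using C1_on_add[OF assms(1) C1_on_mult[OF C1_on_const[of S "-1"] assms(2)]] by simp

lemma C1_on_sum:
  assumes "\<And>i. i \<in> I \<Longrightarrow> C1_on S (f i)" shows "C1_on S (\<lambda>x. \<Sum>i\<in>I. f i x)"
  using assms by (induction I rule: infinite_finite_induct) (auto intro: C1_on_const C1_on_add)

lemma C1_on_divide:
  assumes "C1_on S f" "C1_on S g" "\<And>x. x \<in> S \<Longrightarrow> g x \<noteq> 0" shows "C1_on S (\<lambda>x. f x / g x)"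
  by (rule C1_onI[where f'="\<lambda>x v. (frechet_derivative f (at x) v * g x - f x * frechet_derivative g (at x) v) / (g x * g x)"])
     (use C1_on_frechet[OF assms(1)] C1_on_frechet[OF assms(2)] assms(1,2)[THEN C1_on_continuous] assms(3) in
       \<open>auto intro!: has_derivative_divide' continuous_intros\<close>)

lemma C1_on_compose_real:
  assumes f: "C1_on S f" and p: "\<And>y. (p has_real_derivative p' y) (at y)" "continuous_on UNIV p'"
  shows "C1_on S (\<lambda>x. p (f x))"
proof (rule C1_onI[where f'="\<lambda>x v. p' (f x) * frechet_derivative f (at x) v"])
  fix x assume "x \<in> S"
  have "(p has_derivative (*) (p' (f x))) (at (f x))"
    using p(1)[of "f x"] by (simp add: has_field_derivative_def)
  from has_derivative_compose[OF C1_on_frechet(1)[OF f \<open>x \<in> S\<close>] this]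
  show "((\<lambda>x. p (f x)) has_derivative (\<lambda>v. p' (f x) * frechet_derivative f (at x) v)) (at x)" .
next
  fix v
  have "continuous_on S (\<lambda>x. p' (f x))"
    using continuous_on_compose2[OF p(2) C1_on_continuous[OF f]] by simp
  then show "continuous_on S (\<lambda>x. p' (f x) * frechet_derivative f (at x) v)"
    by (intro continuous_on_mult C1_on_frechet(2)[OF f])
qed

lemma C1_on_fst:
  assumes "C1_on S f" shows "C1_on (S \<times> T) (\<lambda>z. f (fst z))"
proof (rule C1_onI[where f'="\<lambda>z v. frechet_derivative f (at (fst z)) (fst v)"])
  fix z assume z: "z \<in> S \<times> T"
  have "(fst has_derivative fst) (at z)" by (rule has_derivative_fst) (rule has_derivative_ident)
  from has_derivative_compose[OF this C1_on_frechet(1)[OF assms]] z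
  show "((\<lambda>z. f (fst z)) has_derivative (\<lambda>v. frechet_derivative f (at (fst z)) (fst v))) (at z)"
    by auto
next
  fix v :: "'a \<times> 'b"
  show "continuous_on (S \<times> T) (\<lambda>z. frechet_derivative f (at (fst z)) (fst v))"
    by (rule continuous_on_compose2[OF C1_on_frechet(2)[OF assms]]) (auto intro: continuous_intros)
qed

lemma C1_on_snd: "C1_on S (snd :: 'a::euclidean_space \<times> real \<Rightarrow> real)"
  by (rule C1_onI[where f'="\<lambda>_. snd"]) (auto intro: has_derivative_snd has_derivative_ident)

lemma C1_on_local:
  assumes "\<And>x. x \<in> S \<Longrightarrow> \<exists>U g. open U \<and> x \<in> U \<and> C1_on U g \<and> (\<forall>y\<in>U. f y = g y)"
  shows "C1_on S f"
proof (rule C1_onI[where f'="\<lambda>x. frechet_derivative f (at x)"])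
  have *: "\<exists>U. open U \<and> x \<in> U \<and> (f has_derivative frechet_derivative f (at x)) (at x) \<and>
             (\<forall>v. continuous_on U (\<lambda>x. frechet_derivative f (at x) v))" if xS: "x \<in> S" for x
  proof -
    obtain U g where U: "open U" "x \<in> U" "C1_on U g" "\<And>y. y \<in> U \<Longrightarrow> f y = g y"
      using assms[OF xS] by blast
    have d: "(f has_derivative frechet_derivative g (at y)) (at y)" if "y \<in> U" for y
      by (rule has_derivative_transform_within_open[OF C1_on_frechet(1)[OF U(3) that] U(1) that])
         (use U(4) in auto)
    then have eq: "frechet_derivative f (at y) = frechet_derivative g (at y)" if "y \<in> U" for y
      using frechet_derivative_at[OF d[OF that]] that by simp
    show ?thesis
      using U(1,2) d[OF U(2)] eq[OF U(2)] C1_on_frechet(2)[OF U(3)]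
      by (intro exI[of _ U]) (auto cong: continuous_on_cong simp: eq)
  qed
  show "x \<in> S \<Longrightarrow> (f has_derivative frechet_derivative f (at x)) (at x)" for x
    using * by blast
  show "continuous_on S (\<lambda>x. frechet_derivative f (at x) v)" for v
    using * by (intro continuous_at_imp_continuous_on ballI) (meson continuous_on_eq_continuous_at)
qed

section \<open>Weak derivatives of C1 functions\<close>

lemma continuous_locally_integrable:
  assumes "continuous_on S f" shows "locally_integrable S f"
  unfolding locally_integrable_def
proof (intro allI impI)
  fix K assume K: "compact K \<and> K \<subseteq> S"
  then have "integrable lborel (\<lambda>x. indicator K x *\<^sub>R f x)"
    using assms by (intro borel_integrable_compact) (auto intro: continuous_on_subset)
  then show "f absolutely_integrable_on K"
    unfolding set_integrable_def by (rule integrable_completion[THEN iffD2, rotated])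
       (use \<open>integrable lborel _\<close> in auto)
qed

text \<open>The integrals of the difference quotients of \<open>F\<close> vanish by translation invariance, and the quotients
  are dominated by a constant on a fixed ball that contains their supports. Dominated convergence gives the claim.\<close>

lemma integral_directional_derivative_zero:
  fixes F :: "'a::euclidean_space \<Rightarrow> real"
  assumes F: "C1_on UNIV F" and K: "compact K" "\<And>x. x \<notin> K \<Longrightarrow> F x = 0"
  shows "(LINT x|lebesgue. frechet_derivative F (at x) b) = 0"
proof -
  define D where "D = (\<lambda>x. frechet_derivative F (at x) b)"
  have contF: "continuous_on UNIV F" by (rule C1_on_continuous[OF F])
  have contD: "continuous_on UNIV D" unfolding D_def by (rule C1_on_frechet(2)[OF F])
  obtain R where R: "R > 0" "K \<subseteq> ball 0 R"
    using bounded_subset_ballD[OF compact_imp_bounded[OF K(1)], of 0] by blast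
  define R' where "R' = R + norm b"
  define q where "q = (\<lambda>(i::nat) x. (F (x + (1 / Suc i) *\<^sub>R b) - F x) * Suc i)"
  obtain M where M: "\<And>x. x \<in> cball 0 (R' + norm b) \<Longrightarrow> \<bar>D x\<bar> \<le> M"
    using compact_continuous_image[OF continuous_on_subset[OF contD] compact_cball[of 0 "R' + norm b"]]
    by (fastforce dest!: compact_imp_bounded simp: bounded_iff)
  have D': "(F has_derivative frechet_derivative F (at x)) (at x)" for x
    using C1_on_frechet(1)[OF F] by auto
  have lim: "(\<lambda>i. q i x) \<longlonglongrightarrow> D x" for x
  proof -
    have "((\<lambda>t. (F (x + t *\<^sub>R b) - F x) / t) \<longlongrightarrow> D x) (at 0)"
    proof -
      have "((\<lambda>t. x + t *\<^sub>R b) has_derivative (\<lambda>t. t *\<^sub>R b)) (at 0)"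
        by (auto intro!: derivative_eq_intros)
      from has_derivative_compose[OF this, of F "frechet_derivative F (at x)"] D'[of x]
      have "((\<lambda>t. F (x + t *\<^sub>R b)) has_derivative (\<lambda>t. frechet_derivative F (at x) (t *\<^sub>R b))) (at 0)"
        by simp
      moreover have "frechet_derivative F (at x) (t *\<^sub>R b) = D x * t" for t
        using linear_scale[OF has_derivative_linear[OF D'[of x]], of t b] by (simp add: D_def)
      ultimately have "((\<lambda>t. F (x + t *\<^sub>R b)) has_real_derivative D x) (at 0)"
        by (simp add: has_field_derivative_def mult_commute_abs)
      then show ?thesis by (simp add: DERIV_def)
    qed
    moreover have "filterlim (\<lambda>i. 1 / real (Suc i)) (at 0) sequentially"
      unfolding filterlim_at using LIMSEQ_Suc[OF lim_1_over_n] by auto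
    ultimately have "((\<lambda>i. (F (x + (1 / real (Suc i)) *\<^sub>R b) - F x) / (1 / real (Suc i))) \<longlongrightarrow> D x) sequentially"
      by (rule filterlim_compose)
    then show ?thesis by (simp add: q_def mult.commute)
  qed
  have bound: "norm (q i x) \<le> indicator (cball 0 R') x * M" for i x
  proof (cases "x \<in> cball 0 R'")
    case True
    have "\<exists>t\<in>{0<..<1}. F (x + (1 / Suc i) *\<^sub>R b) - F x = frechet_derivative F (at (x + t *\<^sub>R ((1 / Suc i) *\<^sub>R b))) ((1 / Suc i) *\<^sub>R b)"
    proof -
      define y where "y = (1 / Suc i) *\<^sub>R b"
      have "((\<lambda>t. F (x + t *\<^sub>R y)) has_derivative (\<lambda>s. frechet_derivative F (at (x + t *\<^sub>R y)) (s *\<^sub>R y))) (at t)" for t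
      proof -
        have "((\<lambda>t. x + t *\<^sub>R y) has_derivative (\<lambda>t. t *\<^sub>R y)) (at t)"
          by (auto intro!: derivative_eq_intros)
        from has_derivative_compose[OF this D'] show ?thesis .
      qed
      from mvt_simple[of 0 1 "\<lambda>t. F (x + t *\<^sub>R y)", OF _ this[THEN has_derivative_at_withinI]]
      show ?thesis unfolding y_def[symmetric] by simp
    qed
    then obtain t where t: "0 < t" "t < 1" and
      e: "F (x + (1 / Suc i) *\<^sub>R b) - F x = frechet_derivative F (at (x + t *\<^sub>R ((1 / Suc i) *\<^sub>R b))) ((1 / Suc i) *\<^sub>R b)"
      by auto
    have "q i x = D (x + t *\<^sub>R ((1 / Suc i) *\<^sub>R b))"
      unfolding q_def e D_def using linear_scale[OF has_derivative_linear[OF D'], of _ "1 / Suc i" b] by simp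
    moreover have "norm (x + t *\<^sub>R ((1 / Suc i) *\<^sub>R b)) \<le> R' + norm b"
    proof -
      have "norm (t *\<^sub>R ((1 / Suc i) *\<^sub>R b)) = (t * (1 / Suc i)) * norm b" using t by simp
      also have "\<dots> \<le> 1 * norm b" using t by (intro mult_right_mono) (auto simp: divide_simps)
      finally show ?thesis using True norm_triangle_ineq[of x "t *\<^sub>R ((1 / Suc i) *\<^sub>R b)"] by simp
    qed
    ultimately show ?thesis using M[of "x + t *\<^sub>R ((1 / Suc i) *\<^sub>R b)"] True by simp
  next
    case False
    have "norm ((1 / Suc i) *\<^sub>R b) \<le> norm b" by (simp add: divide_simps mult_left_le) (simp add: algebra_simps)
    then have "norm (x + (1 / Suc i) *\<^sub>R b) \<ge> R"
      using False norm_diff_ineq[of x "(1 / Suc i) *\<^sub>R b"] by (simp add: R'_def)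
    moreover have "norm x \<ge> R"
    proof -
      have "norm x > R + norm b" using False by (simp add: R'_def)
      then show ?thesis using norm_ge_zero[of b] by linarith
    qed
    ultimately have "x + (1 / Suc i) *\<^sub>R b \<notin> K" "x \<notin> K"
      using R(2) mem_ball_0 by (force simp: subset_eq)+
    then have "F (x + (1 / Suc i) *\<^sub>R b) = 0" "F x = 0"
      using K(2) by blast+
    then have "q i x = 0" by (simp add: q_def)
    then show ?thesis using False by simp
  qed
  have Fint: "integrable lborel F"
  proof -
    have "(\<lambda>x. indicator K x *\<^sub>R F x) = F"
      using K(2) by (force simp: fun_eq_iff indicator_def)
    then show ?thesis
      using borel_integrable_compact[OF K(1) continuous_on_subset[OF contF]] by simp
  qed
  have "(\<lambda>i. LINT x|lborel. q i x) \<longlonglongrightarrow> (LINT x|lborel. D x)"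
  proof (rule integral_dominated_convergence[where w="\<lambda>x. indicator (cball 0 R') x * M"])
    show "D \<in> borel_measurable lborel" using borel_measurable_continuous_onI[OF contD] by simp
    have [measurable]: "F \<in> borel_measurable borel" using borel_measurable_continuous_onI[OF contF] by simp
    show "q i \<in> borel_measurable lborel" for i unfolding q_def by measurable
    show "integrable lborel (\<lambda>x. indicator (cball 0 R') x * M)"
      using borel_integrable_compact[OF compact_cball continuous_on_const, of 0 R' M] by simp
  qed (use lim bound in auto)
  moreover have "(LINT x|lborel. q i x) = 0" for i
  proof -
    have e: "(LINT x|lborel. F (x + (1 / Suc i) *\<^sub>R b)) = (LINT x|lborel. F x)"
      "integrable lborel (\<lambda>x. F (x + (1 / Suc i) *\<^sub>R b))"
    proof -
      have "lborel = distr lborel borel (\<lambda>x. x + (1 / Suc i) *\<^sub>R b)"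
        using lborel_distr_plus[of "(1 / Suc i) *\<^sub>R b"]
        by (simp add: add.commute[of _ "(1 / (1 + real i)) *\<^sub>R b"])
      moreover have [measurable]: "F \<in> borel_measurable borel" using borel_measurable_continuous_onI[OF contF] by simp
      ultimately show "(LINT x|lborel. F (x + (1 / Suc i) *\<^sub>R b)) = (LINT x|lborel. F x)"
        "integrable lborel (\<lambda>x. F (x + (1 / Suc i) *\<^sub>R b))"
        using Fint integral_distr[of "\<lambda>x. x + (1 / Suc i) *\<^sub>R b" lborel borel F]
          integrable_distr_eq[of "\<lambda>x. x + (1 / Suc i) *\<^sub>R b" lborel borel F] by auto
    qed
    show ?thesis unfolding q_def using e Fint by simp
  qed
  ultimately have "(LINT x|lborel. D x) = 0"
    by (simp add: LIMSEQ_const_iff)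
  moreover have "(LINT x|lebesgue. D x) = (LINT x|lborel. D x)"
    using borel_measurable_continuous_onI[OF contD] by (intro integral_completion) auto
  ultimately show ?thesis by (simp add: D_def)
qed

lemma test_function_C1: assumes "test_function \<Omega> u" shows "C1_on UNIV u"
proof -
  have "C_k (Suc 0) u" using assms unfolding test_function_def by blast
  then have d: "u differentiable_on UNIV" "\<And>b. b \<in> Basis \<Longrightarrow> continuous_on UNIV (\<lambda>x. frechet_derivative u (at x) b)"
    by auto
  have D: "(u has_derivative frechet_derivative u (at x)) (at x)" for x
    using d(1) by (simp add: differentiable_on_def frechet_derivative_works)
  show ?thesis
  proof (rule C1_onI[OF D])
    fix v :: 'a
    have "frechet_derivative u (at x) v = (\<Sum>b\<in>Basis. (v \<bullet> b) * frechet_derivative u (at x) b)" for x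
      by (subst euclidean_representation[of v, symmetric],
          simp add: linear_sum[OF has_derivative_linear[OF D]] linear_scale[OF has_derivative_linear[OF D]] del: euclidean_representation)
    then show "continuous_on UNIV (\<lambda>x. frechet_derivative u (at x) v)"
      using d(2) by (auto intro!: continuous_intros)
  qed
qed

text \<open>The product of \<open>f\<close> with a test function, extended by zero, is of class C1 on the whole space with
  compact support, so that the integral of its derivative is zero.\<close>

lemma C1_has_weak_deriv:
  assumes \<Omega>: "open \<Omega>" and f: "C1_on \<Omega> f"
  shows "has_weak_deriv \<Omega> b f (\<lambda>x. frechet_derivative f (at x) b)"
  unfolding has_weak_deriv_def
proof (intro conjI allI impI)
  show "locally_integrable \<Omega> f" "locally_integrable \<Omega> (\<lambda>x. frechet_derivative f (at x) b)"
    using f by (auto intro!: continuous_locally_integrable C1_on_continuous C1_on_frechet)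
next
  fix u assume u: "test_function \<Omega> u"
  define K where "K = closure {x. u x \<noteq> 0}"
  have K: "compact K" "K \<subseteq> \<Omega>" "\<And>x. x \<notin> K \<Longrightarrow> u x = 0"
    using u closure_subset[of "{x. u x \<noteq> 0}"] by (auto simp: test_function_def K_def)
  note u1 = test_function_C1[OF u]
  define F where "F = (\<lambda>x. if x \<in> \<Omega> then f x * u x else 0)"
  have du0: "frechet_derivative u (at x) v = 0" if "x \<notin> K" for x v
  proof -
    have "(u has_derivative (\<lambda>_. 0)) (at x)"
      by (rule has_derivative_transform_within_open[of "\<lambda>_. 0" _ x UNIV "- K"])
         (use that K in \<open>auto intro: compact_imp_closed\<close>)
    from frechet_derivative_at[OF this, symmetric] show ?thesis by simp
  qed
  have FC1: "C1_on UNIV F"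
  proof (rule C1_on_local)
    fix x :: 'a
    show "\<exists>U g. open U \<and> x \<in> U \<and> C1_on U g \<and> (\<forall>y\<in>U. F y = g y)"
    proof (cases "x \<in> K")
      case True
      then show ?thesis using \<Omega> K f C1_on_subset[OF u1]
        by (intro exI[of _ \<Omega>] exI[of _ "\<lambda>x. f x * u x"]) (auto simp: F_def intro!: C1_on_mult)
    next
      case False
      then show ?thesis using K
        by (intro exI[of _ "-K"] exI[of _ "\<lambda>x. 0"]) (auto simp: F_def C1_on_const intro: compact_imp_closed)
    qed
  qed
  have dF: "frechet_derivative F (at x) b = indicator \<Omega> x * (f x * frechet_derivative u (at x) b) + indicator \<Omega> x * (frechet_derivative f (at x) b * u x)" for x
  proof (cases "x \<in> \<Omega>")
    case True
    have "(F has_derivative (\<lambda>v. f x * frechet_derivative u (at x) v + frechet_derivative f (at x) v * u x)) (at x)"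
      by (rule has_derivative_transform_within_open[OF has_derivative_mult[OF C1_on_frechet(1)[OF f True] C1_on_frechet(1)[OF u1 UNIV_I]] \<Omega> True])
         (auto simp: F_def)
    from frechet_derivative_at[OF this] True show ?thesis by (simp add: fun_eq_iff)
  next
    case False
    then have "x \<notin> K" using K by auto
    have "(F has_derivative (\<lambda>_. 0)) (at x)"
      by (rule has_derivative_transform_within_open[of "\<lambda>_. 0" _ x UNIV "- K"])
         (use \<open>x \<notin> K\<close> K in \<open>auto intro: compact_imp_closed simp: F_def\<close>)
    from frechet_derivative_at[OF this, symmetric] False show ?thesis by simp
  qed
  have int: "integrable lebesgue (\<lambda>x. indicator \<Omega> x * g x)" if "continuous_on \<Omega> g" "\<And>x. x \<notin> K \<Longrightarrow> g x = 0" for g :: "'a \<Rightarrow> real"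
  proof -
    have "g absolutely_integrable_on K"
      using continuous_locally_integrable[OF that(1)] K unfolding locally_integrable_def by blast
    moreover have "(\<lambda>x. indicator K x *\<^sub>R g x) = (\<lambda>x. indicator \<Omega> x * g x)"
      using that(2) K by (auto simp: fun_eq_iff indicator_def)
    ultimately show ?thesis by (simp add: set_integrable_def)
  qed
  have "(LINT x|lebesgue. frechet_derivative F (at x) b) = 0"
    by (rule integral_directional_derivative_zero[OF FC1 K(1)]) (use K in \<open>auto simp: F_def\<close>)
  then have "(LINT x|lebesgue. indicator \<Omega> x * (f x * frechet_derivative u (at x) b)) + (LINT x|lebesgue. indicator \<Omega> x * (frechet_derivative f (at x) b * u x)) = 0"
    unfolding dF by (subst (asm) Bochner_Integration.integral_add)
      (auto intro!: int continuous_intros C1_on_continuous[OF f] C1_on_frechet(2)[OF f] C1_on_continuous[OF C1_on_subset[OF u1]] C1_on_frechet(2)[OF C1_on_subset[OF u1]] simp: du0 K)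
  then show "(LINT x:\<Omega>|lebesgue. f x * frechet_derivative u (at x) b) = - (LINT x:\<Omega>|lebesgue. frechet_derivative f (at x) b * u x)"
    by (simp add: set_lebesgue_integral_def)
qed

section \<open>Smooth bumps\<close>

fun smooth_order :: "nat \<Rightarrow> (real \<Rightarrow> real) \<Rightarrow> bool" where
  "smooth_order 0 g \<longleftrightarrow> True"
| "smooth_order (Suc k) g \<longleftrightarrow>
     (\<exists>g'. (\<forall>x. (g has_real_derivative g' x) (at x)) \<and> smooth_order k g')"

lemma smooth_order_Suc_imp: "smooth_order (Suc k) g \<Longrightarrow> smooth_order k g"
proof (induction k arbitrary: g)
  case (Suc k)
  obtain g' where "\<forall>x. (g has_real_derivative g' x) (at x)" "smooth_order (Suc k) g'"
    using Suc.prems by (subst (asm) smooth_order.simps) blast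
  then show ?case using Suc.IH by auto
qed simp

lemma smooth_order_const: "smooth_order k (\<lambda>_. c)"
proof (induction k arbitrary: c)
  case (Suc k)
  then show ?case by (auto intro!: exI[of _ "\<lambda>_. 0"])
qed simp

lemma smooth_order_add: "smooth_order k f \<Longrightarrow> smooth_order k g \<Longrightarrow> smooth_order k (\<lambda>x. f x + g x)"
proof (induction k arbitrary: f g)
  case (Suc k)
  then obtain f' g' where "\<forall>x. (f has_real_derivative f' x) (at x)" "smooth_order k f'"
    "\<forall>x. (g has_real_derivative g' x) (at x)" "smooth_order k g'" by auto
  then show ?case using Suc.IH by (auto intro!: exI[of _ "\<lambda>x. f' x + g' x"] derivative_intros)
qed simp

lemma smooth_order_mult: "smooth_order k f \<Longrightarrow> smooth_order k g \<Longrightarrow> smooth_order k (\<lambda>x. f x * g x)"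
proof (induction k arbitrary: f g)
  case (Suc k)
  then obtain f' g' where *: "\<forall>x. (f has_real_derivative f' x) (at x)" "smooth_order k f'"
    "\<forall>x. (g has_real_derivative g' x) (at x)" "smooth_order k g'" by auto
  have "((\<lambda>x. f x * g x) has_real_derivative (f' x * g x + g' x * f x)) (at x)" for x
    using * by (intro DERIV_mult) auto
  moreover have "smooth_order k (\<lambda>x. f' x * g x + g' x * f x)"
    using * Suc.prems[THEN smooth_order_Suc_imp] by (intro smooth_order_add Suc.IH)
  ultimately show ?case
    unfolding smooth_order.simps by (intro exI[of _ "\<lambda>x. f' x * g x + g' x * f x"]) simp
qed simp

lemma smooth_order_affine: "smooth_order k f \<Longrightarrow> smooth_order k (\<lambda>x. f (a * x + c))"
proof (induction k arbitrary: f)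
  case (Suc k)
  then obtain f' where *: "\<forall>x. (f has_real_derivative f' x) (at x)" "smooth_order k f'" by auto
  have "((\<lambda>x. f (a * x + c)) has_real_derivative (f' (a * x + c) * a)) (at x)" for x
  proof -
    have "((\<lambda>x. a * x + c) has_real_derivative a) (at x)" by (auto intro!: derivative_eq_intros)
    from DERIV_chain2[OF _ this] * show ?thesis by auto
  qed
  moreover have "smooth_order k (\<lambda>x. f' (a * x + c) * a)"
    using * by (intro smooth_order_mult smooth_order_const Suc.IH)
  ultimately show ?case
    unfolding smooth_order.simps by (intro exI[of _ "\<lambda>x. f' (a * x + c) * a"]) simp
qed simp

text \<open>The functions \<open>x\<^sup>-\<^sup>m exp (-1/x)\<close>, continued by 0 to the left. Taking all \<open>m\<close> at once makes the family closed under
  derivatives up to linear combination.\<close>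

definition flat :: "nat \<Rightarrow> real \<Rightarrow> real" where
  "flat m x = (if 0 < x then (1 / x) ^ m * exp (- (1 / x)) else 0)"

lemma flat_over_tendsto_0: "((\<lambda>x. flat m x / x) \<longlongrightarrow> 0) (at 0)"
proof -
  have "((\<lambda>x::real. (1 / x) ^ Suc m / exp (1 / x)) \<longlongrightarrow> 0) (at_right 0)"
    using tendsto_power_div_exp_0[of "Suc m"] filterlim_inverse_at_top_right
    unfolding inverse_eq_divide by (rule filterlim_compose)
  moreover have "\<forall>\<^sub>F x in at_right 0. (1 / x) ^ Suc m / exp (1 / x) = flat m x / x"
    by (auto simp: eventually_at_right_field flat_def exp_minus field_simps intro!: exI[of _ 1])
  ultimately have R: "((\<lambda>x. flat m x / x) \<longlongrightarrow> 0) (at_right 0)"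
    by (rule Lim_transform_eventually)
  have "\<forall>\<^sub>F x in at_left 0. 0 = flat m x / x"
    by (auto simp: eventually_at_left_field flat_def intro!: exI[of _ "-1"])
  then have "((\<lambda>x. flat m x / x) \<longlongrightarrow> 0) (at_left 0)"
    by (rule Lim_transform_eventually[OF tendsto_const])
  with R show ?thesis by (simp add: filterlim_split_at)
qed

lemma flat_has_derivative:
  "(flat m has_real_derivative (flat (m + 2) x - real m * flat (m + 1) x)) (at x)"
proof -
  consider "x < 0" | "x = 0" | "x > 0" by linarith
  then show ?thesis
  proof cases
    case 1
    have "((\<lambda>_. 0) has_real_derivative 0) (at x)" by simp
    then have "(flat m has_real_derivative 0) (at x)"
      by (rule has_field_derivative_transform_within_open[where S="{..<0}"]) (use 1 in \<open>auto simp: flat_def\<close>)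
    then show ?thesis using 1 by (simp add: flat_def)
  next
    case 2
    then show ?thesis using flat_over_tendsto_0[of m] by (simp add: DERIV_def flat_def)
  next
    case 3
    have "((\<lambda>x. (1 / x) ^ m * exp (- (1 / x))) has_real_derivative
       (real m * (1 / x) ^ (m - 1) * (- 1 / x\<^sup>2)) * exp (- (1 / x)) + (exp (- (1 / x)) * (1 / x\<^sup>2)) * (1 / x) ^ m) (at x)"
      using 3 by (auto intro!: derivative_eq_intros simp: power2_eq_square)
    moreover have "(real m * (1 / x) ^ (m - 1) * (- 1 / x\<^sup>2)) * exp (- (1 / x)) + (exp (- (1 / x)) * (1 / x\<^sup>2)) * (1 / x) ^ m
       = flat (m + 2) x - real m * flat (m + 1) x"
      using 3 by (cases m) (simp_all add: flat_def power2_eq_square field_simps power_add)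
    ultimately have "((\<lambda>x. (1 / x) ^ m * exp (- (1 / x))) has_real_derivative flat (m + 2) x - real m * flat (m + 1) x) (at x)"
      by simp
    then show ?thesis
      by (rule has_field_derivative_transform_within_open[where S="{0<..}"]) (use 3 in \<open>auto simp: flat_def\<close>)
  qed
qed

lemma smooth_order_flat: "smooth_order k (flat m)"
proof (induction k arbitrary: m)
  case (Suc k)
  have "smooth_order k (\<lambda>x. flat (m + 2) x + (- real m) * flat (m + 1) x)"
    by (intro smooth_order_add smooth_order_mult smooth_order_const Suc.IH)
  then show ?case using flat_has_derivative[of m]
    by (auto intro!: exI[of _ "\<lambda>x. flat (m + 2) x - real m * flat (m + 1) x"])
qed simp

lemma smooth_deriv:
  assumes "\<And>k. smooth_order k g"
  shows "(g has_real_derivative deriv g x) (at x)" "smooth_order k (deriv g)"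
proof -
  have *: "\<exists>g'. (\<forall>x. (g has_real_derivative g' x) (at x)) \<and> smooth_order k g'" for k
    using assms[of "Suc k"] by simp
  then show "(g has_real_derivative deriv g x) (at x)" by (metis DERIV_imp_deriv)
  obtain g' where "\<forall>x. (g has_real_derivative g' x) (at x)" "smooth_order k g'" using * by blast
  moreover from this have "deriv g = g'" by (auto intro: DERIV_imp_deriv)
  ultimately show "smooth_order k (deriv g)" by simp
qed

text \<open>A partial derivative of a product of smooth functions of the single coordinates is a product of the
  same kind: only one factor changes, to its derivative. So the induction needs no sums.\<close>

lemma C_k_product:
  fixes p :: "'a::euclidean_space \<Rightarrow> real \<Rightarrow> real"
  assumes "\<And>i j. i \<in> Basis \<Longrightarrow> smooth_order j (p i)"
  shows "C_k k (\<lambda>z. \<Prod>i\<in>Basis. p i (z \<bullet> i))"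
  using assms
proof (induction k arbitrary: p)
  have D: "((\<lambda>z. \<Prod>i\<in>Basis. p i (z \<bullet> i)) has_derivative
      (\<lambda>y. \<Sum>i\<in>Basis. (deriv (p i) (z \<bullet> i) * (y \<bullet> i)) * (\<Prod>j\<in>Basis - {i}. p j (z \<bullet> j)))) (at z)"
    if p: "\<And>i j. i \<in> Basis \<Longrightarrow> smooth_order j (p i)" for p :: "'a \<Rightarrow> real \<Rightarrow> real" and z
  proof (rule has_derivative_prod)
    fix i :: 'a assume i: "i \<in> Basis"
    have "((\<lambda>z. z \<bullet> i) has_derivative (\<lambda>y. y \<bullet> i)) (at z)" by (auto intro!: derivative_eq_intros)
    from has_derivative_compose[OF this smooth_deriv(1)[OF p[OF i], unfolded has_field_derivative_def]]
    show "((\<lambda>z. p i (z \<bullet> i)) has_derivative (\<lambda>y. deriv (p i) (z \<bullet> i) * (y \<bullet> i))) (at z)" .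
  qed
  {
    case 0
    have "isCont (\<lambda>z. \<Prod>i\<in>Basis. p i (z \<bullet> i)) z" for z
      by (rule has_derivative_continuous[OF D[OF 0]])
    then show ?case by (simp add: continuous_at_imp_continuous_on)
  next
    case (Suc k)
    let ?u = "\<lambda>z. \<Prod>i\<in>Basis. p i (z \<bullet> i)"
    have "?u differentiable_on UNIV"
      unfolding differentiable_on_def differentiable_def using D[OF Suc.prems] by fast
    moreover have "C_k k (\<lambda>x. frechet_derivative ?u (at x) b)" if b: "b \<in> Basis" for b
    proof -
      define p' where "p' = p(b := deriv (p b))"
      have "frechet_derivative ?u (at x) b = (\<Prod>i\<in>Basis. p' i (x \<bullet> i))" for x
      proof -
        have "frechet_derivative ?u (at x) b = (\<Sum>i\<in>Basis. (deriv (p i) (x \<bullet> i) * (b \<bullet> i)) * (\<Prod>j\<in>Basis - {i}. p j (x \<bullet> j)))"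
          by (simp add: frechet_derivative_at[OF D[OF Suc.prems], symmetric])
        also have "\<dots> = (\<Sum>i\<in>Basis. if i = b then deriv (p b) (x \<bullet> b) * (\<Prod>j\<in>Basis - {b}. p j (x \<bullet> j)) else 0)"
          using b by (intro sum.cong) (auto simp: inner_Basis)
        also have "\<dots> = deriv (p b) (x \<bullet> b) * (\<Prod>j\<in>Basis - {b}. p j (x \<bullet> j))" using b by simp
        also have "\<dots> = (\<Prod>i\<in>Basis. p' i (x \<bullet> i))"
          using b by (subst prod.remove[of Basis b]) (auto simp: p'_def intro!: prod.cong)
        finally show ?thesis .
      qed
      moreover have "smooth_order j (p' i)" if "i \<in> Basis" for i j
        using Suc.prems smooth_deriv(2)[OF Suc.prems[OF b]] that by (auto simp: p'_def)
      ultimately show ?thesis using Suc.IH[of p'] by simp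
    qed
    ultimately show ?case by simp
  }
qed

text \<open>The factors are \<open>exp (-1/(j y))\<close> with \<open>y\<close> the distance to a face. They increase to 1 as \<open>j\<close> grows, so
  that these bumps approximate the indicator of the box.\<close>

definition box_bump :: "'a::euclidean_space \<Rightarrow> 'a \<Rightarrow> nat \<Rightarrow> 'a \<Rightarrow> real" where
  "box_bump a b j z = (\<Prod>i\<in>Basis. flat 0 (Suc j * (z \<bullet> i - a \<bullet> i)) * flat 0 (Suc j * (b \<bullet> i - z \<bullet> i)))"

lemma box_bump_eq_0_iff: "box_bump a b j z = 0 \<longleftrightarrow> z \<notin> box a b"
proof -
  have "flat 0 (Suc j * y) = 0 \<longleftrightarrow> y \<le> 0" for y :: real
    using mult_pos_pos[of "real (Suc j)" y] mult_nonneg_nonpos[of "real (Suc j)" y]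
    by (cases "y > 0") (auto simp: flat_def not_less simp del: of_nat_Suc)
  then show ?thesis by (auto simp: box_bump_def mem_box not_less)
qed

lemma box_bump_bounds: "0 \<le> box_bump a b j z" "box_bump a b j z \<le> 1"
proof -
  have f: "0 \<le> flat 0 x" "flat 0 x \<le> 1" for x by (auto simp: flat_def)
  show "0 \<le> box_bump a b j z" "box_bump a b j z \<le> 1"
    unfolding box_bump_def using f by (auto intro!: prod_nonneg prod_le_1 mult_le_one)
qed

lemma box_bump_tendsto: "(\<lambda>j. box_bump a b j z) \<longlonglongrightarrow> indicator (box a b) z"
proof (cases "z \<in> box a b")
  case True
  have f: "(\<lambda>j. flat 0 (real (Suc j) * c)) \<longlonglongrightarrow> 1" if "c > 0" for c
  proof -
    have "(\<lambda>j. exp (- ((1 / real (Suc j)) * (1 / c)))) \<longlonglongrightarrow> exp (- (0 * (1 / c)))"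
      by (intro tendsto_intros LIMSEQ_Suc[OF lim_1_over_n])
    then show ?thesis using that by (simp add: flat_def)
  qed
  have "(\<lambda>j. box_bump a b j z) \<longlonglongrightarrow> (\<Prod>i\<in>(Basis::'a set). 1 * 1)"
    unfolding box_bump_def by (intro tendsto_prod tendsto_mult f) (use True in \<open>auto simp: mem_box\<close>)
  then show ?thesis using True by simp
next
  case False
  then show ?thesis using box_bump_eq_0_iff[of a b _ z] by simp
qed

lemma test_function_box_bump:
  assumes "cbox a b \<subseteq> \<Omega>" shows "test_function \<Omega> (box_bump a b j)"
proof -
  have eq: "box_bump a b j = (\<lambda>z. \<Prod>i\<in>Basis. (\<lambda>y. flat 0 (Suc j * y + (- Suc j * (a \<bullet> i))) * flat 0 ((- Suc j) * y + Suc j * (b \<bullet> i))) (z \<bullet> i))"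
    by (auto simp: box_bump_def fun_eq_iff algebra_simps)
  have "C_k k (box_bump a b j)" for k
    unfolding eq by (intro C_k_product smooth_order_mult smooth_order_affine smooth_order_flat)
  moreover have "{x. box_bump a b j x \<noteq> 0} = box a b" using box_bump_eq_0_iff[of a b j] by auto
  moreover have "closure (box a b) \<subseteq> cbox a b" by (intro closure_minimal box_subset_cbox closed_cbox)
  moreover have "compact (closure (box a b))" by (simp add: bounded_box)
  ultimately show ?thesis using assms by (auto simp: test_function_def)
qed

section \<open>Uniqueness of weak derivatives\<close>

text \<open>The measures with densities \<open>max 0 g\<close> and \<open>max 0 (-g)\<close> agree on boxes, which generate the Borel sets and are stable
  under intersection. Hence they are equal, and so are their densities.\<close>

lemma box_integrals_zero_AE:
  fixes g :: "'a::euclidean_space \<Rightarrow> real"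
  assumes g: "integrable lborel g" and z: "\<And>a b. (LINT x|lborel. indicator (box a b) x * g x) = 0"
  shows "AE x in lborel. g x = 0"
proof -
  have [measurable]: "g \<in> borel_measurable borel" using g by auto
  let ?p = "\<lambda>x. ennreal (g x)" and ?m = "\<lambda>x. ennreal (- g x)"
  have "density lborel ?p = density lborel ?m"
  proof (rule measure_eqI_generator_eq)
    let ?E = "range (\<lambda>(a, b). box a b::'a set)"
    show "Int_stable ?E" by (auto simp: Int_stable_def box_Int_box)
    show "?E \<subseteq> Pow UNIV" "sets (density lborel ?p) = sigma_sets UNIV ?E" "sets (density lborel ?m) = sigma_sets UNIV ?E"
      by (simp_all add: borel_eq_box)
    let ?A = "\<lambda>n::nat. box (- (real n *\<^sub>R One)) (real n *\<^sub>R One) :: 'a set"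
    show "range ?A \<subseteq> ?E" "(\<Union>i. ?A i) = UNIV" unfolding UN_box_eq_UNIV by auto
    have fin: "(\<integral>\<^sup>+x. ennreal (max 0 (g x)) * indicator X x \<partial>lborel) \<noteq> \<infinity>" for X
    proof -
      have "(\<integral>\<^sup>+x. ennreal (max 0 (g x)) * indicator X x \<partial>lborel) \<le> (\<integral>\<^sup>+x. ennreal \<bar>g x\<bar> \<partial>lborel)"
        by (intro nn_integral_mono) (auto simp: indicator_def ennreal_leI)
      also have "\<dots> < \<infinity>" using g by (simp add: integrable_iff_bounded)
      finally show ?thesis by simp
    qed
    have max0: "ennreal (max 0 y) = ennreal y" for y :: real
      by (simp add: max_def ennreal_neg)
    then show "emeasure (density lborel ?p) (?A i) \<noteq> \<infinity>" for i
      using fin by (simp add: emeasure_density)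
    fix X assume "X \<in> ?E"
    then obtain a b where X: "X = box a b" by auto
    have i: "integrable lborel (\<lambda>x. indicator X x * g x)"
      using integrable_mult_indicator[OF _ g, of X] X by simp
    have ip: "integrable lborel (\<lambda>x. indicator X x * max 0 (g x))" "integrable lborel (\<lambda>x. indicator X x * max 0 (- g x))"
      by (rule Bochner_Integration.integrable_bound[OF i]; use X in \<open>auto simp: indicator_def\<close>)+
    have "(LINT x|lborel. indicator X x * max 0 (g x)) - (LINT x|lborel. indicator X x * max 0 (- g x)) = (LINT x|lborel. indicator X x * g x)"
      by (subst Bochner_Integration.integral_diff[OF ip, symmetric]) (auto intro!: Bochner_Integration.integral_cong simp: indicator_def)
    then have e: "(LINT x|lborel. indicator X x * max 0 (g x)) = (LINT x|lborel. indicator X x * max 0 (- g x))"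
      using z X by simp
    have "(\<integral>\<^sup>+x. ennreal (indicator X x * max 0 (g x)) \<partial>lborel) = (\<integral>\<^sup>+x. ennreal (indicator X x * max 0 (- g x)) \<partial>lborel)"
      using ip e by (subst (1 2) nn_integral_eq_integral) auto
    then show "emeasure (density lborel ?p) X = emeasure (density lborel ?m) X"
      using X by (simp add: emeasure_density max0 ennreal_mult' mult.commute ennreal_indicator)
  qed
  then have "AE x in lborel. ?p x = ?m x"
    by (subst (asm) sigma_finite_measure.density_unique_iff[OF lborel.sigma_finite_measure_axioms]) auto
  then show ?thesis
  proof eventually_elim
    case (elim x)
    then show "g x = 0" by (cases "g x \<ge> 0") (auto simp: ennreal_neg not_le ennreal_eq_0_iff)
  qed
qed

text \<open>Testing with \<open>box_bump\<close> and letting it tend to the indicator shows that the integral of \<open>g\<close> vanishes over each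
  box whose closure lies in \<open>\<Omega>\<close>; countably many such boxes exhaust \<open>\<Omega>\<close>.\<close>

lemma annihilator_of_test_functions_AE:
  fixes g :: "'a::euclidean_space \<Rightarrow> real"
  assumes \<Omega>: "open \<Omega>" and g: "locally_integrable \<Omega> g"
    and z: "\<And>u. test_function \<Omega> u \<Longrightarrow> (LINT x:\<Omega>|lebesgue. g x * u x) = 0"
  shows "AE x in lebesgue. x \<in> \<Omega> \<longrightarrow> g x = 0"
proof -
  have box0: "(LINT x|lebesgue. indicator (box a b) x * g x) = 0" if ab: "cbox a b \<subseteq> \<Omega>" for a b
  proof -
    have gi: "integrable lebesgue (\<lambda>x. indicator (cbox a b) x * g x)"
      using g ab by (auto simp: locally_integrable_def set_integrable_def)
    have eq: "indicator \<Omega> x * (g x * box_bump a b j x) = indicator (cbox a b) x * g x * box_bump a b j x" for j x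
      using box_bump_eq_0_iff[of a b j x] ab box_subset_cbox[of a b] by (auto simp: indicator_def)
    have [measurable]: "box_bump a b j \<in> borel_measurable borel" for j
      by (intro borel_measurable_continuous_onI C1_on_continuous test_function_C1[OF test_function_box_bump[of _ _ UNIV]] subset_UNIV)
    have "(\<lambda>j. LINT x|lebesgue. indicator (cbox a b) x * g x * box_bump a b j x) \<longlonglongrightarrow> (LINT x|lebesgue. indicator (cbox a b) x * g x * indicator (box a b) x)"
    proof (rule integral_dominated_convergence[where w="\<lambda>x. \<bar>indicator (cbox a b) x * g x\<bar>"])
      note [measurable] = borel_measurable_integrable[OF gi]
      show "(\<lambda>x. indicator (cbox a b) x * g x * box_bump a b j x) \<in> borel_measurable lebesgue" for j
        by (rule borel_measurable_times[OF borel_measurable_integrable[OF gi]]) (simp add: measurable_completion)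
      show "(\<lambda>x. indicator (cbox a b) x * g x * indicator (box a b) x) \<in> borel_measurable lebesgue"
        by (rule borel_measurable_times[OF borel_measurable_integrable[OF gi]], rule borel_measurable_indicator) simp
      show "AE x in lebesgue. norm (indicator (cbox a b) x * g x * box_bump a b j x) \<le> \<bar>indicator (cbox a b) x * g x\<bar>" for j
        using box_bump_bounds[of a b j] by (auto simp: abs_mult intro!: mult_left_le)
    qed (use gi in \<open>auto intro!: tendsto_mult_left box_bump_tendsto\<close>)
    moreover have "(LINT x|lebesgue. indicator (cbox a b) x * g x * box_bump a b j x) = 0" for j
      using z[OF test_function_box_bump[OF ab, of j]] by (simp add: set_lebesgue_integral_def eq)
    moreover have "indicator (cbox a b) x * g x * indicator (box a b) x = indicator (box a b) x * g x" for x
      using box_subset_cbox[of a b] by (auto simp: indicator_def)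
    ultimately show ?thesis by (simp add: LIMSEQ_const_iff)
  qed
  have AEbox: "AE x in lebesgue. x \<in> cbox c d \<longrightarrow> g x = 0" if cd: "cbox c d \<subseteq> \<Omega>" for c d
  proof -
    define G where "G = (\<lambda>x. indicator (box c d) x * g x)"
    have Gi: "integrable lebesgue G"
    proof -
      have "integrable lebesgue (\<lambda>x. indicator (cbox c d) x * g x)"
        using g cd by (auto simp: locally_integrable_def set_integrable_def)
      from integrable_mult_indicator[OF _ this, of "box c d"]
      have "integrable lebesgue (\<lambda>x. indicator (box c d) x * (indicator (cbox c d) x * g x))" by simp
      moreover have "indicator (box c d) x * (indicator (cbox c d) x * g x) = G x" for x
        using box_subset_cbox[of c d] by (auto simp: indicator_def G_def)
      ultimately show ?thesis by simp
    qed
    obtain G' where G': "G' \<in> borel_measurable lborel" "AE x in lborel. G x = G' x"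
      using completion_ex_borel_measurable_real[OF borel_measurable_integrable[OF Gi]] by auto
    have AE': "AE x in lebesgue. G x = G' x" using G'(2) by (rule AE_completion)
    have G'm: "G' \<in> borel_measurable lebesgue" using G'(1) by (simp add: measurable_completion)
    have G'i: "integrable lborel G'"
      using integrable_cong_AE[THEN iffD1, OF borel_measurable_integrable[OF Gi] G'm AE' Gi]
        integrable_completion[OF G'(1)] by simp
    have "AE x in lborel. G' x = 0"
    proof (rule box_integrals_zero_AE[OF G'i])
      fix a b
      have "(LINT x|lborel. indicator (box a b) x * G' x) = (LINT x|lebesgue. indicator (box a b) x * G' x)"
        using G'(1) by (intro integral_completion[symmetric]) auto
      also have "\<dots> = (LINT x|lebesgue. indicator (box a b) x * G x)"
        by (rule integral_cong_AE) (use AE' Gi G'm in \<open>auto intro!: borel_measurable_times borel_measurable_indicator\<close>)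
      also have "\<dots> = (LINT x|lebesgue. indicator (box a b \<inter> box c d) x * g x)"
        by (simp add: G_def indicator_inter_arith mult.assoc)
      also have "\<dots> = 0"
      proof (cases "box a b \<inter> box c d = {}")
        case False
        then show ?thesis unfolding box_Int_box
        proof (intro box0)
          let ?a = "\<Sum>i\<in>Basis. max (a \<bullet> i) (c \<bullet> i) *\<^sub>R i" and ?b = "\<Sum>i\<in>Basis. min (b \<bullet> i) (d \<bullet> i) *\<^sub>R i"
          have "cbox ?a ?b \<subseteq> cbox c d" by (auto simp: mem_box)
          then show "cbox ?a ?b \<subseteq> \<Omega>" using cd by blast
        qed
      qed simp
      finally show "(LINT x|lborel. indicator (box a b) x * G' x) = 0" .
    qed
    then have "AE x in lebesgue. G' x = 0" by (rule AE_completion)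
    moreover have "AE x in lebesgue. x \<notin> cbox c d - box c d"
      using negligible_frontier_interval[of c d] by (intro AE_not_in) (simp add: negligible_iff_null_sets)
    ultimately show ?thesis using AE'
      by eventually_elim (auto simp: G_def indicator_def split: if_splits)
  qed
  obtain D where D: "countable D" "D \<subseteq> Pow \<Omega>" "\<And>X. X \<in> D \<Longrightarrow> \<exists>a b. X = cbox a b" "\<Union>D = \<Omega>"
    by (rule open_countable_Union_open_cbox[OF \<Omega>]) blast
  have "AE x in lebesgue. \<forall>X\<in>D. x \<in> X \<longrightarrow> g x = 0"
    by (subst AE_ball_countable[OF D(1)]) (use D(2,3) AEbox in \<open>metis PowD subsetD\<close>)
  then show ?thesis using D(4) by (auto elim!: eventually_mono)
qed

lemma has_weak_deriv_unique:
  assumes \<Omega>: "open \<Omega>" and g: "has_weak_deriv \<Omega> b f g1" "has_weak_deriv \<Omega> b f g2"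
  shows "AE x in lebesgue. x \<in> \<Omega> \<longrightarrow> g1 x = g2 x"
proof -
  have li: "locally_integrable \<Omega> g1" "locally_integrable \<Omega> g2" using g by (auto simp: has_weak_deriv_def)
  have "AE x in lebesgue. x \<in> \<Omega> \<longrightarrow> g1 x - g2 x = 0"
  proof (rule annihilator_of_test_functions_AE[OF \<Omega>])
    show "locally_integrable \<Omega> (\<lambda>x. g1 x - g2 x)"
      using li unfolding locally_integrable_def by (auto intro: set_integral_diff(1))
    fix u assume u: "test_function \<Omega> u"
    define K where "K = closure {x. u x \<noteq> 0}"
    have K: "compact K" "K \<subseteq> \<Omega>" "\<And>x. x \<notin> K \<Longrightarrow> u x = 0"
      using u closure_subset[of "{x. u x \<noteq> 0}"] by (auto simp: test_function_def K_def)
    have cu: "continuous_on UNIV u" by (rule C1_on_continuous[OF test_function_C1[OF u]])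
    obtain M where M: "\<And>x. \<bar>u x\<bar> \<le> M"
    proof -
      obtain M where "\<And>x. x \<in> K \<Longrightarrow> \<bar>u x\<bar> \<le> M"
        using compact_continuous_image[OF continuous_on_subset[OF cu] K(1)]
        by (fastforce dest!: compact_imp_bounded simp: bounded_iff)
      then have "\<bar>u x\<bar> \<le> max M 0" for x using K(3)[of x] by (cases "x \<in> K") (auto simp: le_max_iff_disj)
      then show ?thesis using that by blast
    qed
    have int: "set_integrable lebesgue \<Omega> (\<lambda>x. g x * u x)" if "locally_integrable \<Omega> g" for g :: "'a \<Rightarrow> real"
    proof -
      have gi: "integrable lebesgue (\<lambda>x. indicator K x * g x)"
        using that K by (auto simp: locally_integrable_def set_integrable_def)
      have "integrable lebesgue (\<lambda>x. indicator K x * g x * u x)"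
      proof (rule Bochner_Integration.integrable_bound)
        show "integrable lebesgue (\<lambda>x. M * (indicator K x * g x))" using gi by simp
        show "(\<lambda>x. indicator K x * g x * u x) \<in> borel_measurable lebesgue"
          by (rule borel_measurable_times[OF borel_measurable_integrable[OF gi]])
             (use borel_measurable_continuous_onI[OF cu] in \<open>simp add: measurable_completion\<close>)
        show "AE x in lebesgue. norm (indicator K x * g x * u x) \<le> norm (M * (indicator K x * g x))"
        proof -
          have "\<bar>g x\<bar> * \<bar>u x\<bar> \<le> \<bar>M\<bar> * \<bar>g x\<bar>" for x
            using mult_left_mono[of "\<bar>u x\<bar>" "\<bar>M\<bar>" "\<bar>g x\<bar>"] M[of x] by (simp add: mult.commute)
          then show ?thesis by (auto simp: abs_mult indicator_def)
        qed
      qed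
      moreover have "indicator K x * g x * u x = indicator \<Omega> x * (g x * u x)" for x
        using K by (auto simp: indicator_def)
      ultimately show ?thesis by (simp add: set_integrable_def)
    qed
    have "(LINT x:\<Omega>|lebesgue. g1 x * u x) = (LINT x:\<Omega>|lebesgue. g2 x * u x)"
      using g u unfolding has_weak_deriv_def by (metis neg_equal_iff_equal)
    then show "(LINT x:\<Omega>|lebesgue. (g1 x - g2 x) * u x) = 0"
      using set_integral_diff(2)[OF int[OF li(1)] int[OF li(2)]] by (simp add: left_diff_distrib)
  qed
  then show ?thesis by simp
qed

lemma weak_deriv_C1_AE:
  assumes "open \<Omega>" "C1_on \<Omega> f"
  shows "AE x in lebesgue. x \<in> \<Omega> \<longrightarrow> weak_deriv \<Omega> b f x = frechet_derivative f (at x) b"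
proof (rule has_weak_deriv_unique[OF assms(1)])
  show d: "has_weak_deriv \<Omega> b f (\<lambda>x. frechet_derivative f (at x) b)" by (rule C1_has_weak_deriv[OF assms])
  show "has_weak_deriv \<Omega> b f (weak_deriv \<Omega> b f)" unfolding weak_deriv_def by (rule someI[of "has_weak_deriv \<Omega> b f", OF d])
qed

text \<open>The norm involves an arbitrarily chosen weak derivative; for C1 functions it can be computed with the
  classical one.\<close>

lemma W11_norm_C1:
  assumes "open \<Omega>" "C1_on \<Omega> f"
  shows "W11_norm \<Omega> \<gamma> f = (\<integral>\<^sup>+ z\<in>\<Omega>. ennreal \<bar>\<gamma> z * f z\<bar> \<partial>lebesgue) +
     (\<Sum>b\<in>Basis. \<integral>\<^sup>+ z\<in>\<Omega>. ennreal \<bar>\<gamma> z * frechet_derivative f (at z) b\<bar> \<partial>lebesgue)"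
proof -
  have "(\<integral>\<^sup>+ z\<in>\<Omega>. ennreal \<bar>\<gamma> z * weak_deriv \<Omega> b f z\<bar> \<partial>lebesgue) = (\<integral>\<^sup>+ z\<in>\<Omega>. ennreal \<bar>\<gamma> z * frechet_derivative f (at z) b\<bar> \<partial>lebesgue)" for b
    by (rule nn_integral_cong_AE, use weak_deriv_C1_AE[OF assms, of b] in eventually_elim) (auto simp: indicator_def)
  then show ?thesis by (simp add: W11_norm_def)
qed

section \<open>Cubes\<close>

lemma One_cart: "(One :: real^'n) $ i = 1"
  using cart_eq_inner_axis[of "One :: real^'n" i]
  by (simp add: inner_sum_left inner_Basis axis_in_Basis_iff del: sum_component)

lemma mem_ocube_cart: "x \<in> ocube z r \<longleftrightarrow> (\<forall>i. \<bar>x $ i - z $ i\<bar> < r / 2)" for x z :: "real^'n"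
proof -
  have "(a - r / 2 < b \<and> b < a + r / 2) \<longleftrightarrow> \<bar>b - a\<bar> < r / 2" for a b r :: real by linarith
  then show ?thesis by (simp add: ocube_def mem_box_cart One_cart del: sum_component)
qed

lemma box_Pair: "box (a, c) (b, d) = box a b \<times> box c d"
  for a b :: "'a::euclidean_space" and c d :: "'b::euclidean_space"
  by (force simp: mem_box Basis_prod_def)

lemma One_Pair: "(One :: 'a::euclidean_space \<times> real) = (One, 1)"
proof (rule euclidean_eqI)
  fix b :: "'a \<times> real" assume b: "b \<in> Basis"
  have "(One, 1 :: real) \<bullet> b = 1"
    using b unfolding Basis_prod_def by (auto simp: inner_sum_left inner_Basis)
  then show "One \<bullet> b = (One, 1) \<bullet> b"
    using b by (simp add: inner_sum_left inner_Basis)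
qed

lemma ocube_mono: "r \<le> r' \<Longrightarrow> ocube z r \<subseteq> ocube z r'"
proof
  fix x assume r: "r \<le> r'" and x: "x \<in> ocube z r"
  show "x \<in> ocube z r'" unfolding ocube_def mem_box
  proof (intro ballI conjI)
    fix i :: 'a assume i: "i \<in> Basis"
    have "z \<bullet> i - r / 2 < x \<bullet> i" "x \<bullet> i < z \<bullet> i + r / 2"
      using x i by (auto simp: ocube_def mem_box inner_simps)
    then show "(z - (r' / 2) *\<^sub>R One) \<bullet> i < x \<bullet> i" "x \<bullet> i < (z + (r' / 2) *\<^sub>R One) \<bullet> i"
      using r i by (auto simp: inner_simps)
  qed
qed

lemma ocube_Pair: "ocube (x, t) r = ocube x r \<times> {t - r / 2<..<t + r / 2}"
  for x :: "'a::euclidean_space"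
  unfolding ocube_def One_Pair by (simp add: box_Pair box_real)

lemma emeasure_ocube: "0 \<le> r \<Longrightarrow> emeasure lborel (ocube z r) = ennreal (r ^ DIM('a))"
  for z :: "'a::euclidean_space"
  unfolding ocube_def
  by (simp add: emeasure_lborel_box_eq inner_simps field_simps)

lemma ocube_sets [simp]: "ocube z r \<in> sets lebesgue" "ocube z r \<in> sets borel"
  unfolding ocube_def by simp_all

lemma measure_ocube: "0 \<le> r \<Longrightarrow> measure lborel (ocube z r) = r ^ DIM('a)"
  for z :: "'a::euclidean_space"
  by (simp add: measure_def emeasure_ocube)

lemma dyadic_side_pos [simp]: "0 < dyadic_side \<alpha>" and dyadic_side_le_1: "dyadic_side \<alpha> \<le> 1"
  and dyadic_side_neq [simp]: "dyadic_side \<alpha> \<noteq> 0" and dyadic_side_nonneg [simp]: "0 \<le> dyadic_side \<alpha>"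
  by (simp_all add: dyadic_side_def)

lemma dyadic_cube_ocube: "dyadic_cube \<alpha> = ocube (dyadic_centre \<alpha>) (dyadic_side \<alpha>)"
  using enlarged_0[of \<alpha>] by (simp add: enlarged_def)

lemma mem_enlarged: "x \<in> enlarged lam \<alpha> \<longleftrightarrow> (\<forall>i. \<bar>x $ i - dyadic_centre \<alpha> $ i\<bar> < (1 + lam) * dyadic_side \<alpha> / 2)"
  by (simp add: enlarged_def mem_ocube_cart)

lemma mem_dyadic_cube: "x \<in> dyadic_cube \<alpha> \<longleftrightarrow> (\<forall>i. \<bar>x $ i - dyadic_centre \<alpha> $ i\<bar> < dyadic_side \<alpha> / 2)"
  by (simp add: dyadic_cube_ocube mem_ocube_cart)

lemma centre_in_dyadic_cube [simp]: "dyadic_centre \<alpha> \<in> dyadic_cube \<alpha>"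
  by (simp add: mem_dyadic_cube)

lemma closure_dyadic_cube: "closure (dyadic_cube \<alpha>) = cbox (dyadic_centre \<alpha> - (dyadic_side \<alpha> / 2) *\<^sub>R One) (dyadic_centre \<alpha> + (dyadic_side \<alpha> / 2) *\<^sub>R One)"
  using centre_in_dyadic_cube[of \<alpha>] unfolding dyadic_cube_ocube ocube_def by (intro closure_box) auto

lemma mem_closure_dyadic_cube: "x \<in> closure (dyadic_cube \<alpha>) \<longleftrightarrow> (\<forall>i. \<bar>x $ i - dyadic_centre \<alpha> $ i\<bar> \<le> dyadic_side \<alpha> / 2)"
proof -
  have "(a - r / 2 \<le> b \<and> b \<le> a + r / 2) \<longleftrightarrow> \<bar>b - a\<bar> \<le> r / 2" for a b r :: real by linarith
  then show ?thesis by (simp add: closure_dyadic_cube mem_box_cart One_cart del: sum_component)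
qed

lemma interior_closure_dyadic_cube: "interior (closure (dyadic_cube \<alpha>)) = dyadic_cube \<alpha>"
  unfolding closure_dyadic_cube by (simp add: dyadic_cube_ocube ocube_def)

lemma closure_cube_subset_enlarged:
  fixes \<alpha> :: "'n::finite dyadic"
  shows "0 < lam \<Longrightarrow> closure (dyadic_cube \<alpha>) \<subseteq> enlarged lam \<alpha>"
  unfolding subset_iff mem_closure_dyadic_cube mem_enlarged
proof (intro allI impI)
  fix x :: "real^'n" and i
  assume l: "0 < lam" and x: "\<forall>i. \<bar>x $ i - dyadic_centre \<alpha> $ i\<bar> \<le> dyadic_side \<alpha> / 2"
  have "0 < lam * dyadic_side \<alpha>" using l by simp
  moreover have "\<bar>x $ i - dyadic_centre \<alpha> $ i\<bar> \<le> dyadic_side \<alpha> / 2" using x by blast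
  moreover have "(1 + lam) * dyadic_side \<alpha> / 2 = dyadic_side \<alpha> / 2 + lam * dyadic_side \<alpha> / 2"
    by (simp add: field_simps)
  ultimately show "\<bar>x $ i - dyadic_centre \<alpha> $ i\<bar> < (1 + lam) * dyadic_side \<alpha> / 2"
    by linarith
qed

lemma cube_subset_closure: "dyadic_cube \<alpha> \<subseteq> closure (dyadic_cube \<alpha>)" by (rule closure_subset)

lemma norm_le_of_components:
  fixes x :: "real^'n" assumes "\<And>i. \<bar>x $ i\<bar> \<le> M" shows "norm x \<le> real CARD('n) * M"
  using order_trans[OF norm_le_l1_cart sum_bounded_above[of UNIV "\<lambda>i. \<bar>x $ i\<bar>" M]] assms by simp

lemma ex_dyadic_cube: "\<exists>m. x \<in> closure (dyadic_cube (k, m))"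
proof (intro exI)
  show "x \<in> closure (dyadic_cube (k, \<chi> i. \<lfloor>2 ^ k * x $ i\<rfloor>))"
  proof -
    have "\<bar>x $ i - (of_int \<lfloor>2 ^ k * x $ i\<rfloor> + 1 / 2) / 2 ^ k\<bar> \<le> 1 / 2 ^ k / 2" for i
    proof -
      define y where "y = 2 ^ k * x $ i"
      have "\<bar>y - (of_int \<lfloor>y\<rfloor> + 1 / 2)\<bar> \<le> 1 / 2" by linarith
      then have "\<bar>y - (of_int \<lfloor>y\<rfloor> + 1 / 2)\<bar> / 2 ^ k \<le> (1 / 2) / 2 ^ k" by (rule divide_right_mono) simp
      moreover have "x $ i = y / 2 ^ k" by (simp add: y_def)
      ultimately show ?thesis by (simp add: y_def[symmetric] diff_divide_distrib[symmetric] mult.commute)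
    qed
    then show ?thesis by (simp add: mem_closure_dyadic_cube dyadic_centre_def dyadic_side_def)
  qed
qed

lemma card_int_vec_box:
  fixes S :: "'n::finite \<Rightarrow> int set"
  assumes "\<And>i. finite (S i)" "\<And>i. card (S i) \<le> M"
  shows "finite {m :: int^'n. \<forall>i. m $ i \<in> S i}" "card {m :: int^'n. \<forall>i. m $ i \<in> S i} \<le> M ^ CARD('n)"
proof -
  have inj: "inj_on vec_nth {m :: int^'n. \<forall>i. m $ i \<in> S i}" by (auto simp: inj_on_def vec_nth_inject)
  have sub: "vec_nth ` {m :: int^'n. \<forall>i. m $ i \<in> S i} \<subseteq> Pi\<^sub>E UNIV S" by auto
  have fin: "finite (Pi\<^sub>E UNIV S)" using assms by (intro finite_PiE) auto
  show "finite {m :: int^'n. \<forall>i. m $ i \<in> S i}" using inj_on_finite[OF inj sub fin] .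
  have "card {m :: int^'n. \<forall>i. m $ i \<in> S i} \<le> card (Pi\<^sub>E UNIV S)" by (rule card_inj_on_le[OF inj sub fin])
  also have "\<dots> = (\<Prod>i\<in>UNIV. card (S i))" by (simp add: card_PiE)
  also have "\<dots> \<le> M ^ CARD('n)" using assms prod_mono[of UNIV "\<lambda>i. card (S i)" "\<lambda>_. M"] by simp
  finally show "card {m :: int^'n. \<forall>i. m $ i \<in> S i} \<le> M ^ CARD('n)" .
qed

text \<open>This bounds the number of dyadic cubes of one generation near a point, independently of the generation. It
  is the source of all overlap constants.\<close>

lemma card_dyadic_near:
  fixes x :: "real^'n"
  shows "finite {m. \<forall>i. \<bar>x $ i - dyadic_centre (k, m) $ i\<bar> \<le> R * dyadic_side (k, m)}"
    "card {m. \<forall>i. \<bar>x $ i - dyadic_centre (k, m) $ i\<bar> \<le> R * dyadic_side (k, m)} \<le> (nat \<lceil>2 * R + 1\<rceil>) ^ CARD('n)"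
proof -
  define S where "S = (\<lambda>i. {\<lceil>2 ^ k * x $ i - 1 / 2 - R\<rceil>..\<lfloor>2 ^ k * x $ i - 1 / 2 + R\<rfloor>})"
  have eq: "\<bar>x $ i - dyadic_centre (k, m) $ i\<bar> \<le> R * dyadic_side (k, m) \<longleftrightarrow> m $ i \<in> S i" for m i
  proof -
    have "\<bar>x $ i - dyadic_centre (k, m) $ i\<bar> \<le> R * dyadic_side (k, m) \<longleftrightarrow> 2 ^ k * \<bar>x $ i - dyadic_centre (k, m) $ i\<bar> \<le> R"
      by (simp add: dyadic_side_def field_simps)
    also have "2 ^ k * \<bar>x $ i - dyadic_centre (k, m) $ i\<bar> = \<bar>2 ^ k * x $ i - (m $ i + 1 / 2)\<bar>"
      using abs_mult[of "2 ^ k" "x $ i - dyadic_centre (k, m) $ i"] by (simp add: dyadic_centre_def right_diff_distrib)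
    also have "\<dots> \<le> R \<longleftrightarrow> m $ i \<in> S i"
      by (auto simp: S_def abs_le_iff ceiling_le_iff le_floor_iff)
    finally show ?thesis .
  qed
  have c: "card (S i) \<le> nat \<lceil>2 * R + 1\<rceil>" for i
  proof -
    have "\<lfloor>2 ^ k * x $ i - 1 / 2 + R\<rfloor> - \<lceil>2 ^ k * x $ i - 1 / 2 - R\<rceil> + 1 \<le> \<lceil>2 * R + 1\<rceil>" by linarith
    then show ?thesis unfolding S_def by simp
  qed
  have f: "finite (S i)" for i by (simp add: S_def)
  show "finite {m. \<forall>i. \<bar>x $ i - dyadic_centre (k, m) $ i\<bar> \<le> R * dyadic_side (k, m)}"
    unfolding eq by (rule card_int_vec_box(1)[OF f c])
  show "card {m. \<forall>i. \<bar>x $ i - dyadic_centre (k, m) $ i\<bar> \<le> R * dyadic_side (k, m)} \<le> (nat \<lceil>2 * R + 1\<rceil>) ^ CARD('n)"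
    unfolding eq by (rule card_int_vec_box(2)[OF f c])
qed

lemma finite_enlarged_containing:
  assumes "\<And>\<alpha>. \<alpha> \<in> A \<Longrightarrow> 1 / 2 ^ l \<le> dyadic_side \<alpha>"
  shows "finite {\<alpha>\<in>A. x \<in> enlarged lam \<alpha>}"
proof (rule finite_subset)
  define R where "R = (1 + lam) / 2"
  show "{\<alpha>\<in>A. x \<in> enlarged lam \<alpha>} \<subseteq> (SIGMA k:{..l}. {m. \<forall>i. \<bar>x $ i - dyadic_centre (k, m) $ i\<bar> \<le> R * dyadic_side (k, m)})"
  proof
    fix \<alpha> assume a: "\<alpha> \<in> {\<alpha>\<in>A. x \<in> enlarged lam \<alpha>}"
    then have "1 / 2 ^ l \<le> (1 / 2 ^ fst \<alpha> :: real)" using assms[of \<alpha>] by (simp add: dyadic_side_def)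
    then have "(2::real) ^ fst \<alpha> \<le> 2 ^ l" by (simp add: field_simps)
    then have "fst \<alpha> \<le> l" by simp
    then show "\<alpha> \<in> (SIGMA k:{..l}. {m. \<forall>i. \<bar>x $ i - dyadic_centre (k, m) $ i\<bar> \<le> R * dyadic_side (k, m)})"
      using a by (cases \<alpha>) (auto simp: mem_enlarged R_def less_imp_le)
  qed
  show "finite (SIGMA k:{..l}. {m. \<forall>i. \<bar>x $ i - dyadic_centre (k, m) $ i\<bar> \<le> R * dyadic_side (k, m)})"
    by (intro finite_SigmaI card_dyadic_near) auto
qed

text \<open>After multiplication by \<open>2 ^ j\<close> the faces of the enlarged cube have integer coordinates, and so has \<open>p\<close>.
  Being strictly between the faces, \<open>p\<close> keeps distance at least 1 from them. The hypothesis on \<open>j\<close> says that the mesh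
  of the grid is at most half of \<open>lam\<close> times the side; here \<open>lam\<close> must be a power of 1/2.\<close>

lemma grid_cell_inside_enlarged:
  fixes \<beta> :: "'n::finite dyadic" and p y :: "real^'n" and a :: "'n \<Rightarrow> int"
  assumes j: "fst \<beta> + k0 + 1 \<le> j" and p: "p \<in> enlarged (1 / 2 ^ k0) \<beta>"
    and a: "\<And>i. 2 ^ j * p $ i = of_int (a i)" and y: "\<And>i. 2 ^ j * \<bar>y $ i - p $ i\<bar> < 1"
  shows "y \<in> enlarged (1 / 2 ^ k0) \<beta>"
  unfolding mem_enlarged
proof
  fix i
  define k where "k = fst \<beta>"
  define v :: int where "v = 2 ^ (j - k - 1) + 2 ^ (j - k - 1 - k0)"
  define u :: int where "u = 2 ^ (j - k - 1) * (2 * snd \<beta> $ i + 1)"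
  have p1: "(2::real) ^ j = 2 ^ k * 2 * 2 ^ (j - k - 1)"
  proof -
    have "j = k + 1 + (j - k - 1)" using j by (simp add: k_def)
    then show ?thesis by (metis power_add power_one_right)
  qed
  have p2: "(2::real) ^ (j - k - 1) = 2 ^ k0 * 2 ^ (j - k - 1 - k0)"
  proof -
    have "j - k - 1 = k0 + (j - k - 1 - k0)" using j by (simp add: k_def)
    then show ?thesis by (metis power_add)
  qed
  have u: "2 ^ j * dyadic_centre \<beta> $ i = of_int u"
    unfolding p1 u_def by (simp add: dyadic_centre_def k_def[symmetric] field_simps)
  have "2 ^ j * ((1 + 1 / 2 ^ k0) * dyadic_side \<beta> / 2) = 2 ^ (j - k - 1) + 2 ^ (j - k - 1) / (2 ^ k0 :: real)"
    unfolding p1 by (simp add: dyadic_side_def k_def[symmetric] field_simps)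
  also have "2 ^ (j - k - 1) / (2 ^ k0 :: real) = 2 ^ (j - k - 1 - k0)" unfolding p2 by simp
  finally have v: "2 ^ j * ((1 + 1 / 2 ^ k0) * dyadic_side \<beta> / 2) = of_int v" by (simp add: v_def)
  have scale: "\<bar>z - dyadic_centre \<beta> $ i\<bar> < (1 + 1 / 2 ^ k0) * dyadic_side \<beta> / 2 \<longleftrightarrow> \<bar>2 ^ j * z - of_int u\<bar> < of_int v" for z
  proof -
    have "\<bar>z - dyadic_centre \<beta> $ i\<bar> < (1 + 1 / 2 ^ k0) * dyadic_side \<beta> / 2 \<longleftrightarrow>
      2 ^ j * \<bar>z - dyadic_centre \<beta> $ i\<bar> < 2 ^ j * ((1 + 1 / 2 ^ k0) * dyadic_side \<beta> / 2)"
      by (rule mult_less_cancel_left_pos[symmetric]) simp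
    also have "2 ^ j * \<bar>z - dyadic_centre \<beta> $ i\<bar> = \<bar>2 ^ j * z - of_int u\<bar>"
      using abs_mult[of "2 ^ j" "z - dyadic_centre \<beta> $ i"] by (simp add: right_diff_distrib u)
    finally show ?thesis unfolding v .
  qed
  have "\<bar>2 ^ j * p $ i - of_int u\<bar> < of_int v" using p unfolding mem_enlarged by (subst scale[symmetric]) blast
  then have "\<bar>a i - u\<bar> < v" unfolding a by linarith
  then have "\<bar>real_of_int (a i) - of_int u\<bar> \<le> of_int v - 1" by linarith
  moreover have "\<bar>2 ^ j * y $ i - of_int (a i)\<bar> < 1"
    using y[of i] abs_mult[of "2 ^ j" "y $ i - p $ i"] by (simp add: right_diff_distrib a)
  ultimately have "\<bar>2 ^ j * y $ i - of_int u\<bar> < of_int v" by linarith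
  then show "\<bar>y $ i - dyadic_centre \<beta> $ i\<bar> < (1 + 1 / 2 ^ k0) * dyadic_side \<beta> / 2" unfolding scale .
qed

lemma infdist_cube_le:
  fixes \<beta> :: "'n::finite dyadic"
  assumes "p \<in> enlarged lam \<beta>" "0 \<le> lam"
  shows "infdist p (closure (dyadic_cube \<beta>)) \<le> real CARD('n) * (lam * dyadic_side \<beta> / 2)"
proof -
  let ?c = "dyadic_centre \<beta>" and ?r = "dyadic_side \<beta> / 2"
  define q :: "real^'n" where "q = (\<chi> i. max (?c $ i - ?r) (min (?c $ i + ?r) (p $ i)))"
  have r0: "0 < ?r" by simp
  have "\<bar>q $ i - ?c $ i\<bar> \<le> ?r" for i
  proof -
    have "q $ i = max (?c $ i - ?r) (min (?c $ i + ?r) (p $ i))" by (simp add: q_def)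
    then show ?thesis using r0 by linarith
  qed
  then have "q \<in> closure (dyadic_cube \<beta>)" by (simp add: mem_closure_dyadic_cube)
  then have "infdist p (closure (dyadic_cube \<beta>)) \<le> dist p q" by (rule infdist_le)
  also have "\<dots> \<le> real CARD('n) * (lam * ?r)" unfolding dist_norm
  proof (rule norm_le_of_components)
    fix i
    have "\<bar>p $ i - ?c $ i\<bar> < (1 + lam) * dyadic_side \<beta> / 2" using assms(1) by (simp add: mem_enlarged)
    moreover have "(1 + lam) * dyadic_side \<beta> / 2 = ?r + lam * ?r" by (simp add: field_simps)
    moreover have "0 \<le> lam * ?r" using assms(2) by simp
    moreover have "(p - q) $ i = p $ i - max (?c $ i - ?r) (min (?c $ i + ?r) (p $ i))" by (simp add: q_def)
    ultimately show "\<bar>(p - q) $ i\<bar> \<le> lam * ?r" by linarith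
  qed
  finally show ?thesis by simp
qed

lemma measure_closure_cube:
  fixes \<alpha> :: "'n::finite dyadic"
  shows "measure lborel (closure (dyadic_cube \<alpha>)) = dyadic_side \<alpha> ^ CARD('n)"
proof -
  have "(2 * (dyadic_side \<alpha> / 2)) = dyadic_side \<alpha>" by simp
  then show ?thesis unfolding closure_dyadic_cube
    by (subst content_cbox) (auto simp: inner_simps)
qed

lemma AE_in_unit_cube: "AE x in (lebesgue :: (real^'n::finite) measure). \<exists>m. x \<in> dyadic_cube (0, m)"
proof -
  have "AE x in (lebesgue :: (real^'n) measure). \<forall>m. x \<notin> closure (dyadic_cube (0, m)) - dyadic_cube (0, m :: int^'n)"
    unfolding AE_all_countable
  proof
    fix m :: "int^'n"
    have "negligible (closure (dyadic_cube (0, m)) - dyadic_cube (0, m))"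
    proof -
      have e: "dyadic_cube (0, m) = box (dyadic_centre (0, m) - (dyadic_side (0, m) / 2) *\<^sub>R One)
          (dyadic_centre (0, m) + (dyadic_side (0, m) / 2) *\<^sub>R One)"
        by (simp only: dyadic_cube_ocube ocube_def)
      show ?thesis by (subst closure_dyadic_cube, subst e, rule negligible_frontier_interval)
    qed
    then show "AE x in lebesgue. x \<notin> closure (dyadic_cube (0, m)) - dyadic_cube (0, m)"
      by (intro AE_not_in) (simp add: negligible_iff_null_sets)
  qed
  then show ?thesis
  proof eventually_elim
    case (elim x)
    obtain m where "x \<in> closure (dyadic_cube (0, m))" using ex_dyadic_cube by blast
    then show ?case using elim by blast
  qed
qed

section \<open>Covering by the reduced family\<close>

lemma retained_antimono: "i \<le> j \<Longrightarrow> retained lam A e j \<subseteq> retained lam A e i"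
  by (rule lift_Suc_antimono_le[of "retained lam A e"]) (auto simp: Let_def)

lemma reduced_subset: "reduced lam A e \<subseteq> A"
  unfolding reduced_def by (metis INT_lower UNIV_I retained.simps(1))

text \<open>An index is discarded only if its cube stays covered, so after each step some remaining cube contains \<open>p\<close>. As
  only finitely many indices are concerned with \<open>p\<close>, if each of them were discarded at some step, none
  would be left after finitely many steps.\<close>

lemma reduced_covers:
  assumes fin: "finite {\<alpha>\<in>A. p \<in> enlarged lam \<alpha>}" and \<alpha>: "\<alpha> \<in> A" "p \<in> enlarged lam \<alpha>"
  shows "\<exists>\<beta>\<in>reduced lam A e. p \<in> enlarged lam \<beta>"
proof (rule ccontr)
  have step: "\<exists>\<beta>\<in>retained lam A e i. p \<in> enlarged lam \<beta>" for i
  proof (induction i)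
    case 0
    then show ?case using \<alpha> by auto
  next
    case (Suc i)
    then obtain \<beta> where "\<beta> \<in> retained lam A e i" "p \<in> enlarged lam \<beta>" by blast
    then show ?case by (cases "\<beta> = e i") (auto simp: Let_def)
  qed
  assume "\<not> ?thesis"
  then have "\<forall>\<beta>\<in>{\<alpha>\<in>A. p \<in> enlarged lam \<alpha>}. \<exists>i. \<beta> \<notin> retained lam A e i" by (auto simp: reduced_def)
  then obtain i where i: "\<And>\<beta>. \<beta> \<in> A \<Longrightarrow> p \<in> enlarged lam \<beta> \<Longrightarrow> \<beta> \<notin> retained lam A e (i \<beta>)"
    by (auto simp: bchoice_iff)
  define N where "N = Max (i ` {\<alpha>\<in>A. p \<in> enlarged lam \<alpha>})"
  obtain \<beta> where \<beta>: "\<beta> \<in> retained lam A e N" "p \<in> enlarged lam \<beta>" using step by blast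
  then have "\<beta> \<in> A" using retained_antimono[of 0 N] by auto
  then have "i \<beta> \<le> N" unfolding N_def using \<beta> fin by (intro Max_ge) auto
  then show False using retained_antimono[OF \<open>i \<beta> \<le> N\<close>] i[OF \<open>\<beta> \<in> A\<close> \<beta>(2)] \<beta>(1) by blast
qed

section \<open>Local A1 weights\<close>

lemma locally_integrable_UNIV_bounded:
  assumes "locally_integrable UNIV f" "bounded S" "S \<in> sets lebesgue"
  shows "set_integrable lebesgue S f"
proof -
  obtain a where "S \<subseteq> cbox (-a) a" using bounded_subset_cbox_symmetric[OF assms(2)] by blast
  moreover have "set_integrable lebesgue (cbox (-a) a) f"
    using assms(1) unfolding locally_integrable_def by (auto intro: compact_cbox)
  ultimately show ?thesis using set_integrable_subset assms(3) by blast
qed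

lemma locally_integrable_borel:
  assumes "locally_integrable UNIV f" shows "f \<in> borel_measurable lebesgue"
proof (rule borel_measurable_LIMSEQ_real)
  show "(\<lambda>x. indicator (cball 0 (real i)) x * f x) \<in> borel_measurable lebesgue" for i
    using locally_integrable_UNIV_bounded[OF assms bounded_cball, of 0 "real i"]
    by (auto simp: set_integrable_def dest: borel_measurable_integrable)
  show "(\<lambda>i. indicator (cball 0 (real i)) x * f x) \<longlonglongrightarrow> f x" for x
  proof (rule tendsto_eventually)
    obtain N where "norm x \<le> real N" using real_arch_simple by blast
    then show "\<forall>\<^sub>F i in sequentially. indicator (cball 0 (real i)) x * f x = f x"
      by (intro eventually_sequentiallyI[of N]) (auto simp: indicator_def)
  qed
qed

lemma bounded_ocube [simp]: "bounded (ocube z r)" by (simp add: ocube_def bounded_box)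

lemma weight_set_integral_pos:
  assumes "weight \<gamma>" "bounded W" "W \<in> sets lebesgue" "emeasure lebesgue W \<noteq> 0"
  shows "0 < (LINT x:W|lebesgue. \<gamma> x)"
proof -
  have i: "set_integrable lebesgue W \<gamma>"
    using assms unfolding weight_def by (intro locally_integrable_UNIV_bounded) auto
  have pos: "AE x in lebesgue. 0 < \<gamma> x" using assms by (simp add: weight_def)
  have "0 \<le> (LINT x:W|lebesgue. \<gamma> x)"
    unfolding set_lebesgue_integral_def using pos by (intro integral_nonneg_AE) (auto simp: indicator_def)
  moreover have "(LINT x:W|lebesgue. \<gamma> x) \<noteq> 0"
  proof
    assume "(LINT x:W|lebesgue. \<gamma> x) = 0"
    then have "AE x in lebesgue. indicator W x *\<^sub>R \<gamma> x = 0"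
      unfolding set_lebesgue_integral_def
      using i pos by (subst (asm) integral_nonneg_eq_0_iff_AE) (auto simp: set_integrable_def indicator_def)
    with pos have "AE x in lebesgue. x \<notin> W" by eventually_elim (auto simp: indicator_def)
    then have "W \<in> null_sets lebesgue" using assms(3) by (simp add: AE_iff_null_sets)
    then show False using assms(4) by (auto dest: null_setsD1)
  qed
  ultimately show ?thesis by simp
qed

text \<open>The essential infimum over the cube is at most the mean over any part \<open>W\<close> of it. The inequality of the A1 condition enters
  in this form only.\<close>

lemma A1_loc_mean_le:
  fixes \<gamma> :: "'a::euclidean_space \<Rightarrow> real"
  assumes A: "A1_loc C \<gamma>" and C: "1 \<le> C" and r: "0 < r" "r \<le> 1"
    and W: "W \<subseteq> ocube z r" "W \<in> sets lebesgue" "0 < measure lebesgue W"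
  shows "mean (ocube z r) \<gamma> \<le> C * mean W \<gamma>"
proof -
  define M where "M = mean (ocube z r) \<gamma>"
  have w: "weight \<gamma>" using A by (simp add: A1_loc_def)
  let ?L = "lebesgue_on (ocube z r)"
  define I where "I = ess_inf ?L (\<lambda>w. ereal (\<gamma> w))"
  have "ereal M \<le> ereal C * I" using A r by (simp add: A1_loc_def M_def I_def)
  then have MI: "ereal (M / C) \<le> I"
    using C by (cases I) (auto simp: field_simps)
  have "AE w in ?L. - ereal (\<gamma> w) \<le> esssup ?L (\<lambda>w. - ereal (\<gamma> w))" by (rule esssup_AE)
  then have "AE w in ?L. M / C \<le> \<gamma> w"
  proof eventually_elim
    case (elim w)
    have "I \<le> ereal (\<gamma> w)" using elim by (simp add: I_def ess_inf_def ereal_uminus_le_reorder)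
    with MI show ?case using order_trans by fastforce
  qed
  then have AE: "AE w in lebesgue. w \<in> ocube z r \<longrightarrow> M / C \<le> \<gamma> w"
    by (subst (asm) AE_restrict_space_iff) auto
  have bW: "bounded W" using W(1) bounded_subset bounded_ocube by blast
  have iW: "set_integrable lebesgue W \<gamma>"
    using w W bW unfolding weight_def by (intro locally_integrable_UNIV_bounded) auto
  have mW: "W \<in> lmeasurable" using bW W(2) by (rule bounded_set_imp_lmeasurable)
  have "(LINT x:W|lebesgue. M / C) \<le> (LINT x:W|lebesgue. \<gamma> x)"
    unfolding set_lebesgue_integral_def
  proof (rule integral_mono_AE)
    show "integrable lebesgue (\<lambda>x. indicator W x *\<^sub>R (M / C))"
      using mW by (intro integrable_scaleR_left integrable_real_indicator) (auto simp: fmeasurable_def)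
    show "integrable lebesgue (\<lambda>x. indicator W x *\<^sub>R \<gamma> x)" using iW by (simp add: set_integrable_def)
    show "AE x in lebesgue. indicator W x *\<^sub>R (M / C) \<le> indicator W x *\<^sub>R \<gamma> x"
      using AE by eventually_elim (use W(1) in \<open>auto simp: indicator_def\<close>)
  qed
  then have "measure lebesgue W * (M / C) \<le> (LINT x:W|lebesgue. \<gamma> x)"
    using mW by (simp add: set_lebesgue_integral_def)
  then have "M / C \<le> mean W \<gamma>" using W(3) by (simp add: mean_def field_simps)
  then show ?thesis using C by (simp add: M_def field_simps)
qed

lemma nn_integral_weight_ocube:
  fixes \<gamma> :: "'a::euclidean_space \<Rightarrow> real"
  assumes "weight \<gamma>" "0 < r"
  shows "(\<integral>\<^sup>+x\<in>ocube z r. ennreal (\<gamma> x) \<partial>lebesgue) = ennreal (r ^ DIM('a) * mean (ocube z r) \<gamma>)"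
proof -
  have i: "set_integrable lebesgue (ocube z r) \<gamma>"
    using assms unfolding weight_def by (intro locally_integrable_UNIV_bounded) auto
  have "(\<integral>\<^sup>+x\<in>ocube z r. ennreal (\<gamma> x) \<partial>lebesgue) = (\<integral>\<^sup>+x. ennreal (indicator (ocube z r) x *\<^sub>R \<gamma> x) \<partial>lebesgue)"
    by (intro nn_integral_cong) (auto simp: indicator_def)
  also have "\<dots> = ennreal (LINT x:ocube z r|lebesgue. \<gamma> x)"
    unfolding set_lebesgue_integral_def
    using i assms(1) by (intro nn_integral_eq_integral) (auto simp: set_integrable_def weight_def indicator_def elim!: eventually_mono)
  also have "(LINT x:ocube z r|lebesgue. \<gamma> x) = r ^ DIM('a) * mean (ocube z r) \<gamma>"
    using assms(2) by (simp add: mean_def measure_ocube)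
  finally show ?thesis .
qed

lemma weight_mean_ocube:
  "weight_mean \<gamma> \<alpha> = mean (ocube (dyadic_centre \<alpha>, dyadic_side \<alpha> / 2) (dyadic_side \<alpha>)) \<gamma>"
  by (simp add: weight_mean_def ocube_Pair dyadic_cube_ocube)

lemma weight_mean_pos: assumes "weight \<gamma>" shows "0 < weight_mean \<gamma> \<alpha>"
  unfolding weight_mean_ocube mean_def using assms
  by (intro divide_pos_pos weight_set_integral_pos) (auto simp: emeasure_ocube measure_ocube)

text \<open>Converts the difference between a constant and a mean into an integral of \<open>\<bar>c - \<phi>\<bar>\<close>, which is what the energy
  contains.\<close>

lemma abs_diff_mean_le:
  fixes \<phi> :: "'a::euclidean_space \<Rightarrow> real"
  assumes D: "set_integrable lebesgue D \<phi>" "D \<in> lmeasurable" "0 < measure lebesgue D"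
  shows "ennreal (measure lebesgue D * \<bar>c - mean D \<phi>\<bar>) \<le> (\<integral>\<^sup>+x\<in>D. ennreal \<bar>c - \<phi> x\<bar> \<partial>lebesgue)"
proof -
  have ci: "set_integrable lebesgue D (\<lambda>_. c)"
    unfolding set_integrable_def using D(2) by (intro integrable_scaleR_left integrable_real_indicator) (auto simp: fmeasurable_def)
  note di = set_integral_diff(1)[OF ci D(1)]
  have "(LINT x:D|lebesgue. c - \<phi> x) = measure lebesgue D * c - (LINT x:D|lebesgue. \<phi> x)"
    using set_integral_diff(2)[OF ci D(1)] D(2) by (simp add: set_lebesgue_integral_def)
  also have "\<dots> = measure lebesgue D * (c - mean D \<phi>)" using D(3) by (simp add: mean_def right_diff_distrib)
  finally have "measure lebesgue D * \<bar>c - mean D \<phi>\<bar> = \<bar>LINT x:D|lebesgue. c - \<phi> x\<bar>"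
    using D(3) by (simp add: abs_mult)
  also have "\<dots> \<le> (LINT x:D|lebesgue. \<bar>c - \<phi> x\<bar>)"
    using set_integral_norm_bound[OF di] by simp
  finally have "ennreal (measure lebesgue D * \<bar>c - mean D \<phi>\<bar>) \<le> ennreal (LINT x:D|lebesgue. \<bar>c - \<phi> x\<bar>)"
    by (rule ennreal_leI)
  also have "\<dots> = (\<integral>\<^sup>+x. ennreal (indicator D x *\<^sub>R \<bar>c - \<phi> x\<bar>) \<partial>lebesgue)"
    unfolding set_lebesgue_integral_def
    using set_integrable_norm[OF di] by (intro nn_integral_eq_integral[symmetric]) (auto simp: set_integrable_def indicator_def)
  also have "\<dots> = (\<integral>\<^sup>+x\<in>D. ennreal \<bar>c - \<phi> x\<bar> \<partial>lebesgue)"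
    by (intro nn_integral_cong) (auto simp: indicator_def)
  finally show ?thesis .
qed

section \<open>Countable sums of extended nonnegative reals\<close>

lemma borel_measurable_count_space_integral:
  fixes f :: "'i \<Rightarrow> 'a \<Rightarrow> ennreal"
  assumes I: "countable I" and [measurable]: "\<And>i. i \<in> I \<Longrightarrow> f i \<in> borel_measurable M"
  shows "(\<lambda>x. \<integral>\<^sup>+i. f i x \<partial>count_space I) \<in> borel_measurable M"
proof (cases "finite I")
  case True
  then show ?thesis by (simp add: nn_integral_count_space_finite)
next
  case False
  then have ne: "I \<noteq> {}" by auto
  note b = bij_betw_from_nat_into[OF I False]
  have "(\<integral>\<^sup>+i. f i x \<partial>count_space I) = (\<Sum>n. f (from_nat_into I n) x)" for x
    by (simp add: nn_integral_bij_count_space[OF b, symmetric, of "\<lambda>i. f i x"] nn_integral_count_space_nat)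
  then show ?thesis using from_nat_into[OF ne] by simp
qed

lemma count_space_integral_le_infsum:
  fixes f :: "'i \<Rightarrow> ennreal"
  assumes I: "countable I" shows "(\<integral>\<^sup>+i. f i \<partial>count_space I) \<le> infsum f I"
proof -
  have le: "sum f F \<le> infsum f I" if "finite F" "F \<subseteq> I" for F
    using that by (subst nonneg_infsum_complete) (auto intro: SUP_upper)
  show ?thesis
  proof (cases "finite I")
    case True
    then show ?thesis using le by (simp add: nn_integral_count_space_finite)
  next
    case False
    then have ne: "I \<noteq> {}" by auto
    note b = bij_betw_from_nat_into[OF I False]
    have "(\<integral>\<^sup>+i. f i \<partial>count_space I) = (\<Sum>n. f (from_nat_into I n))"
      by (simp add: nn_integral_bij_count_space[OF b, symmetric, of f] nn_integral_count_space_nat)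
    also have "\<dots> \<le> infsum f I"
      unfolding suminf_eq_SUP
    proof (rule SUP_least)
      fix k
      have "(\<Sum>n<k. f (from_nat_into I n)) = sum f (from_nat_into I ` {..<k})"
        using b by (subst sum.reindex) (auto simp: bij_betw_def intro: inj_on_subset)
      also have "\<dots> \<le> infsum f I" using from_nat_into[OF ne] by (intro le) auto
      finally show "(\<Sum>n<k. f (from_nat_into I n)) \<le> infsum f I" .
    qed
    finally show ?thesis .
  qed
qed

lemma ennreal_suminf_le:
  fixes f :: "nat \<Rightarrow> ennreal"
  assumes "\<And>k. sum f {..<k} \<le> B" shows "suminf f \<le> B"
  unfolding suminf_eq_SUP by (intro SUP_least assms)

lemma ennreal_tail_small:
  fixes f :: "nat \<Rightarrow> ennreal"
  assumes f: "(\<Sum>s. f s) < \<infinity>" and r: "0 < (r :: real)"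
  shows "\<exists>S\<ge>1. (\<Sum>s. f (s + S)) < ennreal r"
proof -
  have fin: "f s < \<infinity>" for s
  proof -
    have "f s \<le> (\<Sum>s. f s)" using sum_le_suminf[of f "{s}"] by simp
    then show ?thesis using f by (rule le_less_trans)
  qed
  define a where "a s = enn2real (f s)" for s
  have fa: "f s = ennreal (a s)" "0 \<le> a s" for s using fin[of s] by (simp_all add: a_def)
  have sm: "summable a"
  proof (rule summable_suminf_not_top[OF fa(2)])
    have "(\<Sum>s. ennreal (a s)) = (\<Sum>s. f s)" using fa(1) by simp
    then show "(\<Sum>s. ennreal (a s)) \<noteq> top" using f by simp
  qed
  obtain N where N: "\<And>n. N \<le> n \<Longrightarrow> norm (\<Sum>i. a (i + n)) < r" using suminf_exist_split[OF r sm] by blast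
  have "(\<Sum>s. f (s + max N 1)) = ennreal (\<Sum>s. a (s + max N 1))"
    unfolding fa(1) using fa(2) summable_ignore_initial_segment[OF sm] by (intro suminf_ennreal2) auto
  also have "\<dots> < ennreal r" using N[of "max N 1"] r by (intro ennreal_lessI) auto
  finally show ?thesis by (intro exI[of _ "max N 1"]) auto
qed

section \<open>Averages at a slowly varying scale\<close>

text \<open>The simplest C1 function that vanishes on a half-line. All cutoffs below are compositions with it.\<close>

definition pos_sq :: "real \<Rightarrow> real" where "pos_sq y = (max 0 y)\<^sup>2"

lemma pos_sq_nonneg [simp]: "0 \<le> pos_sq y" by (simp add: pos_sq_def)

lemma DERIV_pos_sq: "(pos_sq has_real_derivative 2 * max 0 y) (at y)"
proof -
  consider "y < 0" | "y = 0" | "y > 0" by linarith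
  then show ?thesis
  proof cases
    case 1
    have "((\<lambda>_. 0) has_real_derivative 2 * max 0 y) (at y)" using 1 by simp
    then show ?thesis
      by (rule has_field_derivative_transform_within_open[where S="{..<0}"]) (use 1 in \<open>auto simp: pos_sq_def\<close>)
  next
    case 2
    have "((\<lambda>h. pos_sq h / h) \<longlongrightarrow> 0) (at 0)"
    proof (rule Lim_null_comparison)
      show "\<forall>\<^sub>F h in at 0. norm (pos_sq h / h) \<le> \<bar>h\<bar>"
        by (intro always_eventually allI) (auto simp: pos_sq_def max_def power2_eq_square)
      show "((\<lambda>h::real. \<bar>h\<bar>) \<longlongrightarrow> 0) (at 0)" by (auto intro!: tendsto_eq_intros)
    qed
    then show ?thesis using 2 by (simp add: DERIV_def pos_sq_def)
  next
    case 3
    have "((\<lambda>y. y\<^sup>2) has_real_derivative 2 * max 0 y) (at y)" using 3 by (auto intro!: derivative_eq_intros)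
    then show ?thesis
      by (rule has_field_derivative_transform_within_open[where S="{0<..}"]) (use 3 in \<open>auto simp: pos_sq_def\<close>)
  qed
qed

text \<open>Equal to 1 up to \<open>y = 1\<close> and to 0 from \<open>y = 2\<close> on.\<close>

definition cutoff :: "real \<Rightarrow> real" where "cutoff y = pos_sq (1 - pos_sq (y - 1))"

definition cutoff' :: "real \<Rightarrow> real" where
  "cutoff' y = 2 * max 0 (1 - pos_sq (y - 1)) * (- (2 * max 0 (y - 1)))"

lemma DERIV_cutoff: "(cutoff has_real_derivative cutoff' y) (at y)"
proof -
  have "((\<lambda>y. y - 1) has_real_derivative 1) (at y)" by (auto intro!: derivative_eq_intros)
  from DERIV_chain2[OF DERIV_pos_sq this]
  have "((\<lambda>y. 1 - pos_sq (y - 1)) has_real_derivative (- (2 * max 0 (y - 1)))) (at y)"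
    by (auto intro!: derivative_eq_intros)
  from DERIV_chain2[OF DERIV_pos_sq this] show ?thesis unfolding cutoff_def[abs_def] cutoff'_def .
qed

lemma cutoff_eq_1: "y \<le> 1 \<Longrightarrow> cutoff y = 1" by (simp add: cutoff_def pos_sq_def)

lemma cutoff_ge_2: assumes "2 \<le> y" shows "cutoff y = 0" "cutoff' y = 0"
proof -
  have "1 \<le> pos_sq (y - 1)" using assms by (simp add: pos_sq_def power2_eq_square mult_ge1_I)
  then show "cutoff y = 0" "cutoff' y = 0" by (simp_all add: cutoff_def cutoff'_def pos_sq_def)
qed

lemma cutoff_bounds: "0 \<le> cutoff y" "cutoff y \<le> 1" "\<bar>cutoff' y\<bar> \<le> 4"
proof -
  have le1: "max 0 (1 - pos_sq (y - 1)) \<le> 1" using pos_sq_nonneg[of "y - 1"] by linarith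
  show "0 \<le> cutoff y" by (simp add: cutoff_def)
  show "cutoff y \<le> 1" unfolding cutoff_def pos_sq_def[of "1 - _"]
    using le1 by (intro power_le_one) auto
  show "\<bar>cutoff' y\<bar> \<le> 4"
  proof (cases "y \<le> 2")
    case True
    have "\<bar>cutoff' y\<bar> = 4 * (max 0 (1 - pos_sq (y - 1)) * max 0 (y - 1))" by (simp add: cutoff'_def abs_mult)
    also have "\<dots> \<le> 4 * (1 * 1)" using True le1 by (intro mult_left_mono mult_mono) auto
    finally show ?thesis by simp
  next
    case False
    then show ?thesis using cutoff_ge_2[of y] by simp
  qed
qed

lemma continuous_on_cutoff': "continuous_on UNIV cutoff'"
  unfolding cutoff'_def[abs_def] pos_sq_def by (intro continuous_intros)

text \<open>A radial bump. With the dimension \<open>n\<close> in place of its square root the support is the ball of radius \<open>n\<close> times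
  the side, and on the cube itself, where the distance to the centre is at most half of that, the bump is
  at least 1/2.\<close>

definition bump :: "'n::finite dyadic \<Rightarrow> real^'n \<Rightarrow> real" where
  "bump \<alpha> x = pos_sq ((real CARD('n))\<^sup>2 - ((x - dyadic_centre \<alpha>) \<bullet> (x - dyadic_centre \<alpha>)) / (dyadic_side \<alpha>)\<^sup>2)"

definition bump' :: "'n::finite dyadic \<Rightarrow> real^'n \<Rightarrow> real^'n \<Rightarrow> real" where
  "bump' \<alpha> x v = 2 * max 0 ((real CARD('n))\<^sup>2 - ((x - dyadic_centre \<alpha>) \<bullet> (x - dyadic_centre \<alpha>)) / (dyadic_side \<alpha>)\<^sup>2)
     * (- (2 * ((x - dyadic_centre \<alpha>) \<bullet> v) / (dyadic_side \<alpha>)\<^sup>2))"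

lemma bump_has_derivative: "(bump \<alpha> has_derivative bump' \<alpha> x) (at x)"
  for \<alpha> :: "'n::finite dyadic"
proof -
  have "((\<lambda>x. (real CARD('n))\<^sup>2 - ((x - dyadic_centre \<alpha>) \<bullet> (x - dyadic_centre \<alpha>)) / (dyadic_side \<alpha>)\<^sup>2)
      has_derivative (\<lambda>v. - (2 * ((x - dyadic_centre \<alpha>) \<bullet> v) / (dyadic_side \<alpha>)\<^sup>2))) (at x)"
    by (auto intro!: derivative_eq_intros simp: fun_eq_iff inner_commute power2_eq_square power4_eq_xxxx field_simps)
  from has_derivative_compose[OF this DERIV_pos_sq[unfolded has_field_derivative_def]]
  show ?thesis unfolding bump_def[abs_def] bump'_def[abs_def] .
qed

lemma C1_on_bump: "C1_on UNIV (bump \<alpha>)"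
proof (rule C1_onI[OF bump_has_derivative])
  show "continuous_on UNIV (\<lambda>x. bump' \<alpha> x v)" for v
    unfolding bump'_def by (intro continuous_intros) auto
qed

lemma bump_nonneg [simp]: "0 \<le> bump \<alpha> x" by (simp add: bump_def)

lemma bump_outside:
  fixes \<alpha> :: "'n::finite dyadic"
  assumes "real CARD('n) * dyadic_side \<alpha> \<le> dist x (dyadic_centre \<alpha>)"
  shows "bump \<alpha> x = 0" "bump' \<alpha> x v = 0"
proof -
  have "(real CARD('n) * dyadic_side \<alpha>)\<^sup>2 \<le> (norm (x - dyadic_centre \<alpha>))\<^sup>2"
    using assms by (intro power_mono) (auto simp: dist_norm)
  then have "(real CARD('n))\<^sup>2 - ((x - dyadic_centre \<alpha>) \<bullet> (x - dyadic_centre \<alpha>)) / (dyadic_side \<alpha>)\<^sup>2 \<le> 0"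
    by (simp add: power2_norm_eq_inner power_mult_distrib field_simps)
  then show "bump \<alpha> x = 0" "bump' \<alpha> x v = 0" by (simp_all add: bump_def bump'_def pos_sq_def)
qed

lemma bump_le:
  fixes \<alpha> :: "'n::finite dyadic" shows "bump \<alpha> x \<le> real CARD('n) ^ 4"
proof -
  have "max 0 ((real CARD('n))\<^sup>2 - ((x - dyadic_centre \<alpha>) \<bullet> (x - dyadic_centre \<alpha>)) / (dyadic_side \<alpha>)\<^sup>2) \<le> (real CARD('n))\<^sup>2"
    by simp
  then have "bump \<alpha> x \<le> ((real CARD('n))\<^sup>2)\<^sup>2" unfolding bump_def pos_sq_def by (intro power_mono) auto
  then show ?thesis by simp
qed

lemma bump'_le:
  fixes \<alpha> :: "'n::finite dyadic"
  shows "\<bar>bump' \<alpha> x v\<bar> \<le> 4 * real CARD('n) ^ 3 * norm v / dyadic_side \<alpha>"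
proof (cases "real CARD('n) * dyadic_side \<alpha> \<le> dist x (dyadic_centre \<alpha>)")
  case True
  then show ?thesis using bump_outside[OF True] by simp
next
  case False
  let ?n = "real CARD('n)" and ?r = "dyadic_side \<alpha>" and ?y = "x - dyadic_centre \<alpha>"
  have "\<bar>bump' \<alpha> x v\<bar> = 4 * (max 0 (?n\<^sup>2 - (?y \<bullet> ?y) / ?r\<^sup>2) * \<bar>?y \<bullet> v\<bar>) / ?r\<^sup>2"
    by (simp add: bump'_def abs_mult)
  also have "\<dots> \<le> 4 * (?n\<^sup>2 * (?n * ?r * norm v)) / ?r\<^sup>2"
  proof (intro divide_right_mono mult_left_mono mult_mono)
    have "\<bar>?y \<bullet> v\<bar> \<le> norm ?y * norm v" by (rule Cauchy_Schwarz_ineq2)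
    also have "\<dots> \<le> ?n * ?r * norm v" using False by (intro mult_right_mono) (auto simp: dist_norm)
    finally show "\<bar>?y \<bullet> v\<bar> \<le> ?n * ?r * norm v" .
  qed auto
  also have "\<dots> = 4 * ?n ^ 3 * norm v / ?r" by (simp add: power2_eq_square power3_eq_cube)
  finally show ?thesis .
qed

lemma dist_centre_le:
  fixes \<alpha> :: "'n::finite dyadic"
  assumes "x \<in> closure (dyadic_cube \<alpha>)"
  shows "dist x (dyadic_centre \<alpha>) \<le> real CARD('n) * dyadic_side \<alpha> / 2"
  using norm_le_of_components[of "x - dyadic_centre \<alpha>" "dyadic_side \<alpha> / 2"] assms
  by (simp add: dist_norm mem_closure_dyadic_cube)

lemma bump_ge_on_cube:
  fixes \<alpha> :: "'n::finite dyadic"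
  assumes "x \<in> closure (dyadic_cube \<alpha>)" shows "1 / 2 \<le> bump \<alpha> x"
proof -
  let ?n = "real CARD('n)" and ?r = "dyadic_side \<alpha>" and ?y = "x - dyadic_centre \<alpha>"
  have "(norm ?y)\<^sup>2 \<le> (?n * ?r / 2)\<^sup>2"
    using dist_centre_le[OF assms] by (intro power_mono) (auto simp: dist_norm)
  then have a: "(?y \<bullet> ?y) / ?r\<^sup>2 \<le> ?n\<^sup>2 / 4"
    by (simp add: power2_norm_eq_inner power_mult_distrib power_divide field_simps)
  have "1 \<le> ?n\<^sup>2" by (simp add: one_le_power)
  then have "3 / 4 \<le> max 0 (?n\<^sup>2 - (?y \<bullet> ?y) / ?r\<^sup>2)" using a by linarith
  then have "(3 / 4)\<^sup>2 \<le> bump \<alpha> x" unfolding bump_def pos_sq_def by (rule power_mono) simp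
  moreover have "(1 / 2 :: real) \<le> (3 / 4)\<^sup>2" by (simp add: power2_eq_square)
  ultimately show ?thesis by linarith
qed

text \<open>The factor 32 is chosen for \<open>near_scale\<close>: the scale changes by at most a quarter over a distance of \<open>8 n\<close> times the side of a
  cell, a side being at most \<open>\<delta> h\<close>.\<close>

definition slow :: "real \<Rightarrow> (real^'n \<Rightarrow> real) \<Rightarrow> bool" where
  "slow \<delta> h \<longleftrightarrow> 0 < \<delta> \<and> \<delta> \<le> 1 \<and> (\<forall>x. 0 < h x \<and> h x \<le> 1) \<and>
     (\<forall>x y. 32 * real CARD('n) * \<delta> * \<bar>h x - h y\<bar> \<le> dist x y)"

text \<open>Dyadic cubes whose side is comparable with \<open>\<delta> h\<close>. They overlap, and cells of several generations may contain a
  point: the window of a factor 4 is what makes them cover when \<open>h\<close> is sampled at centres only.\<close>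

definition cells :: "real \<Rightarrow> (real^'n \<Rightarrow> real) \<Rightarrow> 'n::finite dyadic set" where
  "cells \<delta> h = {\<alpha>. \<delta> * h (dyadic_centre \<alpha>) / 4 < dyadic_side \<alpha> \<and> dyadic_side \<alpha> \<le> \<delta> * h (dyadic_centre \<alpha>)}"

text \<open>The cells within the distance \<open>8 n\<close> times their side. This is wider than the supports of the bumps (\<open>active\<close>) so
  that it also catches, near a point, every cell that is active somewhere on a cell around this point, even for a
  larger scale function (\<open>touching_near\<close>).\<close>

definition near :: "real \<Rightarrow> (real^'n \<Rightarrow> real) \<Rightarrow> real^'n \<Rightarrow> 'n::finite dyadic set" where
  "near \<delta> h x = {\<alpha> \<in> cells \<delta> h. dist x (dyadic_centre \<alpha>) \<le> 8 * real CARD('n) * dyadic_side \<alpha>}"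

definition active :: "real \<Rightarrow> (real^'n \<Rightarrow> real) \<Rightarrow> real^'n \<Rightarrow> 'n::finite dyadic set" where
  "active \<delta> h x = {\<alpha> \<in> cells \<delta> h. dist x (dyadic_centre \<alpha>) < real CARD('n) * dyadic_side \<alpha>}"

lemma slowD:
  fixes h :: "real^'n \<Rightarrow> real"
  assumes "slow \<delta> h"
  shows "0 < \<delta>" "\<delta> \<le> 1" "0 < h x" "h x \<le> 1" "32 * real CARD('n) * \<delta> * \<bar>h x - h y\<bar> \<le> dist x y"
  using assms unfolding slow_def by blast+

lemma slow_diff_le:
  fixes h :: "real^'n \<Rightarrow> real"
  assumes "slow \<delta> h" "dist x y \<le> real CARD('n) * (\<delta> * (32 * b))" shows "\<bar>h x - h y\<bar> \<le> b"
proof -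
  have "32 * real CARD('n) * \<delta> * \<bar>h x - h y\<bar> \<le> 32 * real CARD('n) * \<delta> * b"
    using slowD(5)[OF assms(1), of x y] assms(2) by (simp add: mult_ac)
  then show ?thesis using slowD(1)[OF assms(1)] by (simp add: mult_le_cancel_left)
qed

lemma near_scale:
  fixes h :: "real^'n \<Rightarrow> real"
  assumes s: "slow \<delta> h" and a: "\<alpha> \<in> near \<delta> h x"
  shows "\<delta> * h x / 5 < dyadic_side \<alpha>" "dyadic_side \<alpha> \<le> 4 / 3 * (\<delta> * h x)"
proof -
  let ?c = "dyadic_centre \<alpha>"
  have c: "\<delta> * h ?c / 4 < dyadic_side \<alpha>" "dyadic_side \<alpha> \<le> \<delta> * h ?c"
    "dist x ?c \<le> 8 * real CARD('n) * dyadic_side \<alpha>" using a by (auto simp: near_def cells_def)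
  have "8 * real CARD('n) * dyadic_side \<alpha> \<le> 8 * real CARD('n) * (\<delta> * h ?c)"
    using c(2) by (intro mult_left_mono) auto
  also have "\<dots> = real CARD('n) * (\<delta> * (32 * (h ?c / 4)))" by simp
  finally have "\<bar>h x - h ?c\<bar> \<le> h ?c / 4"
    using c(3) by (intro slow_diff_le[OF s]) linarith
  then have "h x \<le> 5 / 4 * h ?c" "h ?c \<le> 4 / 3 * h x" by linarith+
  then have "\<delta> * h x \<le> \<delta> * (5 / 4 * h ?c)" "\<delta> * h ?c \<le> \<delta> * (4 / 3 * h x)"
    using slowD(1)[OF s] by (auto intro: mult_left_mono)
  then show "\<delta> * h x / 5 < dyadic_side \<alpha>" "dyadic_side \<alpha> \<le> 4 / 3 * (\<delta> * h x)"
    using c by auto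
qed

text \<open>Cells near one point have sides within a factor less than 8, hence belong to at most three
  generations.\<close>

definition overlap :: "'n::finite itself \<Rightarrow> nat" where
  "overlap _ = 3 * nat \<lceil>2 * (8 * real CARD('n)) + 1\<rceil> ^ CARD('n)"

lemma near_finite_card:
  fixes h :: "real^'n \<Rightarrow> real"
  assumes s: "slow \<delta> h"
  shows "finite (near \<delta> h x)" "card (near \<delta> h x) \<le> overlap TYPE('n)"
proof -
  let ?R = "8 * real CARD('n)"
  have "\<exists>k0. near \<delta> h x \<subseteq> (SIGMA k:{k0..<k0+3}. {m. \<forall>i. \<bar>x $ i - dyadic_centre (k, m) $ i\<bar> \<le> ?R * dyadic_side (k, m)})"
  proof (cases "near \<delta> h x = {}")
    case False
    define k0 where "k0 = (LEAST k. \<exists>\<alpha>\<in>near \<delta> h x. fst \<alpha> = k)"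
    have "\<exists>\<alpha>\<in>near \<delta> h x. fst \<alpha> = k0" unfolding k0_def by (rule LeastI_ex) (use False in auto)
    then obtain \<alpha>0 where \<alpha>0: "\<alpha>0 \<in> near \<delta> h x" "fst \<alpha>0 = k0" by blast
    show ?thesis
    proof (intro exI subsetI)
      fix \<alpha> assume a: "\<alpha> \<in> near \<delta> h x"
      have ge: "k0 \<le> fst \<alpha>" unfolding k0_def by (rule Least_le) (use a in auto)
      have "dyadic_side \<alpha>0 < 8 * dyadic_side \<alpha>"
        using near_scale[OF s a] near_scale[OF s \<alpha>0(1)] slowD(1,3)[OF s] by (auto simp: algebra_simps)
      then have "(2::real) ^ fst \<alpha> < 2 ^ (k0 + 3)" by (simp add: dyadic_side_def \<alpha>0 field_simps power_add)
      then have lt: "fst \<alpha> < k0 + 3" by simp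
      have "\<bar>x $ i - dyadic_centre \<alpha> $ i\<bar> \<le> ?R * dyadic_side \<alpha>" for i
        using a component_le_norm_cart[of "x - dyadic_centre \<alpha>" i] by (simp add: near_def dist_norm)
      then show "\<alpha> \<in> (SIGMA k:{k0..<k0+3}. {m. \<forall>i. \<bar>x $ i - dyadic_centre (k, m) $ i\<bar> \<le> ?R * dyadic_side (k, m)})"
        using ge lt by (cases \<alpha>) auto
    qed
  qed auto
  then obtain k0 where k0: "near \<delta> h x \<subseteq> (SIGMA k:{k0..<k0+3}. {m. \<forall>i. \<bar>x $ i - dyadic_centre (k, m) $ i\<bar> \<le> ?R * dyadic_side (k, m)})"
    (is "_ \<subseteq> ?S") by blast
  have fS: "finite ?S" by (intro finite_SigmaI card_dyadic_near) auto
  then show "finite (near \<delta> h x)" using k0 finite_subset by blast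
  have "card (near \<delta> h x) \<le> card ?S" by (rule card_mono[OF fS k0])
  also have "\<dots> = (\<Sum>k\<in>{k0..<k0+3}. card {m. \<forall>i. \<bar>x $ i - dyadic_centre (k, m) $ i\<bar> \<le> ?R * dyadic_side (k, m)})"
    by (intro card_SigmaI) (auto intro: card_dyadic_near)
  also have "\<dots> \<le> (\<Sum>k\<in>{k0..<k0+3}. nat \<lceil>2 * ?R + 1\<rceil> ^ CARD('n))"
    by (intro sum_mono card_dyadic_near(2))
  finally show "card (near \<delta> h x) \<le> overlap TYPE('n)" by (simp add: overlap_def)
qed

lemma active_subset_near: "active \<delta> h x \<subseteq> near \<delta> h x"
  for h :: "real^'n \<Rightarrow> real"
proof
  fix \<alpha> assume a: "\<alpha> \<in> active \<delta> h x"
  have "0 \<le> real CARD('n) * dyadic_side \<alpha>" by simp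
  moreover have "dist x (dyadic_centre \<alpha>) < real CARD('n) * dyadic_side \<alpha>" using a by (simp add: active_def)
  ultimately have "dist x (dyadic_centre \<alpha>) \<le> 8 * real CARD('n) * dyadic_side \<alpha>" by linarith
  then show "\<alpha> \<in> near \<delta> h x" using a by (auto simp: active_def near_def)
qed

lemma ex_dyadic_scale: assumes "0 < \<kappa>" "\<kappa> \<le> (1::real)" shows "\<exists>k. \<kappa> / 2 < 1 / 2 ^ k \<and> 1 / 2 ^ k \<le> \<kappa>"
proof -
  have ex: "\<exists>k. 1 / 2 ^ k \<le> \<kappa>"
    using real_arch_pow_inv[of \<kappa> "1/2"] assms by (auto simp: power_one_over intro: less_imp_le)
  define k where "k = (LEAST k. 1 / 2 ^ k \<le> \<kappa>)"
  have k: "1 / 2 ^ k \<le> \<kappa>" unfolding k_def by (rule LeastI_ex[OF ex])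
  have "\<kappa> / 2 < 1 / 2 ^ k"
  proof (cases k)
    case 0
    then show ?thesis using assms by simp
  next
    case (Suc j)
    then have "\<not> 1 / 2 ^ j \<le> \<kappa>" using not_less_Least[of j "\<lambda>k. 1 / 2 ^ k \<le> \<kappa>"] by (simp add: k_def)
    then show ?thesis using Suc by (simp add: field_simps)
  qed
  with k show ?thesis by blast
qed

lemma cells_cover:
  fixes h :: "real^'n \<Rightarrow> real"
  assumes s: "slow \<delta> h" shows "\<exists>\<alpha>\<in>cells \<delta> h. x \<in> closure (dyadic_cube \<alpha>)"
proof -
  have hx: "0 < \<delta> * h x" "\<delta> * h x \<le> 1" using slowD[OF s] by (auto intro: mult_le_one less_imp_le)
  obtain k where k: "3 / 4 * (\<delta> * h x) / 2 < 1 / 2 ^ k" "1 / 2 ^ k \<le> 3 / 4 * (\<delta> * h x)"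
    using ex_dyadic_scale[of "3 / 4 * (\<delta> * h x)"] hx by auto
  obtain m where m: "x \<in> closure (dyadic_cube (k, m))" using ex_dyadic_cube by blast
  let ?c = "dyadic_centre (k, m)" and ?r = "dyadic_side (k, m)"
  have r: "?r = 1 / 2 ^ k" by (simp add: dyadic_side_def)
  have "dist x ?c \<le> real CARD('n) * (?r / 2)" using dist_centre_le[OF m] by simp
  also have "\<dots> \<le> real CARD('n) * (\<delta> * h x * (3 / 8))" using k r by (intro mult_left_mono) auto
  also have "\<dots> = real CARD('n) * (\<delta> * (32 * (3 / 256 * h x)))" by simp
  finally have "\<bar>h x - h ?c\<bar> \<le> 3 / 256 * h x" by (rule slow_diff_le[OF s])
  then have "3 / 4 * h x \<le> h ?c" "h ?c \<le> 3 / 2 * h x" using slowD(3)[OF s, of x] by linarith+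
  then have "\<delta> * (3 / 4 * h x) \<le> \<delta> * h ?c" "\<delta> * h ?c \<le> \<delta> * (3 / 2 * h x)"
    using slowD(1)[OF s] by (auto intro: mult_left_mono)
  then have "(k, m) \<in> cells \<delta> h" using k r by (simp add: cells_def)
  with m show ?thesis by blast
qed

lemma cell_near:
  fixes h :: "real^'n \<Rightarrow> real"
  assumes "\<alpha> \<in> cells \<delta> h" "x \<in> closure (dyadic_cube \<alpha>)" shows "\<alpha> \<in> near \<delta> h x"
proof -
  have "0 \<le> real CARD('n) * dyadic_side \<alpha>" by simp
  then have "dist x (dyadic_centre \<alpha>) \<le> 8 * real CARD('n) * dyadic_side \<alpha>"
    using dist_centre_le[OF assms(2)] by linarith
  then show ?thesis using assms by (auto simp: near_def)
qed

text \<open>Normalised by the sum of the bumps, so that constants are reproduced. The sums run over \<open>near\<close>, but by \<open>avg_eq_sum\<close>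
  any finite set of cells that contains the active ones gives the same value; for a set that serves all points of a
  neighbourhood the quotient can be differentiated.\<close>

definition avg :: "real \<Rightarrow> (real^'n::finite \<Rightarrow> real) \<Rightarrow> ('n dyadic \<Rightarrow> real) \<Rightarrow> real^'n \<Rightarrow> real" where
  "avg \<delta> h c x = (\<Sum>\<alpha>\<in>near \<delta> h x. c \<alpha> * bump \<alpha> x) / (\<Sum>\<alpha>\<in>near \<delta> h x. bump \<alpha> x)"

lemma bump_sum_ge:
  assumes s: "slow \<delta> h" and F: "finite F" "near \<delta> h x \<subseteq> F"
  shows "1 / 2 \<le> (\<Sum>\<alpha>\<in>F. bump \<alpha> x)"
proof -
  obtain \<alpha> where a: "\<alpha> \<in> cells \<delta> h" "x \<in> closure (dyadic_cube \<alpha>)" using cells_cover[OF s] by blast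
  then have "\<alpha> \<in> F" using cell_near F by blast
  then have "bump \<alpha> x \<le> (\<Sum>\<alpha>\<in>F. bump \<alpha> x)" using F by (intro member_le_sum) auto
  then show ?thesis using bump_ge_on_cube[OF a(2)] by linarith
qed

lemma sum_active_eq:
  fixes h :: "real^'n \<Rightarrow> real"
  assumes "finite F" "active \<delta> h x \<subseteq> F" "F \<subseteq> cells \<delta> h"
  shows "(\<Sum>\<alpha>\<in>F. c \<alpha> * bump \<alpha> x) = (\<Sum>\<alpha>\<in>active \<delta> h x. c \<alpha> * bump \<alpha> x)"
    "(\<Sum>\<alpha>\<in>F. c \<alpha> * bump' \<alpha> x v) = (\<Sum>\<alpha>\<in>active \<delta> h x. c \<alpha> * bump' \<alpha> x v)"
proof -
  have "bump \<alpha> x = 0 \<and> bump' \<alpha> x v = 0" if "\<alpha> \<in> F - active \<delta> h x" for \<alpha>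
    using that assms bump_outside[of \<alpha> x] by (auto simp: active_def not_less)
  then show "(\<Sum>\<alpha>\<in>F. c \<alpha> * bump \<alpha> x) = (\<Sum>\<alpha>\<in>active \<delta> h x. c \<alpha> * bump \<alpha> x)"
    "(\<Sum>\<alpha>\<in>F. c \<alpha> * bump' \<alpha> x v) = (\<Sum>\<alpha>\<in>active \<delta> h x. c \<alpha> * bump' \<alpha> x v)"
    using assms by (auto intro!: sum.mono_neutral_right)
qed

lemma near_subset_cells: "near \<delta> h x \<subseteq> cells \<delta> h" by (auto simp: near_def)

lemma active_locally:
  fixes h :: "real^'n \<Rightarrow> real"
  assumes s: "slow \<delta> h" and y: "dist x y < \<delta> * h x / 10"
  shows "active \<delta> h y \<subseteq> near \<delta> h x"
proof
  fix \<alpha> assume a: "\<alpha> \<in> active \<delta> h y"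
  let ?n = "real CARD('n)"
  have n1: "1 \<le> ?n" by simp
  have "\<delta> * h x / 10 \<le> ?n * (\<delta> * h x / 10)"
    using mult_right_mono[OF n1, of "\<delta> * h x / 10"] slowD(1)[OF s] slowD(3)[OF s, of x] by simp
  then have "dist x y \<le> ?n * (\<delta> * (32 * (h x / 320)))" using y by simp
  then have "\<bar>h x - h y\<bar> \<le> h x / 320" by (rule slow_diff_le[OF s])
  then have "h x / 2 \<le> h y" using slowD(3)[OF s, of x] by linarith
  then have "\<delta> * (h x / 2) \<le> \<delta> * h y" using slowD(1)[OF s] by (intro mult_left_mono) auto
  moreover have "\<delta> * h y / 5 < dyadic_side \<alpha>" using near_scale(1)[OF s] a active_subset_near by blast
  ultimately have "dist x y \<le> dyadic_side \<alpha>" using y by simp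
  also have "\<dots> \<le> ?n * dyadic_side \<alpha>" using mult_right_mono[OF n1, of "dyadic_side \<alpha>"] by simp
  finally have "dist x y \<le> ?n * dyadic_side \<alpha>" .
  moreover have "dist y (dyadic_centre \<alpha>) < ?n * dyadic_side \<alpha>" "\<alpha> \<in> cells \<delta> h"
    using a by (auto simp: active_def)
  moreover have "dist x (dyadic_centre \<alpha>) \<le> dist x y + dist y (dyadic_centre \<alpha>)" by (rule dist_triangle)
  moreover have "0 \<le> ?n * dyadic_side \<alpha>" by simp
  ultimately have "\<alpha> \<in> cells \<delta> h" "dist x (dyadic_centre \<alpha>) \<le> 8 * ?n * dyadic_side \<alpha>" by linarith+
  then show "\<alpha> \<in> near \<delta> h x" by (simp add: near_def)
qed

lemma finite_active:
  fixes h :: "real^'n \<Rightarrow> real"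
  assumes "slow \<delta> h" shows "finite (active \<delta> h x)"
  using near_finite_card(1)[OF assms] active_subset_near[of \<delta> h x] finite_subset by blast

lemma avg_eq_sum:
  fixes h :: "real^'n \<Rightarrow> real"
  assumes s: "slow \<delta> h" and F: "finite F" "active \<delta> h x \<subseteq> F" "F \<subseteq> cells \<delta> h"
  shows "avg \<delta> h c x = (\<Sum>\<alpha>\<in>F. c \<alpha> * bump \<alpha> x) / (\<Sum>\<alpha>\<in>F. bump \<alpha> x)"
    "1 / 2 \<le> (\<Sum>\<alpha>\<in>F. bump \<alpha> x)"
proof -
  note a = sum_active_eq(1)[OF F] and b = sum_active_eq(1)[OF near_finite_card(1)[OF s, of x] active_subset_near near_subset_cells]
  have e: "(\<Sum>\<alpha>\<in>F. bump \<alpha> x) = (\<Sum>\<alpha>\<in>near \<delta> h x. bump \<alpha> x)" using a[of "\<lambda>_. 1"] b[of "\<lambda>_. 1"] by simp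
  show "avg \<delta> h c x = (\<Sum>\<alpha>\<in>F. c \<alpha> * bump \<alpha> x) / (\<Sum>\<alpha>\<in>F. bump \<alpha> x)"
    unfolding avg_def e a b ..
  show "1 / 2 \<le> (\<Sum>\<alpha>\<in>F. bump \<alpha> x)" unfolding e by (rule bump_sum_ge[OF s near_finite_card(1)[OF s] order_refl])
qed

lemma C1_on_avg:
  fixes h :: "real^'n \<Rightarrow> real"
  assumes s: "slow \<delta> h" shows "C1_on UNIV (avg \<delta> h c)"
proof (rule C1_on_local)
  fix x :: "real^'n"
  define U where "U = ball x (\<delta> * h x / 10)"
  have xU: "x \<in> U" unfolding U_def using slowD(1)[OF s] slowD(3)[OF s, of x] by simp
  have F: "active \<delta> h y \<subseteq> near \<delta> h x" if "y \<in> U" for y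
    using active_locally[OF s] that by (simp add: U_def)
  note e = avg_eq_sum[OF s near_finite_card(1)[OF s] F near_subset_cells]
  show "\<exists>U g. open U \<and> x \<in> U \<and> C1_on U g \<and> (\<forall>y\<in>U. avg \<delta> h c y = g y)"
  proof (intro exI conjI ballI)
    show "open U" by (simp add: U_def)
    show "C1_on U (\<lambda>y. (\<Sum>\<alpha>\<in>near \<delta> h x. c \<alpha> * bump \<alpha> y) / (\<Sum>\<alpha>\<in>near \<delta> h x. bump \<alpha> y))"
      using e(2) by (intro C1_on_divide C1_on_sum C1_on_mult C1_on_const C1_on_subset[OF C1_on_bump]) force+
  qed (use xU e in auto)
qed

lemma avg_diff_le:
  fixes h :: "real^'n \<Rightarrow> real"
  assumes s: "slow \<delta> h" shows "\<bar>avg \<delta> h c x - a\<bar> \<le> (\<Sum>\<alpha>\<in>active \<delta> h x. \<bar>c \<alpha> - a\<bar>)"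
proof -
  define F where "F = active \<delta> h x"
  have F: "finite F" "active \<delta> h x \<subseteq> F" "F \<subseteq> cells \<delta> h" unfolding F_def
    using finite_active[OF s] by (auto simp: active_def)
  define \<sigma> where "\<sigma> = (\<Sum>\<alpha>\<in>F. bump \<alpha> x)"
  have s0: "0 < \<sigma>" using avg_eq_sum(2)[OF s F] by (simp add: \<sigma>_def)
  have "(\<Sum>\<alpha>\<in>F. (c \<alpha> - a) * bump \<alpha> x) = (\<Sum>\<alpha>\<in>F. c \<alpha> * bump \<alpha> x) - a * \<sigma>"
    by (simp add: left_diff_distrib sum_subtractf sum_distrib_left[symmetric] \<sigma>_def)
  then have "avg \<delta> h c x - a = (\<Sum>\<alpha>\<in>F. (c \<alpha> - a) * bump \<alpha> x) / \<sigma>"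
    using s0 unfolding avg_eq_sum(1)[OF s F] \<sigma>_def[symmetric] by (simp add: diff_divide_distrib)
  also have "\<bar>\<dots>\<bar> \<le> (\<Sum>\<alpha>\<in>F. \<bar>c \<alpha> - a\<bar> * \<sigma>) / \<sigma>"
  proof -
    have "\<bar>(\<Sum>\<alpha>\<in>F. (c \<alpha> - a) * bump \<alpha> x)\<bar> \<le> (\<Sum>\<alpha>\<in>F. \<bar>(c \<alpha> - a) * bump \<alpha> x\<bar>)" by (rule sum_abs)
    also have "\<dots> \<le> (\<Sum>\<alpha>\<in>F. \<bar>c \<alpha> - a\<bar> * \<sigma>)"
      unfolding abs_mult by (intro sum_mono mult_left_mono) (auto simp: \<sigma>_def F intro: member_le_sum)
    finally show ?thesis using s0 by (simp add: divide_right_mono)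
  qed
  also have "\<dots> = (\<Sum>\<alpha>\<in>F. \<bar>c \<alpha> - a\<bar>)" using s0 by (simp add: sum_distrib_right[symmetric])
  finally show ?thesis by (simp add: F_def)
qed

definition avg_const :: "'n::finite itself \<Rightarrow> real" where
  "avg_const T = 20 * real CARD('n) ^ 3 * (2 + 4 * real CARD('n) ^ 4 * real (overlap T))"

lemma frechet_avg_le0:
  fixes h :: "real^'n \<Rightarrow> real"
  assumes s: "slow \<delta> h"
  shows "\<bar>frechet_derivative (avg \<delta> h c) (at x) v\<bar>
    \<le> avg_const TYPE('n) / (\<delta> * h x) * norm v * (\<Sum>\<alpha>\<in>active \<delta> h x. \<bar>c \<alpha>\<bar>)"
proof -
  let ?n = "real CARD('n)" and ?N = "real (overlap TYPE('n))"
  define F where "F = near \<delta> h x"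
  define A where "A = active \<delta> h x"
  have F: "finite F" "active \<delta> h x \<subseteq> F" "F \<subseteq> cells \<delta> h" unfolding F_def
    using near_finite_card(1)[OF s, of x] active_subset_near[of \<delta> h x] near_subset_cells[of \<delta> h x] by blast+
  have A: "finite A" "active \<delta> h x \<subseteq> A" "A \<subseteq> cells \<delta> h" unfolding A_def
    using finite_active[OF s] by (auto simp: active_def)
  have AF: "A \<subseteq> F" using F A by (simp add: A_def)
  have cA: "real (card A) \<le> ?N"
    using card_mono[OF F(1) AF] near_finite_card(2)[OF s, of x] by (simp add: F_def)
  define \<sigma> where "\<sigma> = (\<Sum>\<alpha>\<in>F. bump \<alpha> x)"
  have sh: "1 / 2 \<le> \<sigma>" using avg_eq_sum(2)[OF s F] by (simp add: \<sigma>_def)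
  have d0: "0 < \<delta> * h x" using slowD(1)[OF s] slowD(3)[OF s, of x] by simp
  have D: "(avg \<delta> h c has_derivative (\<lambda>v. ((\<Sum>\<alpha>\<in>F. c \<alpha> * bump' \<alpha> x v) * \<sigma> - (\<Sum>\<alpha>\<in>F. c \<alpha> * bump \<alpha> x) * (\<Sum>\<alpha>\<in>F. bump' \<alpha> x v)) / (\<sigma> * \<sigma>))) (at x)"
  proof (rule has_derivative_transform_within_open[where s="ball x (\<delta> * h x / 10)"])
    show "((\<lambda>y. (\<Sum>\<alpha>\<in>F. c \<alpha> * bump \<alpha> y) / (\<Sum>\<alpha>\<in>F. bump \<alpha> y)) has_derivative (\<lambda>v. ((\<Sum>\<alpha>\<in>F. c \<alpha> * bump' \<alpha> x v) * \<sigma> - (\<Sum>\<alpha>\<in>F. c \<alpha> * bump \<alpha> x) * (\<Sum>\<alpha>\<in>F. bump' \<alpha> x v)) / (\<sigma> * \<sigma>))) (at x)"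
      unfolding \<sigma>_def
    proof (rule has_derivative_divide')
      show "((\<lambda>y. \<Sum>\<alpha>\<in>F. c \<alpha> * bump \<alpha> y) has_derivative (\<lambda>v. \<Sum>\<alpha>\<in>F. c \<alpha> * bump' \<alpha> x v)) (at x)"
        by (intro has_derivative_sum has_derivative_mult_right bump_has_derivative)
      show "((\<lambda>y. \<Sum>\<alpha>\<in>F. bump \<alpha> y) has_derivative (\<lambda>v. \<Sum>\<alpha>\<in>F. bump' \<alpha> x v)) (at x)"
        by (intro has_derivative_sum bump_has_derivative)
    qed (use sh in \<open>simp add: \<sigma>_def\<close>)
    fix y assume "y \<in> ball x (\<delta> * h x / 10)"
    then have "active \<delta> h y \<subseteq> F" unfolding F_def using active_locally[OF s] by simp
    from avg_eq_sum(1)[OF s F(1) this F(3), of c]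
    show "(\<Sum>\<alpha>\<in>F. c \<alpha> * bump \<alpha> y) / (\<Sum>\<alpha>\<in>F. bump \<alpha> y) = avg \<delta> h c y" by simp
  qed (use d0 in auto)
  define q where "q = norm v / (\<delta> * h x)"
  define L where "L = 20 * ?n ^ 3 * q"
  have L0: "0 \<le> L" using d0 by (simp add: L_def q_def)
  define W where "W = (\<Sum>\<alpha>\<in>A. \<bar>c \<alpha>\<bar>)"
  have W0: "0 \<le> W" by (simp add: W_def sum_nonneg)
  have b'L: "\<bar>bump' \<alpha> x v\<bar> \<le> L" if "\<alpha> \<in> A" for \<alpha>
  proof -
    have "\<delta> * h x / 5 < dyadic_side \<alpha>" by (rule near_scale(1)[OF s]) (use that AF in \<open>auto simp: F_def\<close>)
    then have "4 * ?n ^ 3 * norm v / dyadic_side \<alpha> \<le> 4 * ?n ^ 3 * norm v / (\<delta> * h x / 5)"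
      using d0 by (intro divide_left_mono) auto
    then show ?thesis using bump'_le[of \<alpha> x v] by (simp add: L_def q_def)
  qed
  have s1: "(\<Sum>\<alpha>\<in>F. c \<alpha> * bump' \<alpha> x v) = (\<Sum>\<alpha>\<in>A. c \<alpha> * bump' \<alpha> x v)"
    and s2: "(\<Sum>\<alpha>\<in>F. bump' \<alpha> x v) = (\<Sum>\<alpha>\<in>A. bump' \<alpha> x v)"
    and s3: "(\<Sum>\<alpha>\<in>F. c \<alpha> * bump \<alpha> x) = (\<Sum>\<alpha>\<in>A. c \<alpha> * bump \<alpha> x)"
    using sum_active_eq(2)[OF F, of c v] sum_active_eq(2)[OF F, of "\<lambda>_. 1" v] sum_active_eq(1)[OF F, of c] by (simp_all add: A_def)
  have e1: "\<bar>\<Sum>\<alpha>\<in>F. c \<alpha> * bump' \<alpha> x v\<bar> \<le> W * L" unfolding s1 W_def sum_distrib_right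
    by (rule order_trans[OF sum_abs]) (auto simp: abs_mult intro!: sum_mono mult_left_mono b'L)
  have e2: "\<bar>\<Sum>\<alpha>\<in>F. bump' \<alpha> x v\<bar> \<le> ?N * L"
  proof -
    have "\<bar>\<Sum>\<alpha>\<in>F. bump' \<alpha> x v\<bar> \<le> (\<Sum>\<alpha>\<in>A. L)" unfolding s2
      by (rule order_trans[OF sum_abs sum_mono]) (rule b'L)
    also have "\<dots> \<le> ?N * L" using cA L0 by (simp add: mult_right_mono)
    finally show ?thesis .
  qed
  have e3: "\<bar>\<Sum>\<alpha>\<in>F. c \<alpha> * bump \<alpha> x\<bar> \<le> W * ?n ^ 4" unfolding s3 W_def sum_distrib_right
    by (rule order_trans[OF sum_abs]) (auto simp: abs_mult intro!: sum_mono mult_left_mono bump_le)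
  have "frechet_derivative (avg \<delta> h c) (at x) v = (\<Sum>\<alpha>\<in>F. c \<alpha> * bump' \<alpha> x v) / \<sigma> - (\<Sum>\<alpha>\<in>F. c \<alpha> * bump \<alpha> x) * (\<Sum>\<alpha>\<in>F. bump' \<alpha> x v) / (\<sigma> * \<sigma>)"
    unfolding frechet_derivative_at[OF D, symmetric] using sh by (simp add: diff_divide_distrib)
  also have "\<bar>\<dots>\<bar> \<le> \<bar>(\<Sum>\<alpha>\<in>F. c \<alpha> * bump' \<alpha> x v) / \<sigma>\<bar> + \<bar>(\<Sum>\<alpha>\<in>F. c \<alpha> * bump \<alpha> x) * (\<Sum>\<alpha>\<in>F. bump' \<alpha> x v) / (\<sigma> * \<sigma>)\<bar>"
    by (rule abs_triangle_ineq4)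
  also have "\<dots> \<le> W * L / (1 / 2) + (W * ?n ^ 4) * (?N * L) / (1 / 2 * (1 / 2))"
  proof (rule add_mono)
    show "\<bar>(\<Sum>\<alpha>\<in>F. c \<alpha> * bump' \<alpha> x v) / \<sigma>\<bar> \<le> W * L / (1 / 2)"
      unfolding abs_divide using e1 sh by (intro frac_le) auto
    have "\<bar>(\<Sum>\<alpha>\<in>F. c \<alpha> * bump \<alpha> x) * (\<Sum>\<alpha>\<in>F. bump' \<alpha> x v)\<bar> \<le> (W * ?n ^ 4) * (?N * L)"
      unfolding abs_mult using e2 e3 W0 by (intro mult_mono) auto
    moreover have "1 / 2 * (1 / 2) \<le> \<bar>\<sigma> * \<sigma>\<bar>" using sh mult_mono[OF sh sh] by simp
    ultimately show "\<bar>(\<Sum>\<alpha>\<in>F. c \<alpha> * bump \<alpha> x) * (\<Sum>\<alpha>\<in>F. bump' \<alpha> x v) / (\<sigma> * \<sigma>)\<bar> \<le> (W * ?n ^ 4) * (?N * L) / (1 / 2 * (1 / 2))"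
      unfolding abs_divide[of _ "\<sigma> * \<sigma>"] by (intro frac_le) auto
  qed
  also have "\<dots> = avg_const TYPE('n) * q * W"
    unfolding avg_const_def L_def by (simp add: algebra_simps)
  also have "\<dots> = avg_const TYPE('n) / (\<delta> * h x) * norm v * W" by (simp add: q_def)
  finally show ?thesis by (simp add: W_def A_def)
qed

text \<open>Subtracting a constant from all values does not change the derivative.\<close>

lemma frechet_avg_le:
  fixes h :: "real^'n \<Rightarrow> real"
  assumes s: "slow \<delta> h"
  shows "\<bar>frechet_derivative (avg \<delta> h c) (at x) v\<bar>
    \<le> avg_const TYPE('n) / (\<delta> * h x) * norm v * (\<Sum>\<alpha>\<in>active \<delta> h x. \<bar>c \<alpha> - a\<bar>)"
proof -
  have "avg \<delta> h c y = avg \<delta> h (\<lambda>\<alpha>. c \<alpha> - a) y + a" for y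
  proof -
    have "0 < (\<Sum>\<alpha>\<in>near \<delta> h y. bump \<alpha> y)" using bump_sum_ge[OF s near_finite_card(1)[OF s] order_refl, of y] by linarith
    then show ?thesis by (simp add: avg_def left_diff_distrib sum_subtractf sum_distrib_left[symmetric] diff_divide_distrib)
  qed
  then have eq: "avg \<delta> h c = (\<lambda>y. avg \<delta> h (\<lambda>\<alpha>. c \<alpha> - a) y + a)" by auto
  have "(avg \<delta> h c has_derivative frechet_derivative (avg \<delta> h (\<lambda>\<alpha>. c \<alpha> - a)) (at x)) (at x)"
    unfolding eq using C1_on_frechet(1)[OF C1_on_avg[OF s] UNIV_I] by (auto intro!: derivative_eq_intros)
  from frechet_derivative_at[OF this] frechet_avg_le0[OF s, of "\<lambda>\<alpha>. c \<alpha> - a" x v] show ?thesis by simp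
qed

section \<open>Transition layers\<close>

abbreviation height :: "real \<Rightarrow> (real^'n::finite \<Rightarrow> real) \<Rightarrow> real^'n \<Rightarrow> real" where
  "height \<delta> h \<equiv> avg \<delta> h dyadic_side"

lemma height_bounds:
  fixes h :: "real^'n \<Rightarrow> real"
  assumes s: "slow \<delta> h"
  shows "\<delta> * h x / 5 \<le> height \<delta> h x" "height \<delta> h x \<le> 4 / 3 * (\<delta> * h x)" "0 < height \<delta> h x"
proof -
  define F where "F = near \<delta> h x"
  define \<sigma> where "\<sigma> = (\<Sum>\<alpha>\<in>F. bump \<alpha> x)"
  have s0: "0 < \<sigma>" using bump_sum_ge[OF s near_finite_card(1)[OF s] order_refl, of x] by (simp add: \<sigma>_def F_def)
  have "\<delta> * h x / 5 * \<sigma> \<le> (\<Sum>\<alpha>\<in>F. dyadic_side \<alpha> * bump \<alpha> x)"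
    unfolding \<sigma>_def sum_distrib_left using near_scale(1)[OF s]
    by (intro sum_mono mult_right_mono) (auto simp: F_def intro: less_imp_le)
  moreover have "(\<Sum>\<alpha>\<in>F. dyadic_side \<alpha> * bump \<alpha> x) \<le> 4 / 3 * (\<delta> * h x) * \<sigma>"
    unfolding \<sigma>_def sum_distrib_left using near_scale(2)[OF s]
    by (intro sum_mono mult_right_mono) (auto simp: F_def)
  ultimately show 1: "\<delta> * h x / 5 \<le> height \<delta> h x" "height \<delta> h x \<le> 4 / 3 * (\<delta> * h x)"
    using s0 unfolding avg_def F_def[symmetric] \<sigma>_def[symmetric]
    by (simp_all only: pos_le_divide_eq pos_divide_le_eq)
  have "0 < \<delta> * h x / 5" using slowD(1)[OF s] slowD(3)[OF s, of x] by simp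
  with 1(1) show "0 < height \<delta> h x" by linarith
qed

lemma frechet_height_le:
  fixes h :: "real^'n \<Rightarrow> real"
  assumes s: "slow \<delta> h"
  shows "\<bar>frechet_derivative (height \<delta> h) (at x) v\<bar> \<le> 4 / 3 * real (overlap TYPE('n)) * avg_const TYPE('n) * norm v"
proof -
  let ?N = "real (overlap TYPE('n))" and ?C = "avg_const TYPE('n)"
  have d0: "0 < \<delta> * h x" using slowD(1)[OF s] slowD(3)[OF s, of x] by simp
  have C0: "0 \<le> ?C" by (simp add: avg_const_def)
  have "(\<Sum>\<alpha>\<in>active \<delta> h x. \<bar>dyadic_side \<alpha>\<bar>) \<le> (\<Sum>\<alpha>\<in>active \<delta> h x. 4 / 3 * (\<delta> * h x))"
    using near_scale(2)[OF s] active_subset_near[of \<delta> h x] by (intro sum_mono) auto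
  also have "\<dots> \<le> ?N * (4 / 3 * (\<delta> * h x))"
  proof -
    have "card (active \<delta> h x) \<le> overlap TYPE('n)"
      using card_mono[OF near_finite_card(1)[OF s] active_subset_near, of x] near_finite_card(2)[OF s, of x] by simp
    then have "real (card (active \<delta> h x)) * (4 / 3 * (\<delta> * h x)) \<le> ?N * (4 / 3 * (\<delta> * h x))"
      using d0 by (intro mult_right_mono) auto
    then show ?thesis by simp
  qed
  finally have "?C / (\<delta> * h x) * norm v * (\<Sum>\<alpha>\<in>active \<delta> h x. \<bar>dyadic_side \<alpha>\<bar>) \<le> ?C / (\<delta> * h x) * norm v * (?N * (4 / 3 * (\<delta> * h x)))"
    using d0 C0 by (intro mult_left_mono) auto
  also have "\<dots> = 4 / 3 * ?N * ?C * norm v" using less_imp_neq[OF d0] by simp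
  finally show ?thesis using frechet_avg_le0[OF s, of dyadic_side x v] by linarith
qed

text \<open>One term of the extension: the transition from the averages at scale \<open>h'\<close> to the finer averages at
  scale \<open>h\<close>, at a height which is itself the average of the sides of the cells.\<close>

definition layer :: "real \<Rightarrow> (real^'n::finite \<Rightarrow> real) \<Rightarrow> (real^'n \<Rightarrow> real) \<Rightarrow> ('n dyadic \<Rightarrow> real)
    \<Rightarrow> ('n dyadic \<Rightarrow> real) \<Rightarrow> (real^'n) \<times> real \<Rightarrow> real" where
  "layer \<delta> h h' c c' z = cutoff (snd z / height \<delta> h (fst z)) * (avg \<delta> h c (fst z) - avg \<delta> h' c' (fst z))"

lemma C1_on_layer:
  fixes h :: "real^'n \<Rightarrow> real"
  assumes s: "slow \<delta> h" "slow \<delta> h'" shows "C1_on UNIV (layer \<delta> h h' c c')"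
proof -
  have a: "C1_on UNIV (\<lambda>z :: (real^'n) \<times> real. avg \<delta> g c (fst z))" if "slow \<delta> g" for g c
    using C1_on_fst[OF C1_on_avg[OF that], of UNIV] by simp
  have "height \<delta> h x \<noteq> 0" for x using height_bounds(3)[OF s(1), of x] by simp
  then show ?thesis unfolding layer_def[abs_def]
    by (intro C1_on_mult C1_on_diff a s C1_on_compose_real[OF _ DERIV_cutoff continuous_on_cutoff'] C1_on_divide C1_on_snd)
       simp
qed

text \<open>The cells of scale \<open>h\<close> whose values enter the averages at the points of \<open>P\<close>. The cube \<open>P\<close> is a
  cell of the same or of a smaller scale.\<close>

definition touching :: "real \<Rightarrow> (real^'n \<Rightarrow> real) \<Rightarrow> 'n::finite dyadic \<Rightarrow> 'n dyadic set" where
  "touching \<delta> h P = (\<Union>y\<in>closure (dyadic_cube P). active \<delta> h y)"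

lemma touching_near:
  fixes h h' :: "real^'n \<Rightarrow> real"
  assumes s: "slow \<delta> h" "slow \<delta> h'" and hh': "\<And>x. h x \<le> h' x" and P: "P \<in> cells \<delta> h"
    and y: "y \<in> closure (dyadic_cube P)"
  shows "touching \<delta> h' P \<subseteq> near \<delta> h' y"
proof
  fix \<alpha> assume "\<alpha> \<in> touching \<delta> h' P"
  then obtain x where x: "x \<in> closure (dyadic_cube P)" and \<alpha>: "\<alpha> \<in> active \<delta> h' x" by (auto simp: touching_def)
  let ?n = "real CARD('n)" and ?c = "dyadic_centre P"
  have "\<delta> * h' x / 5 < dyadic_side \<alpha>" using near_scale(1)[OF s(2)] \<alpha> active_subset_near by blast
  moreover have "dyadic_side P \<le> 4 / 3 * (\<delta> * h x)" by (rule near_scale(2)[OF s(1) cell_near[OF P x]])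
  moreover have "\<delta> * h x \<le> \<delta> * h' x" using hh' slowD(1)[OF s(1)] by (intro mult_left_mono) auto
  ultimately have "dyadic_side P \<le> 7 * dyadic_side \<alpha>" using dyadic_side_pos[of \<alpha>] by linarith
  then have "?n * dyadic_side P \<le> ?n * (7 * dyadic_side \<alpha>)" by (intro mult_left_mono) auto
  moreover have "dist y ?c \<le> ?n * dyadic_side P / 2" "dist x ?c \<le> ?n * dyadic_side P / 2"
    using dist_centre_le x y by blast+
  moreover have "dist y (dyadic_centre \<alpha>) \<le> dist y ?c + dist x ?c + dist x (dyadic_centre \<alpha>)"
    by metric
  moreover have "dist x (dyadic_centre \<alpha>) < ?n * dyadic_side \<alpha>" using \<alpha> by (simp add: active_def)
  ultimately have "dist y (dyadic_centre \<alpha>) \<le> 8 * ?n * dyadic_side \<alpha>" by linarith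
  then show "\<alpha> \<in> near \<delta> h' y" using \<alpha> by (simp add: near_def active_def)
qed

lemma touching_finite_card:
  fixes h h' :: "real^'n \<Rightarrow> real"
  assumes s: "slow \<delta> h" "slow \<delta> h'" and hh': "\<And>x. h x \<le> h' x" and P: "P \<in> cells \<delta> h"
  shows "finite (touching \<delta> h' P)" "card (touching \<delta> h' P) \<le> overlap TYPE('n)"
proof -
  have sub: "touching \<delta> h' P \<subseteq> near \<delta> h' (dyadic_centre P)"
    by (rule touching_near[OF s hh' P]) (use centre_in_dyadic_cube cube_subset_closure in blast)
  show "finite (touching \<delta> h' P)" using sub near_finite_card(1)[OF s(2)] finite_subset by blast
  show "card (touching \<delta> h' P) \<le> overlap TYPE('n)"
    using card_mono[OF near_finite_card(1)[OF s(2)] sub] near_finite_card(2)[OF s(2), of "dyadic_centre P"] by simp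
qed

definition layer_const :: "'n::finite itself \<Rightarrow> real" where
  "layer_const T = 1 + 2 * (20 * (1 + 3 * real (overlap T) * avg_const T) + avg_const T)"

lemma layer_const_nonneg: "0 \<le> layer_const T"
  by (simp add: layer_const_def avg_const_def)

text \<open>All factors are differentiated at the cost of \<open>1 / (\<delta> h x)\<close>, which is comparable with \<open>1 / side P\<close>: for the coarser scale because
  \<open>h \<le> h'\<close>, and for the cutoff because its derivative vanishes unless \<open>t\<close> is below twice the height. Twice the height is
  at most \<open>8/3\<close> times \<open>\<delta> h x\<close>, and this is less than \<open>14\<close> sides of \<open>P\<close>.\<close>

lemma layer_bounds:
  fixes h h' :: "real^'n \<Rightarrow> real" and c c' :: "'n dyadic \<Rightarrow> real" and a :: real
  assumes s: "slow \<delta> h" "slow \<delta> h'" and hh': "\<And>x. h x \<le> h' x" and P: "P \<in> cells \<delta> h"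
    and x: "x \<in> closure (dyadic_cube P)" and t: "0 < t"
  defines "S \<equiv> (\<Sum>\<alpha>\<in>touching \<delta> h P. \<bar>c \<alpha> - a\<bar>) + (\<Sum>\<alpha>\<in>touching \<delta> h' P. \<bar>c' \<alpha> - a\<bar>)"
    and "I \<equiv> if t < 14 * dyadic_side P then 1 else (0::real)"
  shows "\<bar>layer \<delta> h h' c c' (x, t)\<bar> \<le> layer_const TYPE('n) / dyadic_side P * S * I"
    "\<bar>frechet_derivative (layer \<delta> h h' c c') (at (x, t)) w\<bar> \<le> layer_const TYPE('n) / dyadic_side P * S * I * norm w"
proof -
  let ?N = "real (overlap TYPE('n))" and ?C = "avg_const TYPE('n)"
  let ?H = "height \<delta> h" and ?r = "dyadic_side P"
  let ?D = "\<lambda>g w. frechet_derivative g (at x) w"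
  define u where "u = avg \<delta> h c"
  define u' where "u' = avg \<delta> h' c'"
  define q where "q = \<delta> * h x"
  have q0: "0 < q" using slowD(1)[OF s(1)] slowD(3)[OF s(1), of x] by (simp add: q_def)
  have qq': "q \<le> \<delta> * h' x" using hh' slowD(1)[OF s(1)] by (simp add: q_def mult_left_mono)
  have C0: "0 \<le> ?C" by (simp add: avg_const_def)
  define SA where "SA = (\<Sum>\<alpha>\<in>active \<delta> h x. \<bar>c \<alpha> - a\<bar>) + (\<Sum>\<alpha>\<in>active \<delta> h' x. \<bar>c' \<alpha> - a\<bar>)"
  have SA: "SA \<le> S" unfolding SA_def S_def
    using x touching_finite_card(1)[OF s(1) s(1) order_refl P] touching_finite_card(1)[OF s hh' P]
    by (intro add_mono sum_mono2) (auto simp: touching_def)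
  have SA0: "0 \<le> SA" by (simp add: SA_def sum_nonneg)
  have diff: "\<bar>u x - u' x\<bar> \<le> SA"
    using avg_diff_le[OF s(1), where c=c and x=x and a=a] avg_diff_le[OF s(2), where c=c' and x=x and a=a] unfolding u_def u'_def SA_def by linarith
  have Ddiff: "\<bar>?D u v - ?D u' v\<bar> \<le> ?C / q * norm v * SA" for v
  proof -
    have "\<bar>?D u v\<bar> \<le> ?C / q * norm v * (\<Sum>\<alpha>\<in>active \<delta> h x. \<bar>c \<alpha> - a\<bar>)"
      using frechet_avg_le[OF s(1), where c=c and x=x and a=a] by (simp add: u_def q_def)
    moreover have "\<bar>?D u' v\<bar> \<le> ?C / (\<delta> * h' x) * norm v * (\<Sum>\<alpha>\<in>active \<delta> h' x. \<bar>c' \<alpha> - a\<bar>)"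
      using frechet_avg_le[OF s(2), where c=c' and x=x and a=a] by (simp add: u'_def)
    moreover have "?C / (\<delta> * h' x) * norm v * (\<Sum>\<alpha>\<in>active \<delta> h' x. \<bar>c' \<alpha> - a\<bar>) \<le> ?C / q * norm v * (\<Sum>\<alpha>\<in>active \<delta> h' x. \<bar>c' \<alpha> - a\<bar>)"
      using q0 qq' C0 by (intro mult_right_mono divide_left_mono) (auto intro: sum_nonneg)
    ultimately show ?thesis unfolding SA_def distrib_left by linarith
  qed
  have H: "q / 5 \<le> ?H x" "?H x \<le> 4 / 3 * q" "0 < ?H x" using height_bounds[OF s(1), where x=x] by (simp_all add: q_def)
  have rq: "q / 5 < ?r" "?r \<le> 4 / 3 * q" using near_scale[OF s(1) cell_near[OF P x]] by (simp_all add: q_def)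
  define y where "y = t / ?H x"
  define L where "L = layer_const TYPE('n) / ?r"
  define K where "K = 4 * (5 / q * (1 + 3 * ?N * ?C)) + ?C / q"
  have "20 * (1 + 3 * ?N * ?C) + ?C \<ge> 0" using C0 by simp
  then have KL: "K \<le> L" and L1: "1 \<le> L"
  proof -
    define Z where "Z = 20 * (1 + 3 * ?N * ?C) + ?C"
    assume Z0: "20 * (1 + 3 * ?N * ?C) + ?C \<ge> 0"
    have "K = Z / q" by (simp add: K_def Z_def add_divide_distrib)
    also have "\<dots> \<le> Z / (?r / 2)" using Z0 rq q0 by (intro divide_left_mono) (auto simp: Z_def)
    also have "\<dots> = 2 * Z / ?r" by simp
    also have "\<dots> \<le> L" unfolding L_def layer_const_def Z_def by (intro divide_right_mono) auto
    finally show "K \<le> L" .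
    have "1 \<le> layer_const TYPE('n)" using Z0 by (simp add: layer_const_def)
    then have "?r \<le> layer_const TYPE('n)" using dyadic_side_le_1[of P] by linarith
    then show "1 \<le> L" by (simp add: L_def)
  qed
  have big: "2 \<le> y" if "\<not> t < 14 * ?r"
  proof -
    have "2 * ?H x \<le> t" using that H rq by linarith
    then show ?thesis using H by (simp add: y_def pos_le_divide_eq)
  qed
  have lay: "layer \<delta> h h' c c' (x, t) = cutoff y * (u x - u' x)" by (simp add: layer_def y_def u_def u'_def)
  show "\<bar>layer \<delta> h h' c c' (x, t)\<bar> \<le> layer_const TYPE('n) / dyadic_side P * S * I"
  proof (cases "t < 14 * ?r")
    case True
    have "\<bar>cutoff y\<bar> * \<bar>u x - u' x\<bar> \<le> 1 * SA" using cutoff_bounds[of y] diff by (intro mult_mono) auto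
    also have "\<dots> \<le> L * S" using L1 SA SA0 by (intro mult_mono) auto
    finally show ?thesis using True by (simp add: lay abs_mult I_def L_def)
  next
    case False
    then show ?thesis using cutoff_ge_2(1)[OF big[OF False]] by (simp add: lay I_def)
  qed
  define dy where "dy w = (snd w * ?H x - t * ?D ?H (fst w)) / (?H x * ?H x)" for w :: "(real^'n) \<times> real"
  have Davg: "((\<lambda>z. avg \<delta> g c (fst z)) has_derivative (\<lambda>w. ?D (avg \<delta> g c) (fst w))) (at (x, t))" if "slow \<delta> g" for g c
  proof -
    have "(fst has_derivative fst) (at (x, t))" by (rule has_derivative_fst) (rule has_derivative_ident)
    from has_derivative_compose[OF this, of "avg \<delta> g c"] C1_on_frechet(1)[OF C1_on_avg[OF that] UNIV_I, of c x]
    show ?thesis by simp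
  qed
  have "((\<lambda>z. snd z / ?H (fst z)) has_derivative dy) (at (x, t))"
    unfolding dy_def
    using has_derivative_divide'[OF has_derivative_snd[OF has_derivative_ident] Davg[OF s(1), of dyadic_side]] H
    by simp
  from has_derivative_compose[OF this, of cutoff "(*) (cutoff' y)"] DERIV_cutoff[of y]
  have "((\<lambda>z. cutoff (snd z / ?H (fst z))) has_derivative (\<lambda>w. cutoff' y * dy w)) (at (x, t))"
    by (simp add: y_def has_field_derivative_def)
  from has_derivative_mult[OF this has_derivative_diff[OF Davg[OF s(1), of c] Davg[OF s(2), of c']]]
  have "(layer \<delta> h h' c c' has_derivative (\<lambda>w. cutoff y * (?D u (fst w) - ?D u' (fst w)) + cutoff' y * dy w * (u x - u' x))) (at (x, t))"
    unfolding layer_def[abs_def] by (simp add: u_def u'_def y_def)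
  from frechet_derivative_at[OF this, symmetric]
  have fr: "frechet_derivative (layer \<delta> h h' c c') (at (x, t)) w = cutoff y * (?D u (fst w) - ?D u' (fst w)) + cutoff' y * dy w * (u x - u' x)"
    by simp
  show "\<bar>frechet_derivative (layer \<delta> h h' c c') (at (x, t)) w\<bar> \<le> layer_const TYPE('n) / dyadic_side P * S * I * norm w"
  proof (cases "y < 2")
    case True
    then have "t < 14 * ?r" using big by force
    then have I: "I = 1" by (simp add: I_def)
    have nw: "norm (fst w) \<le> norm w" "\<bar>snd w\<bar> \<le> norm w" using norm_fst_le[of "fst w" "snd w"] norm_snd_le[of "snd w" "fst w"] by simp_all
    have dy: "\<bar>dy w\<bar> \<le> 5 / q * (1 + 3 * ?N * ?C) * norm w"
    proof -
      have "dy w = (snd w - y * ?D ?H (fst w)) / ?H x" using H by (simp add: dy_def y_def field_simps)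
      also have "\<bar>\<dots>\<bar> \<le> (1 + 3 * ?N * ?C) * norm w / (q / 5)"
        unfolding abs_divide
      proof (rule frac_le)
        have "\<bar>y * ?D ?H (fst w)\<bar> \<le> 2 * (4 / 3 * ?N * ?C * norm (fst w))"
          unfolding abs_mult using True t H frechet_height_le[OF s(1), of x "fst w"]
          by (intro mult_mono) (auto simp: y_def)
        also have "\<dots> = 8 / 3 * (?N * ?C * norm (fst w))" by simp
        also have "\<dots> \<le> 3 * (?N * ?C * norm w)" using nw(1) C0 by (intro mult_mono) auto
        finally show "\<bar>snd w - y * ?D ?H (fst w)\<bar> \<le> (1 + 3 * ?N * ?C) * norm w"
          using nw(2) by (simp add: algebra_simps)
      qed (use H q0 C0 in auto)
      finally show ?thesis by (simp add: mult_ac)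
    qed
    have "\<bar>cutoff y * (?D u (fst w) - ?D u' (fst w))\<bar> \<le> 1 * (?C / q * norm w * SA)"
      unfolding abs_mult
    proof (rule mult_mono)
      show "\<bar>?D u (fst w) - ?D u' (fst w)\<bar> \<le> ?C / q * norm w * SA"
        using Ddiff[of "fst w"] mult_right_mono[OF mult_left_mono[OF nw(1), of "?C / q"] SA0] C0 q0 by simp
    qed (use cutoff_bounds in auto)
    moreover have "\<bar>cutoff' y * dy w * (u x - u' x)\<bar> \<le> 4 * (5 / q * (1 + 3 * ?N * ?C) * norm w) * SA"
      unfolding abs_mult using cutoff_bounds(3)[of y] dy diff C0 q0 by (intro mult_mono mult_nonneg_nonneg) auto
    ultimately have "\<bar>frechet_derivative (layer \<delta> h h' c c') (at (x, t)) w\<bar> \<le> K * norm w * SA"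
      unfolding fr K_def by (simp add: algebra_simps)
    also have "\<dots> \<le> L * norm w * S"
      using KL SA SA0 L1 by (intro mult_mono) auto
    finally show ?thesis by (simp add: I L_def mult_ac)
  next
    case False
    then show ?thesis using cutoff_ge_2[of y] fr SA SA0 L1 by (auto simp: I_def L_def[symmetric])
  qed
qed

section \<open>The scale of an admissible system of tilings\<close>

text \<open>The constant \<open>\<delta>\<close> is so small that cells at the scale of the tilings (\<open>scale\<close> below) are much smaller than
  \<open>lam\<close> times any tile around them. The proof of \<open>cell_inside_reduced\<close> fixes its size.\<close>

locale trace_setting =
  fixes C c1 c2 lam \<delta> :: real and k0 :: nat
    and \<gamma> :: "(real^'n::finite) \<times> real \<Rightarrow> real" and \<phi> :: "real^'n \<Rightarrow> real"
    and A :: "nat \<Rightarrow> 'n dyadic set" and e :: "nat \<Rightarrow> nat \<Rightarrow> 'n dyadic"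
  assumes C: "1 \<le> C" and c1: "1 \<le> c1" and c2: "1 \<le> c2" and lam: "lam = 1 / 2 ^ k0"
    and \<delta>_def: "\<delta> = 1 / 2 ^ (2 * k0 + 2 * CARD('n) + 8)"
    and A1: "A1_loc C \<gamma>" and \<phi>: "locally_integrable UNIV \<phi>" and adm: "admissible lam c1 c2 \<gamma> A"
begin

abbreviation wm :: "'n dyadic \<Rightarrow> real" where "wm \<equiv> weight_mean \<gamma>"

lemma lam_pos: "0 < lam" by (simp add: lam)

lemma weight: "weight \<gamma>" using A1 by (simp add: A1_loc_def)

lemma wm_pos: "0 < wm \<alpha>" by (rule weight_mean_pos[OF weight])

lemma tile_cover: "\<exists>\<alpha>\<in>A s. x \<in> closure (dyadic_cube \<alpha>)"
  using adm unfolding admissible_def tiling_system_def tiling_def by blast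

lemma neighbours_comparable:
  "\<alpha> \<in> A s \<Longrightarrow> \<alpha>' \<in> A s \<Longrightarrow> x \<in> enlarged lam \<alpha> \<Longrightarrow> x \<in> enlarged lam \<alpha>' \<Longrightarrow> wm \<alpha> \<le> c1 * wm \<alpha>'"
  using adm unfolding admissible_def by blast

lemma parent:
  assumes "\<alpha>' \<in> A (Suc s)"
  shows "\<exists>\<alpha>\<in>A s. closure (dyadic_cube \<alpha>') \<subseteq> closure (dyadic_cube \<alpha>) \<and> wm \<alpha>' \<le> c2 * wm \<alpha>"
proof -
  have "succeeds (A (Suc s)) (A s)" using adm unfolding admissible_def tiling_system_def by blast
  then obtain \<alpha> where \<alpha>: "\<alpha> \<in> A s" "closure (dyadic_cube \<alpha>') \<subseteq> closure (dyadic_cube \<alpha>)"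
    using assms unfolding succeeds_def by blast
  then have "dyadic_cube \<alpha>' \<subseteq> dyadic_cube \<alpha>"
    using interior_mono[OF \<alpha>(2)] by (simp add: interior_closure_dyadic_cube)
  then have "wm \<alpha>' \<le> c2 * wm \<alpha>" using adm \<alpha>(1) assms unfolding admissible_def by blast
  with \<alpha> show ?thesis by blast
qed

lemma side_lower: "\<exists>l. (s = 0 \<longrightarrow> l = 0) \<and> (\<forall>\<alpha>\<in>A s. 1 / 2 ^ l \<le> dyadic_side \<alpha>)"
proof -
  obtain l :: "nat \<Rightarrow> nat" where "l 0 = 0" "\<And>s \<alpha>. \<alpha> \<in> A s \<Longrightarrow> 1 / 2 ^ l s \<le> dyadic_side \<alpha>"
    using adm unfolding admissible_def by blast
  then show ?thesis by (intro exI[of _ "l s"]) auto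
qed

lemma finite_enlarged: "finite {\<alpha>\<in>A s. x \<in> enlarged lam \<alpha>}"
  using side_lower[of s] finite_enlarged_containing by blast

text \<open>All cubes of the coarsest tiling have side at least 1, so it is the tiling by unit cubes.\<close>

lemma level_0: "\<alpha> \<in> A 0 \<longleftrightarrow> fst \<alpha> = 0"
proof
  show f0: "fst \<alpha> = 0" if "\<alpha> \<in> A 0" for \<alpha>
  proof -
    have "1 \<le> dyadic_side \<alpha>" using side_lower[of 0] that by force
    then have "(2::real) ^ fst \<alpha> \<le> 2 ^ 0" by (simp add: dyadic_side_def field_simps)
    then show ?thesis by (subst (asm) power_increasing_iff) auto
  qed
  assume a: "fst \<alpha> = 0"
  obtain \<alpha>' where \<alpha>': "\<alpha>' \<in> A 0" "dyadic_centre \<alpha> \<in> closure (dyadic_cube \<alpha>')" using tile_cover by blast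
  have "\<bar>real_of_int (snd \<alpha> $ i) - real_of_int (snd \<alpha>' $ i)\<bar> \<le> 1 / 2" for i
    using \<alpha>'(2) f0[OF \<alpha>'(1)] a by (auto simp: mem_closure_dyadic_cube dyadic_centre_def dyadic_side_def)
  then have "\<bar>real_of_int (snd \<alpha> $ i) - real_of_int (snd \<alpha>' $ i)\<bar> < 1" for i
    by (rule le_less_trans) simp
  then have "snd \<alpha> $ i = snd \<alpha>' $ i" for i
  proof -
    assume "\<And>i. \<bar>real_of_int (snd \<alpha> $ i) - real_of_int (snd \<alpha>' $ i)\<bar> < 1"
    from this[of i] show ?thesis by linarith
  qed
  then have "\<alpha> = \<alpha>'" using a f0[OF \<alpha>'(1)] by (simp add: prod_eq_iff vec_eq_iff)
  then show "\<alpha> \<in> A 0" using \<alpha>' by simp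
qed

text \<open>The third admissibility condition, freed from the maximum and the minimum.\<close>

lemma side_halved:
  assumes "\<alpha>' \<in> A (Suc s)" "x \<in> enlarged lam \<alpha>'" "\<alpha> \<in> A s" "x \<in> enlarged lam \<alpha>"
  shows "dyadic_side \<alpha>' \<le> dyadic_side \<alpha> / 2"
proof -
  let ?X = "{dyadic_side \<alpha>' | \<alpha>'. \<alpha>' \<in> A (Suc s) \<and> x \<in> enlarged lam \<alpha>'}"
  let ?Y = "{dyadic_side \<alpha> | \<alpha>. \<alpha> \<in> A s \<and> x \<in> enlarged lam \<alpha>}"
  have "?X = dyadic_side ` {\<alpha>\<in>A (Suc s). x \<in> enlarged lam \<alpha>}" "?Y = dyadic_side ` {\<alpha>\<in>A s. x \<in> enlarged lam \<alpha>}" by auto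
  then have fin: "finite ?X" "finite ?Y" using finite_enlarged by auto
  have "dyadic_side \<alpha>' \<le> Max ?X" by (rule Max_ge[OF fin(1)]) (use assms in blast)
  also have "\<dots> \<le> 1 / 2 * Min ?Y" using adm unfolding admissible_def by blast
  also have "\<dots> \<le> 1 / 2 * dyadic_side \<alpha>" proof -
    have "dyadic_side \<alpha> \<in> ?Y" using assms by blast
    from Min_le[OF fin(2) this] show ?thesis by simp
  qed
  finally show ?thesis by simp
qed

lemma closure_in_enlarged: "x \<in> closure (dyadic_cube \<alpha>) \<Longrightarrow> x \<in> enlarged lam \<alpha>" for \<alpha> :: "'n dyadic"
  using closure_cube_subset_enlarged[OF lam_pos] by blast

lemma side_upper: "\<alpha> \<in> A s \<Longrightarrow> dyadic_side \<alpha> \<le> 1 / 2 ^ s"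
proof (induction s arbitrary: \<alpha>)
  case (Suc s)
  have x: "dyadic_centre \<alpha> \<in> closure (dyadic_cube \<alpha>)" using centre_in_dyadic_cube cube_subset_closure by blast
  obtain \<beta> where "\<beta> \<in> A s" "dyadic_centre \<alpha> \<in> closure (dyadic_cube \<beta>)" using tile_cover by blast
  from side_halved[OF Suc.prems closure_in_enlarged[OF x] this(1) closure_in_enlarged[OF this(2)]] Suc.IH[OF this(1)]
  show ?case by simp
qed (simp add: dyadic_side_le_1)

text \<open>The path from \<open>\<alpha>\<close> to \<open>\<beta>\<close> goes through the tile containing \<open>x\<close> at the finer level and the tile above it.\<close>

lemma level_comparable:
  assumes "\<alpha> \<in> A (Suc s)" "x \<in> enlarged lam \<alpha>" "\<beta> \<in> A s" "x \<in> enlarged lam \<beta>"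
  shows "wm \<alpha> \<le> c1 ^ 2 * c2 * wm \<beta>"
proof -
  obtain \<alpha>' where \<alpha>': "\<alpha>' \<in> A (Suc s)" "x \<in> closure (dyadic_cube \<alpha>')" using tile_cover by blast
  obtain \<alpha>'' where \<alpha>'': "\<alpha>'' \<in> A s" "x \<in> closure (dyadic_cube \<alpha>'')" "wm \<alpha>' \<le> c2 * wm \<alpha>''"
    using parent[OF \<alpha>'(1)] \<alpha>'(2) by blast
  have "wm \<alpha> \<le> c1 * wm \<alpha>'" using neighbours_comparable[OF assms(1) \<alpha>'(1)] assms(2) closure_in_enlarged \<alpha>'(2) by blast
  also have "\<dots> \<le> c1 * (c2 * wm \<alpha>'')" using \<alpha>''(3) c1 by (intro mult_left_mono) auto
  also have "\<dots> \<le> c1 * (c2 * (c1 * wm \<beta>))"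
    using neighbours_comparable[OF \<alpha>''(1) assms(3) closure_in_enlarged[OF \<alpha>''(2)] assms(4)] c1 c2
    by (intro mult_left_mono) auto
  finally show ?thesis by (simp add: power2_eq_square mult_ac)
qed

text \<open>With this slope a tile that influences the scale at a point of a tile \<open>\<alpha>\<close> meets the enlargement
  of \<open>\<alpha>\<close>: \<open>K * dist < side \<alpha>\<close> gives \<open>dist < lam * side \<alpha> / 4\<close>.\<close>

definition K :: real where "K = 4 * 2 ^ k0"

definition scale :: "nat \<Rightarrow> real^'n \<Rightarrow> real" where
  "scale s x = (INF \<alpha>\<in>A s. dyadic_side \<alpha> + K * infdist x (closure (dyadic_cube \<alpha>)))"

lemma K_ge: "4 \<le> K" and K_lam: "K * lam = 4" by (simp_all add: K_def lam)

lemma A_nonempty: "A s \<noteq> {}" using tile_cover by blast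

lemma scale_bdd: "bdd_below ((\<lambda>\<alpha>. dyadic_side \<alpha> + K * infdist x (closure (dyadic_cube \<alpha>))) ` A s)"
  using K_ge by (intro bdd_belowI2[of _ 0] add_nonneg_nonneg mult_nonneg_nonneg infdist_nonneg) auto

lemma scale_le: "\<alpha> \<in> A s \<Longrightarrow> scale s x \<le> dyadic_side \<alpha> + K * infdist x (closure (dyadic_cube \<alpha>))"
  unfolding scale_def by (rule cINF_lower[OF scale_bdd])

lemma scale_le_tile: "\<alpha> \<in> A s \<Longrightarrow> x \<in> closure (dyadic_cube \<alpha>) \<Longrightarrow> scale s x \<le> dyadic_side \<alpha>"
  using scale_le[of \<alpha> s x] by simp

lemma scale_almost_attained:
  assumes "scale s x < y" shows "\<exists>\<alpha>\<in>A s. dyadic_side \<alpha> + K * infdist x (closure (dyadic_cube \<alpha>)) < y"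
proof -
  have "(\<lambda>\<alpha>. dyadic_side \<alpha> + K * infdist x (closure (dyadic_cube \<alpha>))) ` A s \<noteq> {}" using A_nonempty by simp
  from cInf_lessD[OF this assms[unfolded scale_def]] show ?thesis by blast
qed

lemma scale_lower: "\<exists>l. \<forall>x. 1 / 2 ^ l \<le> scale s x"
proof -
  obtain l where l: "\<And>\<alpha>. \<alpha> \<in> A s \<Longrightarrow> 1 / 2 ^ l \<le> dyadic_side \<alpha>" using side_lower[of s] by blast
  have "1 / 2 ^ l \<le> scale s x" for x unfolding scale_def
  proof (rule cINF_greatest[OF A_nonempty])
    fix \<alpha> assume "\<alpha> \<in> A s"
    moreover have "0 \<le> K * infdist x (closure (dyadic_cube \<alpha>))"
      using K_ge by (intro mult_nonneg_nonneg infdist_nonneg) auto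
    ultimately show "1 / 2 ^ l \<le> dyadic_side \<alpha> + K * infdist x (closure (dyadic_cube \<alpha>))"
      using l[of \<alpha>] by linarith
  qed
  then show ?thesis by blast
qed

lemma scale_pos: "0 < scale s x"
proof -
  obtain l where "1 / 2 ^ l \<le> scale s x" using scale_lower[of s] by blast
  moreover have "(0::real) < 1 / 2 ^ l" by simp
  ultimately show ?thesis by linarith
qed

lemma scale_upper: "scale s x \<le> 1 / 2 ^ s"
proof -
  obtain \<alpha> where "\<alpha> \<in> A s" "x \<in> closure (dyadic_cube \<alpha>)" using tile_cover by blast
  then show ?thesis using scale_le_tile[of \<alpha> s x] side_upper[of \<alpha> s] by linarith
qed

lemma scale_lipschitz: "\<bar>scale s x - scale s y\<bar> \<le> K * dist x y"
proof -
  have "scale s x \<le> scale s y + K * dist x y" for x y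
  proof -
    have "scale s x - K * dist x y \<le> scale s y"
      unfolding scale_def[of s y]
    proof (rule cINF_greatest[OF A_nonempty])
      fix \<alpha> assume "\<alpha> \<in> A s"
      then have "scale s x \<le> dyadic_side \<alpha> + K * infdist x (closure (dyadic_cube \<alpha>))" by (rule scale_le)
      also have "\<dots> \<le> dyadic_side \<alpha> + K * (infdist y (closure (dyadic_cube \<alpha>)) + dist x y)"
        using K_ge infdist_triangle by (intro add_left_mono mult_left_mono) auto
      finally show "scale s x - K * dist x y \<le> dyadic_side \<alpha> + K * infdist y (closure (dyadic_cube \<alpha>))"
        by (simp add: algebra_simps)
    qed
    then show ?thesis by simp
  qed
  from this[of x y] this[of y x] show ?thesis by (simp add: dist_commute)
qed

text \<open>The point of a tile \<open>\<alpha>\<close> nearest to \<open>x\<close> lies in a tile of the next level, and the latter is smaller than \<open>\<alpha>\<close>.\<close>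

lemma scale_antimono: "scale (Suc s) x \<le> scale s x"
  unfolding scale_def[of s]
proof (rule cINF_greatest[OF A_nonempty])
  fix \<alpha> assume \<alpha>: "\<alpha> \<in> A s"
  have ne: "closure (dyadic_cube \<alpha>) \<noteq> {}" using centre_in_dyadic_cube[of \<alpha>] cube_subset_closure[of \<alpha>] by blast
  obtain p where p: "p \<in> closure (dyadic_cube \<alpha>)" "infdist x (closure (dyadic_cube \<alpha>)) = dist x p"
    using infdist_attains_inf[OF closed_closure ne] by blast
  obtain \<alpha>' where \<alpha>': "\<alpha>' \<in> A (Suc s)" "p \<in> closure (dyadic_cube \<alpha>')" using tile_cover by blast
  have "dyadic_side \<alpha>' \<le> dyadic_side \<alpha>"
    using side_halved[OF \<alpha>'(1) closure_in_enlarged[OF \<alpha>'(2)] \<alpha> closure_in_enlarged[OF p(1)]] dyadic_side_pos[of \<alpha>] by linarith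
  moreover have "infdist x (closure (dyadic_cube \<alpha>')) \<le> dist x p" by (rule infdist_le[OF \<alpha>'(2)])
  then have "K * infdist x (closure (dyadic_cube \<alpha>')) \<le> K * dist x p" using K_ge by (intro mult_left_mono) auto
  ultimately show "scale (Suc s) x \<le> dyadic_side \<alpha> + K * infdist x (closure (dyadic_cube \<alpha>))"
    using scale_le[OF \<alpha>'(1), of x] p(2) by simp
qed

lemma n_less: "real CARD('n) < 2 ^ CARD('n)" using of_nat_less_two_power by blast

lemma \<delta>_eq: "\<delta> * 2 ^ CARD('n) * 2 ^ CARD('n) * 2 ^ k0 * 2 ^ k0 * 256 = 1"
  unfolding \<delta>_def power_add mult_2 by simp

lemma \<delta>_pos: "0 < \<delta>" by (simp add: \<delta>_def)

lemma \<delta>_le: "\<delta> \<le> 1 / 256"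
proof -
  have "(1::real) \<le> 2 ^ (2 * k0 + 2 * CARD('n))" by simp
  then show ?thesis by (simp add: \<delta>_def power_add field_simps)
qed

lemma slow_scale: "slow \<delta> (scale s)"
  unfolding slow_def
proof (intro conjI allI)
  show "0 < \<delta>" "\<delta> \<le> 1" using \<delta>_pos \<delta>_le by auto
  show "0 < scale s x" for x by (rule scale_pos)
  show "scale s x \<le> 1" for x
    using scale_upper[of s x] by (rule order_trans) (simp add: divide_simps)
  fix x y :: "real^'n"
  have "32 * real CARD('n) * \<delta> * K \<le> 32 * 2 ^ CARD('n) * \<delta> * K"
    using n_less \<delta>_pos K_ge by (intro mult_right_mono) auto
  also have "\<dots> = \<delta> * 2 ^ CARD('n) * 2 ^ k0 * 128" by (simp add: K_def)
  also have "\<dots> \<le> \<delta> * 2 ^ CARD('n) * 2 ^ k0 * 128 * 2 ^ (CARD('n) + k0 + 1)"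
    using mult_left_mono[OF one_le_power[of "2::real" "CARD('n) + k0 + 1"], of "\<delta> * 2 ^ CARD('n) * 2 ^ k0 * 128"] \<delta>_pos
    by simp
  also have "\<dots> = 1" using \<delta>_eq by (simp add: power_add mult_ac)
  finally have k: "32 * real CARD('n) * \<delta> * K \<le> 1" .
  have "32 * real CARD('n) * \<delta> * \<bar>scale s x - scale s y\<bar> \<le> 32 * real CARD('n) * \<delta> * (K * dist x y)"
    using scale_lipschitz \<delta>_pos by (intro mult_left_mono) auto
  also have "\<dots> = (32 * real CARD('n) * \<delta> * K) * dist x y" by simp
  also have "\<dots> \<le> 1 * dist x y" by (rule mult_right_mono[OF k]) simp
  finally show "32 * real CARD('n) * \<delta> * \<bar>scale s x - scale s y\<bar> \<le> dist x y" by simp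
qed

section \<open>Cells inside cubes of the reduced family\<close>

text \<open>Let \<open>p\<close> be the point nearest to the centre of \<open>P\<close> on the grid of mesh \<open>G\<close>, where \<open>G\<close> is a large multiple of the side
  of \<open>P\<close>. It is in the enlargement of the tile around the centre, hence in the enlargement of some \<open>\<beta>\<close> in the reduced family.
  This \<open>\<beta>\<close> cannot be small, since a small tile near the centre would force a small scale there. So the faces of its
  enlargement lie on the grid, and the cells of the grid around \<open>p\<close> lie inside.\<close>

lemma cell_inside_reduced:
  assumes P: "P \<in> cells \<delta> (scale s)"
  shows "\<exists>\<beta>\<in>reduced lam (A s) (e s). cball (dyadic_centre P) (8 * real CARD('n) * dyadic_side P) \<subseteq> enlarged lam \<beta>"
proof -
  define x where "x = dyadic_centre P"
  define h where "h = scale s x"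
  define k where "k = fst P"
  define r where "r = dyadic_side P"
  let ?n = "real CARD('n)"
  let ?t = "2 ^ CARD('n) :: real" and ?z = "2 ^ k0 :: real"
  \<comment> \<open>The mesh is \<open>2 ^ i0\<close> sides, more than \<open>16 n\<close>, so that the ball has radius less than half a mesh.\<close>
  define i0 where "i0 = CARD('n) + 4"
  have r: "r = 1 / 2 ^ k" "0 < r" by (simp_all add: r_def k_def dyadic_side_def)
  have h0: "0 < h" "h \<le> 1" using slowD(3,4)[OF slow_scale] by (auto simp: h_def)
  have rh: "r \<le> \<delta> * h" using P by (simp add: cells_def r_def h_def x_def)
  have t1: "1 \<le> ?t" and z1: "1 \<le> ?z" by simp_all
  have d: "\<delta> * (?t * ?t * ?z * ?z) = 1 / 256" using \<delta>_eq by (simp add: mult_ac)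
  have i0: "2 ^ i0 = 16 * ?t" by (simp add: i0_def power_add)
  have "\<delta> * h \<le> \<delta>" using h0 \<delta>_pos by (simp add: mult_left_le)
  have ki0: "i0 \<le> k"
  proof -
    have "16 * ?t \<le> 256 * (?t * ?t * ?z * ?z)"
    proof -
      have "?t * 1 * 1 * 1 \<le> ?t * ?t * ?z * ?z" using t1 z1 by (intro mult_mono) auto
      then show ?thesis using t1 by linarith
    qed
    then have "\<delta> * (16 * ?t) \<le> \<delta> * (256 * (?t * ?t * ?z * ?z))" using \<delta>_pos by (intro mult_left_mono) auto
    also have "\<dots> = 1" using d by simp
    finally have "\<delta> * 2 ^ i0 \<le> 1" unfolding i0 .
    moreover have "r * 2 ^ i0 \<le> \<delta> * 2 ^ i0" using rh \<open>\<delta> * h \<le> \<delta>\<close> by (intro mult_right_mono) auto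
    ultimately have "r * 2 ^ i0 \<le> 1" by linarith
    then have "(2::real) ^ i0 \<le> 2 ^ k" by (simp add: r field_simps)
    then show ?thesis by simp
  qed
  define j where "j = k - i0"
  define G where "G = 1 / (2::real) ^ j"
  have G: "G = 16 * ?t * r" "0 < G"
  proof -
    have "(2::real) ^ k = 2 ^ j * 2 ^ i0" using ki0 by (simp add: j_def flip: power_add)
    then show "G = 16 * ?t * r" unfolding G_def r i0[symmetric] by simp
  qed (simp add: G_def)
  have Gh: "G \<le> 16 * ?t * (\<delta> * h)" unfolding G using rh by (intro mult_left_mono) auto
  define a where "a i = round (2 ^ j * x $ i)" for i
  define p :: "real^'n" where "p = (\<chi> i. of_int (a i) / 2 ^ j)"
  have pa: "2 ^ j * p $ i = of_int (a i)" for i by (simp add: p_def)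
  have px: "\<bar>p $ i - x $ i\<bar> \<le> G / 2" for i
  proof -
    have "\<bar>of_int (a i) - 2 ^ j * x $ i\<bar> \<le> 1 / 2" unfolding a_def by (rule of_int_round_abs_le)
    moreover have "of_int (a i) - 2 ^ j * x $ i = 2 ^ j * (p $ i - x $ i)" by (simp add: right_diff_distrib pa)
    ultimately have "2 ^ j * \<bar>p $ i - x $ i\<bar> \<le> 1 / 2" by (simp add: abs_mult)
    then show ?thesis by (simp add: G_def field_simps)
  qed
  obtain \<alpha> where \<alpha>: "\<alpha> \<in> A s" "x \<in> closure (dyadic_cube \<alpha>)" using tile_cover by blast
  have ha: "h \<le> dyadic_side \<alpha>" using scale_le_tile[OF \<alpha>] by (simp add: h_def)
  have "p \<in> enlarged lam \<alpha>" unfolding mem_enlarged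
  proof
    fix i
    have "G < lam * dyadic_side \<alpha>"
    proof -
      have "16 * (\<delta> * (?t * 1 * ?z * 1)) \<le> 16 * (\<delta> * (?t * ?t * ?z * ?z))"
        using t1 z1 \<delta>_pos by (intro mult_left_mono mult_mono) auto
      then have "16 * ?t * \<delta> * ?z < 1" using d by (simp add: mult_ac)
      then have "16 * ?t * \<delta> < lam" by (simp add: lam field_simps)
      then have "16 * ?t * \<delta> * h < lam * dyadic_side \<alpha>"
        using ha h0 lam_pos by (intro mult_less_le_imp_less) (auto simp: \<delta>_pos less_imp_le)
      then show ?thesis using Gh by (simp add: mult_ac)
    qed
    moreover have "\<bar>x $ i - dyadic_centre \<alpha> $ i\<bar> \<le> dyadic_side \<alpha> / 2" using \<alpha>(2) by (simp add: mem_closure_dyadic_cube)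
    moreover have "(1 + lam) * dyadic_side \<alpha> / 2 = dyadic_side \<alpha> / 2 + lam * dyadic_side \<alpha> / 2" by (simp add: field_simps)
    ultimately show "\<bar>p $ i - dyadic_centre \<alpha> $ i\<bar> < (1 + lam) * dyadic_side \<alpha> / 2" using px[of i] by linarith
  qed
  then obtain \<beta> where \<beta>: "\<beta> \<in> reduced lam (A s) (e s)" "p \<in> enlarged lam \<beta>"
    using reduced_covers[OF finite_enlarged \<alpha>(1)] by blast
  have \<beta>A: "\<beta> \<in> A s" using \<beta>(1) reduced_subset by blast
  let ?R = "dyadic_side \<beta>"
  \<comment> \<open>A lower bound for the side of \<open>\<beta>\<close>, from \<open>scale_le\<close>.\<close>
  have "infdist x (closure (dyadic_cube \<beta>)) \<le> infdist p (closure (dyadic_cube \<beta>)) + dist x p"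
    by (rule infdist_triangle)
  moreover have "infdist p (closure (dyadic_cube \<beta>)) \<le> ?n * (lam * ?R / 2)"
    using infdist_cube_le[OF \<beta>(2)] lam_pos by simp
  moreover have "dist x p \<le> ?n * (G / 2)"
    unfolding dist_norm using px by (intro norm_le_of_components) (simp add: abs_minus_commute)
  ultimately have "K * infdist x (closure (dyadic_cube \<beta>)) \<le> K * (?n * (lam * ?R / 2) + ?n * (G / 2))"
    using K_ge by (intro mult_left_mono) auto
  also have "\<dots> = (K * lam) * ?n * ?R / 2 + K * ?n * G / 2" by (simp add: algebra_simps add_divide_distrib)
  also have "\<dots> = 2 * ?n * ?R + K * ?n * G / 2" unfolding K_lam by simp
  finally have "h \<le> ?R + (2 * ?n * ?R + K * ?n * G / 2)"
    using scale_le[OF \<beta>A, of x] by (simp add: h_def)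
  moreover have "K * ?n * G / 2 \<le> h / 8"
  proof -
    have "K * ?n * G / 2 \<le> K * ?t * (16 * ?t * (\<delta> * h)) / 2"
      using n_less Gh K_ge h0 \<delta>_pos G by (intro divide_right_mono mult_mono mult_nonneg_nonneg) auto
    also have "\<dots> = 32 * h * (\<delta> * (?t * ?t * ?z * 1))" by (simp add: K_def)
    also have "\<dots> \<le> 32 * h * (\<delta> * (?t * ?t * ?z * ?z))"
      using t1 z1 \<delta>_pos h0 by (intro mult_left_mono mult_mono) auto
    also have "\<dots> = h / 8" unfolding d by simp
    finally show ?thesis .
  qed
  moreover have "?R + 2 * ?n * ?R \<le> 3 * ?t * ?R"
  proof -
    have "1 * ?R \<le> ?t * ?R" using t1 by (intro mult_right_mono) auto
    moreover have "?n * ?R \<le> ?t * ?R" using n_less by (intro mult_right_mono) auto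
    ultimately show ?thesis unfolding mult.assoc by linarith
  qed
  ultimately have hR: "h \<le> 4 * ?t * ?R" using h0 by linarith
  have GR: "?z * 2 * G \<le> ?R"
  proof -
    have "?z * 2 * G \<le> ?z * 2 * (16 * ?t * (\<delta> * (4 * ?t * ?R)))"
    proof -
      have "16 * ?t * (\<delta> * h) \<le> 16 * ?t * (\<delta> * (4 * ?t * ?R))"
        using hR \<delta>_pos by (intro mult_left_mono) auto
      then have "G \<le> 16 * ?t * (\<delta> * (4 * ?t * ?R))" using Gh by (rule order_trans[rotated])
      then show ?thesis by (intro mult_left_mono) auto
    qed
    also have "\<dots> = 128 * ?R * (\<delta> * (?t * ?t * ?z * 1))" by simp
    also have "\<dots> \<le> 128 * ?R * (\<delta> * (?t * ?t * ?z * ?z))"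
      using t1 z1 \<delta>_pos by (intro mult_left_mono mult_mono) auto
    also have "\<dots> = ?R / 2" unfolding d by simp
    finally show ?thesis using dyadic_side_pos[of \<beta>] by linarith
  qed
  have jb: "fst \<beta> + k0 + 1 \<le> j"
  proof -
    have "(2::real) ^ (fst \<beta> + k0 + 1) \<le> 2 ^ j"
      using GR by (simp add: G_def dyadic_side_def field_simps power_add)
    then show ?thesis by (rule power_le_imp_le_exp[rotated]) simp
  qed
  have "cball x (8 * ?n * r) \<subseteq> enlarged lam \<beta>"
  proof
    fix y assume y: "y \<in> cball x (8 * ?n * r)"
    have "y \<in> enlarged (1 / 2 ^ k0) \<beta>"
    proof (rule grid_cell_inside_enlarged[OF jb _ pa])
      show "p \<in> enlarged (1 / 2 ^ k0) \<beta>" using \<beta>(2) by (simp add: lam)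
      fix i
      have "\<bar>y $ i - x $ i\<bar> \<le> 8 * ?n * r"
        using y component_le_norm_cart[of "x - y" i] by (simp add: dist_norm)
      also have "\<dots> < 8 * ?t * r" by (rule mult_strict_right_mono[OF _ r(2)]) (use n_less in simp)
      also have "8 * ?t * r = G / 2" by (simp add: G)
      finally have "\<bar>y $ i - x $ i\<bar> < G / 2" .
      then have "\<bar>y $ i - p $ i\<bar> < G" using px[of i] by linarith
      then show "2 ^ j * \<bar>y $ i - p $ i\<bar> < 1" by (simp add: G_def field_simps)
    qed
    then show "y \<in> enlarged lam \<beta>" by (simp add: lam)
  qed
  then show ?thesis using \<beta>(1) by (auto simp: x_def r_def)
qed

section \<open>The weight above a cell\<close>

definition weight_const :: real where
  "weight_const = C * c1 * (6 / \<delta>) ^ (CARD('n) + 1)"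

text \<open>An almost minimiser \<open>\<alpha>'\<close> of the scale at the centre of \<open>P\<close> has a weight mean of at most \<open>c1\<close> times that of \<open>\<alpha>\<close>,
  whatever their sides, and the cube \<open>S\<close> contains both the box over \<open>\<alpha>'\<close> and the box over \<open>P\<close>. The level is \<open>Suc s\<close>
  because the side of \<open>S\<close>, \<open>3/2\<close> times the scale, must not exceed 1.\<close>

lemma weight_above_cell:
  assumes P: "P \<in> cells \<delta> (scale (Suc s))" and \<alpha>: "\<alpha> \<in> A (Suc s)" "dyadic_centre P \<in> closure (dyadic_cube \<alpha>)"
  shows "(\<integral>\<^sup>+z\<in>closure (dyadic_cube P) \<times> {0<..<14 * dyadic_side P}. ennreal (\<gamma> z) \<partial>lebesgue)
    \<le> ennreal (weight_const * wm \<alpha> * dyadic_side P ^ (CARD('n) + 1))"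
proof -
  define x where "x = dyadic_centre P"
  define h where "h = scale (Suc s) x"
  define r where "r = dyadic_side P"
  let ?d = "\<lambda>\<alpha>. infdist x (closure (dyadic_cube \<alpha>))"
  have h0: "0 < h" using slowD(3)[OF slow_scale] by (auto simp: h_def)
  have h2: "h \<le> 1 / 2"
  proof -
    have "1 / 2 ^ Suc s \<le> (1 / 2 :: real)" by (simp add: divide_simps)
    then show ?thesis using scale_upper[of "Suc s" x] unfolding h_def by linarith
  qed
  have r0: "0 < r" by (simp add: r_def)
  have rh: "r \<le> \<delta> * h" "\<delta> * h / 4 < r" using P by (simp_all add: cells_def r_def h_def x_def)
  have rh': "r \<le> h / 256" using rh(1) mult_right_mono[OF \<delta>_le, of h] h0 by linarith
  have ha: "h \<le> dyadic_side \<alpha>" using scale_le_tile[OF \<alpha>] by (simp add: h_def x_def)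
  have ne: "closure (dyadic_cube \<alpha>') \<noteq> {}" for \<alpha>' :: "'n dyadic"
    using centre_in_dyadic_cube[of \<alpha>'] cube_subset_closure[of \<alpha>'] by blast
  \<comment> \<open>The bound \<open>5/4\<close> leaves room for \<open>P\<close> within the half side \<open>3/4 h\<close> of \<open>S\<close>. If the scale equals the side of \<open>\<alpha>\<close>, then \<open>\<alpha>\<close> itself attains the infimum.\<close>
  have "\<exists>\<alpha>'\<in>A (Suc s). dyadic_side \<alpha>' + K * ?d \<alpha>' \<le> 5 / 4 * h \<and> wm \<alpha>' \<le> c1 * wm \<alpha>"
  proof (cases "h = dyadic_side \<alpha>")
    case True
    have "wm \<alpha> \<le> c1 * wm \<alpha>" using c1 wm_pos[of \<alpha>] by (simp add: mult_ge1_I less_imp_le)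
    moreover have "?d \<alpha> = 0" using \<alpha>(2) by (simp add: x_def)
    ultimately show ?thesis using \<alpha>(1) True h0 by (intro bexI[of _ \<alpha>]) auto
  next
    case False
    then have "scale (Suc s) x < min (dyadic_side \<alpha>) (5 / 4 * h)" using ha h0 by (simp add: h_def)
    then obtain \<alpha>' where \<alpha>': "\<alpha>' \<in> A (Suc s)" "dyadic_side \<alpha>' + K * ?d \<alpha>' < min (dyadic_side \<alpha>) (5 / 4 * h)"
      using scale_almost_attained by blast
    obtain q where q: "q \<in> closure (dyadic_cube \<alpha>')" "?d \<alpha>' = dist x q"
      using infdist_attains_inf[OF closed_closure ne] by blast
    have "K * dist x q < dyadic_side \<alpha>" using \<alpha>'(2)[unfolded q(2)] dyadic_side_pos[of \<alpha>'] by linarith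
    then have "lam * (K * dist x q) < lam * dyadic_side \<alpha>" using lam_pos by simp
    moreover have "lam * (K * dist x q) = (K * lam) * dist x q" by simp
    ultimately have dq: "4 * dist x q < lam * dyadic_side \<alpha>" unfolding K_lam by simp
    have "q \<in> enlarged lam \<alpha>" unfolding mem_enlarged
    proof
      fix i
      have "\<bar>x $ i - q $ i\<bar> \<le> dist x q" using component_le_norm_cart[of "x - q" i] by (simp add: dist_norm)
      moreover have "\<bar>x $ i - dyadic_centre \<alpha> $ i\<bar> \<le> dyadic_side \<alpha> / 2" using \<alpha>(2) by (simp add: mem_closure_dyadic_cube x_def)
      moreover have "(1 + lam) * dyadic_side \<alpha> / 2 = dyadic_side \<alpha> / 2 + lam * dyadic_side \<alpha> / 2" by (simp add: field_simps)
      moreover have "0 \<le> dist x q" by simp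
      ultimately show "\<bar>q $ i - dyadic_centre \<alpha> $ i\<bar> < (1 + lam) * dyadic_side \<alpha> / 2" using dq by linarith
    qed
    then have "wm \<alpha>' \<le> c1 * wm \<alpha>" using neighbours_comparable[OF \<alpha>'(1) \<alpha>(1) closure_in_enlarged[OF q(1)]] by blast
    then show ?thesis using \<alpha>' by (intro bexI[of _ \<alpha>']) auto
  qed
  then obtain \<alpha>' where \<alpha>': "\<alpha>' \<in> A (Suc s)" "dyadic_side \<alpha>' + K * ?d \<alpha>' \<le> 5 / 4 * h" "wm \<alpha>' \<le> c1 * wm \<alpha>" by blast
  obtain q where q: "q \<in> closure (dyadic_cube \<alpha>')" "?d \<alpha>' = dist x q"
    using infdist_attains_inf[OF closed_closure ne] by blast
  let ?R = "dyadic_side \<alpha>'" and ?c = "dyadic_centre \<alpha>'"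
  have K4: "4 * dist x q \<le> K * dist x q" using K_ge by (intro mult_right_mono) auto
  have R: "?R + 4 * dist x q \<le> 5 / 4 * h" using \<alpha>'(2)[unfolded q(2)] K4 by linarith
  have dq0: "0 \<le> dist x q" by simp
  define z where "z = (?c, ?R / 2)"
  define S where "S = ocube z (3 / 2 * h)"
  have sub: "closure (dyadic_cube P) \<times> {0<..<14 * r} \<subseteq> S"
  proof
    fix w assume "w \<in> closure (dyadic_cube P) \<times> {0<..<14 * r}"
    then obtain y t where w: "w = (y, t)" "y \<in> closure (dyadic_cube P)" "0 < t" "t < 14 * r" by auto
    have "y \<in> ocube ?c (3 / 2 * h)" unfolding mem_ocube_cart
    proof
      fix i
      have "\<bar>x $ i - q $ i\<bar> \<le> dist x q" using component_le_norm_cart[of "x - q" i] by (simp add: dist_norm)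
      moreover have "\<bar>y $ i - x $ i\<bar> \<le> r / 2" using w(2) by (simp add: mem_closure_dyadic_cube x_def r_def)
      moreover have "\<bar>q $ i - ?c $ i\<bar> \<le> ?R / 2" using q(1) by (simp add: mem_closure_dyadic_cube)
      ultimately show "\<bar>y $ i - ?c $ i\<bar> < 3 / 2 * h / 2" using R rh' h0 dq0 by linarith
    qed
    moreover have "t \<in> {?R / 2 - 3 / 2 * h / 2<..<?R / 2 + 3 / 2 * h / 2}"
      using w R rh' h0 dq0 dyadic_side_pos[of \<alpha>'] by (simp; linarith)
    ultimately show "w \<in> S" by (simp add: S_def z_def ocube_Pair w(1))
  qed
  have "mean S \<gamma> \<le> C * mean (ocube z ?R) \<gamma>" unfolding S_def
  proof (rule A1_loc_mean_le[OF A1 C])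
    show "0 < 3 / 2 * h" "3 / 2 * h \<le> 1" using h0 h2 by auto
    show "ocube z ?R \<subseteq> ocube z (3 / 2 * h)"
      using R h0 dq0 by (intro ocube_mono) linarith
  qed (auto simp: measure_ocube)
  also have "mean (ocube z ?R) \<gamma> = wm \<alpha>'" by (simp add: weight_mean_ocube z_def)
  finally have mS: "mean S \<gamma> \<le> C * (c1 * wm \<alpha>)"
    using mult_left_mono[OF \<alpha>'(3), of C] C by linarith
  have "(\<integral>\<^sup>+z\<in>closure (dyadic_cube P) \<times> {0<..<14 * r}. ennreal (\<gamma> z) \<partial>lebesgue) \<le> (\<integral>\<^sup>+z\<in>S. ennreal (\<gamma> z) \<partial>lebesgue)"
    using sub by (intro nn_integral_mono) (auto simp: indicator_def)
  also have "\<dots> = ennreal ((3 / 2 * h) ^ (CARD('n) + 1) * mean S \<gamma>)"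
    unfolding S_def using h0 by (subst nn_integral_weight_ocube[OF weight]) auto
  also have "\<dots> \<le> ennreal ((6 / \<delta> * r) ^ (CARD('n) + 1) * (C * (c1 * wm \<alpha>)))"
  proof (intro ennreal_leI mult_mono)
    have "3 / 2 * h \<le> 6 / \<delta> * r" using rh(2) \<delta>_pos by (simp add: field_simps)
    then show "(3 / 2 * h) ^ (CARD('n) + 1) \<le> (6 / \<delta> * r) ^ (CARD('n) + 1)" using h0 by (intro power_mono) auto
    show "0 \<le> (6 / \<delta> * r) ^ (CARD('n) + 1)" using r0 \<delta>_pos by simp
    have "0 < (LINT x:S|lebesgue. \<gamma> x)"
      using weight_set_integral_pos[OF weight, of S] h0 by (simp add: S_def emeasure_ocube)
    then show "0 \<le> mean S \<gamma>" by (simp add: mean_def)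
  qed (rule mS)
  also have "\<dots> = ennreal (weight_const * wm \<alpha> * r ^ (CARD('n) + 1))"
    unfolding power_mult_distrib weight_const_def by (simp only: mult_ac)
  finally show ?thesis by (simp add: r_def)
qed

section \<open>The energy density\<close>

text \<open>The energy of level \<open>s\<close> is the integral of this function of \<open>x\<close>. Working with the density allows each cell to be charged
  only for the part of the energy that lies over it. The unit cubes form level 0.\<close>

definition density :: "nat \<Rightarrow> real^'n \<Rightarrow> ennreal" where
  "density s x = (if s = 0
     then \<integral>\<^sup>+m. ennreal (wm (0, m)) * (ennreal \<bar>\<phi> x\<bar> * indicator (dyadic_cube (0, m)) x) \<partial>count_space UNIV
     else \<integral>\<^sup>+\<beta>. ennreal (wm \<beta>) * (ennreal \<bar>mean (enlarged lam \<beta>) \<phi> - \<phi> x\<bar> * indicator (enlarged lam \<beta>) x)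
       \<partial>count_space (reduced lam (A s) (e s)))"

lemma \<phi>_measurable [measurable]: "\<phi> \<in> borel_measurable lebesgue"
  by (rule locally_integrable_borel[OF \<phi>])

lemma \<gamma>_measurable [measurable]: "\<gamma> \<in> borel_measurable lebesgue"
  using weight locally_integrable_borel unfolding weight_def by blast

lemma enlarged_sets [measurable]: "enlarged lam \<beta> \<in> sets lebesgue" "dyadic_cube \<beta> \<in> sets lebesgue" for \<beta> :: "'n dyadic"
  by (simp_all add: enlarged_def dyadic_cube_ocube)

lemma density_summand_measurable:
  assumes "S \<in> sets lebesgue"
  shows "(\<lambda>x. ennreal w * (ennreal \<bar>a - \<phi> x\<bar> * indicator S x)) \<in> borel_measurable lebesgue"
    "(\<lambda>x. ennreal \<bar>a - \<phi> x\<bar> * indicator S x) \<in> borel_measurable lebesgue"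
proof -
  note [measurable] = assms
  show "(\<lambda>x. ennreal w * (ennreal \<bar>a - \<phi> x\<bar> * indicator S x)) \<in> borel_measurable lebesgue"
    "(\<lambda>x. ennreal \<bar>a - \<phi> x\<bar> * indicator S x) \<in> borel_measurable lebesgue" by measurable
qed

lemma density_measurable [measurable]: "density s \<in> borel_measurable lebesgue"
proof -
  have *: "(\<lambda>x. ennreal w * (ennreal \<bar>\<phi> x\<bar> * indicator S x)) \<in> borel_measurable lebesgue" if "S \<in> sets lebesgue" for S and w
    using density_summand_measurable(1)[OF that, of w 0] by simp
  show ?thesis unfolding density_def[abs_def]
    by (cases "s = 0")
       (auto intro!: borel_measurable_count_space_integral * density_summand_measurable enlarged_sets)
qed

lemma suminf_density_le: "(\<Sum>s. \<integral>\<^sup>+x. density s x \<partial>lebesgue) \<le> trace_energy lam \<gamma> A e \<phi>"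
proof -
  have *: "(\<lambda>x. ennreal w * (ennreal \<bar>\<phi> x\<bar> * indicator S x)) \<in> borel_measurable lebesgue"
    "(\<lambda>x. ennreal \<bar>\<phi> x\<bar> * indicator S x) \<in> borel_measurable lebesgue" if "S \<in> sets lebesgue" for S and w
    using density_summand_measurable(1)[OF that, of w 0] density_summand_measurable(2)[OF that, of 0] by simp_all
  let ?Z = "\<Sum>\<^sub>\<infinity>m\<in>UNIV. ennreal (wm (0, m)) * (\<integral>\<^sup>+ x\<in>dyadic_cube (0, m). ennreal \<bar>\<phi> x\<bar> \<partial>lebesgue)"
  let ?E = "\<lambda>s. \<Sum>\<^sub>\<infinity>\<alpha>\<in>reduced lam (A (Suc s)) (e (Suc s)). ennreal (wm \<alpha>) *
        (\<integral>\<^sup>+ x\<in>enlarged lam \<alpha>. ennreal \<bar>mean (enlarged lam \<alpha>) \<phi> - \<phi> x\<bar> \<partial>lebesgue)"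
  have 0: "(\<integral>\<^sup>+x. density 0 x \<partial>lebesgue) \<le> ?Z"
  proof -
    have "(\<integral>\<^sup>+x. density 0 x \<partial>lebesgue) = (\<integral>\<^sup>+m. (\<integral>\<^sup>+x. ennreal (wm (0, m)) * (ennreal \<bar>\<phi> x\<bar> * indicator (dyadic_cube (0, m)) x) \<partial>lebesgue) \<partial>count_space UNIV)"
      unfolding density_def by (simp del: nn_integral_cmult, subst nn_integral_count_space_nn_integral) (auto intro!: * enlarged_sets)
    also have "\<dots> = (\<integral>\<^sup>+m. ennreal (wm (0, m)) * (\<integral>\<^sup>+ x\<in>dyadic_cube (0, m). ennreal \<bar>\<phi> x\<bar> \<partial>lebesgue) \<partial>count_space UNIV)"
      by (intro nn_integral_cong nn_integral_cmult * enlarged_sets)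
    also have "\<dots> \<le> ?Z" by (rule count_space_integral_le_infsum) simp
    finally show ?thesis .
  qed
  have S: "(\<integral>\<^sup>+x. density (Suc s) x \<partial>lebesgue) \<le> ?E s" for s
  proof -
    let ?R = "reduced lam (A (Suc s)) (e (Suc s))"
    have "(\<integral>\<^sup>+x. density (Suc s) x \<partial>lebesgue) = (\<integral>\<^sup>+\<beta>. (\<integral>\<^sup>+x. ennreal (wm \<beta>) * (ennreal \<bar>mean (enlarged lam \<beta>) \<phi> - \<phi> x\<bar> * indicator (enlarged lam \<beta>) x) \<partial>lebesgue) \<partial>count_space ?R)"
      unfolding density_def by (simp del: nn_integral_cmult, subst nn_integral_count_space_nn_integral) (auto intro!: density_summand_measurable enlarged_sets)
    also have "\<dots> = (\<integral>\<^sup>+\<beta>. ennreal (wm \<beta>) * (\<integral>\<^sup>+ x\<in>enlarged lam \<beta>. ennreal \<bar>mean (enlarged lam \<beta>) \<phi> - \<phi> x\<bar> \<partial>lebesgue) \<partial>count_space ?R)"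
      by (intro nn_integral_cong nn_integral_cmult density_summand_measurable enlarged_sets)
    also have "\<dots> \<le> ?E s" by (rule count_space_integral_le_infsum) simp
    finally show ?thesis .
  qed
  show ?thesis
  proof (rule ennreal_suminf_le)
    fix k
    have "(\<Sum>s<k. \<integral>\<^sup>+x. density s x \<partial>lebesgue) \<le> (\<Sum>s<Suc k. \<integral>\<^sup>+x. density s x \<partial>lebesgue)"
      by (intro sum_mono2) auto
    also have "\<dots> = (\<integral>\<^sup>+x. density 0 x \<partial>lebesgue) + (\<Sum>s<k. \<integral>\<^sup>+x. density (Suc s) x \<partial>lebesgue)"
      by (rule sum.lessThan_Suc_shift)
    also have "\<dots> \<le> ?Z + (\<Sum>s<k. ?E s)" by (intro add_mono 0 sum_mono S)
    also have "\<dots> \<le> ?Z + (\<Sum>s. ?E s)" by (intro add_left_mono sum_le_suminf) auto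
    finally show "(\<Sum>s<k. \<integral>\<^sup>+x. density s x \<partial>lebesgue) \<le> trace_energy lam \<gamma> A e \<phi>"
      by (simp add: trace_energy_def)
  qed
qed

section \<open>Oscillation on a cell\<close>

text \<open>An enlarged cube of the reduced family around the dilated cell, provided by \<open>cell_inside_reduced\<close>.\<close>

definition host :: "nat \<Rightarrow> 'n dyadic \<Rightarrow> 'n dyadic" where
  "host s P = (SOME \<beta>. \<beta> \<in> reduced lam (A s) (e s) \<and>
     cball (dyadic_centre P) (8 * real CARD('n) * dyadic_side P) \<subseteq> enlarged lam \<beta>)"

text \<open>At level 0 the approximation is the zero function: the energy of this level contains \<open>\<bar>\<phi>\<bar>\<close>, not an
  oscillation. With this value the density of each level controls \<open>\<bar>cell_value s P - \<phi> x\<bar>\<close>.\<close>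

definition cell_value :: "nat \<Rightarrow> 'n dyadic \<Rightarrow> real" where
  "cell_value s P = (if s = 0 then 0 else mean (enlarged lam (host s P)) \<phi>)"

lemma host:
  assumes "P \<in> cells \<delta> (scale s)"
  shows "host s P \<in> reduced lam (A s) (e s)" "host s P \<in> A s"
    "cball (dyadic_centre P) (8 * real CARD('n) * dyadic_side P) \<subseteq> enlarged lam (host s P)"
proof -
  have "\<exists>\<beta>. \<beta> \<in> reduced lam (A s) (e s) \<and> cball (dyadic_centre P) (8 * real CARD('n) * dyadic_side P) \<subseteq> enlarged lam \<beta>"
    using cell_inside_reduced[OF assms] by blast
  from someI_ex[OF this, folded host_def] show "host s P \<in> reduced lam (A s) (e s)"
    "cball (dyadic_centre P) (8 * real CARD('n) * dyadic_side P) \<subseteq> enlarged lam (host s P)" by auto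
  then show "host s P \<in> A s" using reduced_subset by blast
qed

lemma near_in_host:
  assumes "P \<in> near \<delta> (scale s) y" shows "y \<in> enlarged lam (host s P)"
proof -
  have "y \<in> cball (dyadic_centre P) (8 * real CARD('n) * dyadic_side P)"
    using assms by (simp add: near_def dist_commute)
  then show ?thesis using host(3)[of P s] assms near_subset_cells by blast
qed

lemma density_Suc_ge:
  assumes "P \<in> near \<delta> (scale (Suc s)) y"
  shows "ennreal (wm (host (Suc s) P)) * ennreal \<bar>cell_value (Suc s) P - \<phi> y\<bar> \<le> density (Suc s) y"
proof -
  let ?R = "reduced lam (A (Suc s)) (e (Suc s))"
  have P: "P \<in> cells \<delta> (scale (Suc s))" using assms near_subset_cells by blast
  let ?f = "\<lambda>\<beta>. ennreal (wm \<beta>) * (ennreal \<bar>mean (enlarged lam \<beta>) \<phi> - \<phi> y\<bar> * indicator (enlarged lam \<beta>) y)"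
  have "?f (host (Suc s) P) \<le> (\<integral>\<^sup>+\<beta>. ?f \<beta> \<partial>count_space ?R)" by (rule nn_integral_ge_point[OF host(1)[OF P]])
  then show ?thesis using near_in_host[OF assms] by (simp add: density_def cell_value_def)
qed

lemma density_0_ge:
  assumes "y \<in> dyadic_cube (0, m)"
  shows "ennreal (wm (0, m)) * ennreal \<bar>\<phi> y\<bar> \<le> density 0 y"
proof -
  let ?f = "\<lambda>m. ennreal (wm (0, m)) * (ennreal \<bar>\<phi> y\<bar> * indicator (dyadic_cube (0, m)) y)"
  have "?f m \<le> (\<integral>\<^sup>+m. ?f m \<partial>count_space UNIV)" by (rule nn_integral_ge_point) simp
  then show ?thesis using assms by (simp add: density_def)
qed

definition cell_mean :: "'n dyadic \<Rightarrow> real" where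
  "cell_mean P = mean (closure (dyadic_cube P)) \<phi>"

text \<open>The oscillation of the values that the term number \<open>s\<close> of the extension uses over \<open>P\<close>, relative to one common constant.
  The energy controls it because the mean over the small cube \<open>P\<close> is compared with \<open>\<phi>\<close> itself.\<close>

definition osc :: "nat \<Rightarrow> 'n dyadic \<Rightarrow> real" where
  "osc s P = (\<Sum>\<alpha>\<in>touching \<delta> (scale (Suc s)) P. \<bar>cell_value (Suc s) \<alpha> - cell_mean P\<bar>)
     + (\<Sum>\<alpha>\<in>touching \<delta> (scale s) P. \<bar>cell_value s \<alpha> - cell_mean P\<bar>)"

lemma osc_nonneg: "0 \<le> osc s P" by (simp add: osc_def sum_nonneg)

lemma centre_in_closure: "dyadic_centre P \<in> closure (dyadic_cube P)" for P :: "'n dyadic"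
  using centre_in_dyadic_cube cube_subset_closure by blast

lemma comparability_transfer:
  assumes "wm \<alpha> \<le> q * wm \<beta>" "0 \<le> q" "ennreal (wm \<beta>) * X \<le> Y"
  shows "ennreal (wm \<alpha>) * X \<le> ennreal q * Y"
proof -
  have "ennreal (wm \<alpha>) * X \<le> ennreal (q * wm \<beta>) * X" by (intro mult_right_mono ennreal_leI assms(1)) simp
  also have "\<dots> = ennreal q * (ennreal (wm \<beta>) * X)"
    using assms(2) wm_pos[of \<beta>] by (simp add: ennreal_mult less_imp_le mult.assoc)
  also have "\<dots> \<le> ennreal q * Y" by (intro mult_left_mono assms(3)) simp
  finally show ?thesis .
qed

lemma c_const_ge_1: "1 \<le> c1 ^ 2 * c2" "c1 \<le> c1 ^ 2 * c2"
proof -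
  have "c1 * 1 \<le> c1 * (c1 * c2)" using c1 c2 mult_mono[OF c1 c2] by (intro mult_left_mono) auto
  then show "c1 \<le> c1 ^ 2 * c2" by (simp add: power2_eq_square mult.assoc)
  then show "1 \<le> c1 ^ 2 * c2" using c1 by linarith
qed

text \<open>The hosts of both levels contain all of \<open>P\<close>, so that their weight means are comparable with that of the tile around the
  centre of \<open>P\<close> and the density at \<open>x\<close> has the term of the host as a summand. At level 0 the unit cube containing \<open>x\<close>
  takes the role of the host, which is why the statement excludes a null set.\<close>

lemma level_value_AE:
  assumes P: "P \<in> cells \<delta> (scale (Suc s))" and \<alpha>: "\<alpha> \<in> A (Suc s)" "dyadic_centre P \<in> closure (dyadic_cube \<alpha>)"
  shows "\<alpha>' \<in> touching \<delta> (scale (Suc s)) P \<Longrightarrow> AE x in lebesgue. x \<in> closure (dyadic_cube P) \<longrightarrow>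
      ennreal (wm \<alpha>) * ennreal \<bar>cell_value (Suc s) \<alpha>' - \<phi> x\<bar> \<le> ennreal (c1 ^ 2 * c2) * density (Suc s) x" (is "_ \<Longrightarrow> ?one")
    and "\<alpha>' \<in> touching \<delta> (scale s) P \<Longrightarrow> AE x in lebesgue. x \<in> closure (dyadic_cube P) \<longrightarrow>
      ennreal (wm \<alpha>) * ennreal \<bar>cell_value s \<alpha>' - \<phi> x\<bar> \<le> ennreal (c1 ^ 2 * c2) * density s x" (is "_ \<Longrightarrow> ?two")
proof -
  let ?q = "c1 ^ 2 * c2"
  have q0: "0 \<le> ?q" using c_const_ge_1 by linarith
  have c\<alpha>: "dyadic_centre P \<in> enlarged lam \<alpha>" using closure_in_enlarged[OF \<alpha>(2)] .
  note tn1 = touching_near[OF slow_scale slow_scale order_refl P]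
  note tn2 = touching_near[OF slow_scale slow_scale scale_antimono P]
  {
    assume t: "\<alpha>' \<in> touching \<delta> (scale (Suc s)) P"
    have n0: "\<alpha>' \<in> near \<delta> (scale (Suc s)) (dyadic_centre P)" using tn1[OF centre_in_closure] t by blast
    then have cell: "\<alpha>' \<in> cells \<delta> (scale (Suc s))" using near_subset_cells by blast
    have "wm \<alpha> \<le> c1 * wm (host (Suc s) \<alpha>')"
      using neighbours_comparable[OF \<alpha>(1) host(2)[OF cell] c\<alpha> near_in_host[OF n0]] .
    also have "\<dots> \<le> ?q * wm (host (Suc s) \<alpha>')" using c_const_ge_1(2) wm_pos[of "host (Suc s) \<alpha>'"] by (intro mult_right_mono) auto
    finally have w: "wm \<alpha> \<le> ?q * wm (host (Suc s) \<alpha>')" .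
    show ?one
    proof (intro always_eventually allI impI)
      fix x assume "x \<in> closure (dyadic_cube P)"
      then have "\<alpha>' \<in> near \<delta> (scale (Suc s)) x" using tn1 t by blast
      then show "ennreal (wm \<alpha>) * ennreal \<bar>cell_value (Suc s) \<alpha>' - \<phi> x\<bar> \<le> ennreal ?q * density (Suc s) x"
        by (intro comparability_transfer[OF w q0] density_Suc_ge)
    qed
  }
  assume t: "\<alpha>' \<in> touching \<delta> (scale s) P"
  show ?two
  proof (cases s)
    case (Suc s')
    have n0: "\<alpha>' \<in> near \<delta> (scale s) (dyadic_centre P)" using tn2[OF centre_in_closure] t by blast
    then have cell: "\<alpha>' \<in> cells \<delta> (scale s)" using near_subset_cells by blast
    have w: "wm \<alpha> \<le> ?q * wm (host s \<alpha>')"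
      using level_comparable[OF \<alpha>(1) c\<alpha> host(2)[OF cell] near_in_host[OF n0]] .
    show ?thesis
    proof (intro always_eventually allI impI)
      fix x assume "x \<in> closure (dyadic_cube P)"
      then have "\<alpha>' \<in> near \<delta> (scale s) x" using tn2 t by blast
      then show "ennreal (wm \<alpha>) * ennreal \<bar>cell_value s \<alpha>' - \<phi> x\<bar> \<le> ennreal ?q * density s x"
        using w density_Suc_ge[of \<alpha>' s' x] unfolding Suc by (intro comparability_transfer[OF _ q0]) auto
    qed
  next
    case 0
    show ?thesis using AE_in_unit_cube
    proof eventually_elim
      case (elim x)
      then obtain m where m: "x \<in> dyadic_cube (0, m)" by blast
      show ?case
      proof
        assume x: "x \<in> closure (dyadic_cube P)"
        have "x \<in> enlarged lam \<alpha>" unfolding mem_enlarged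
        proof
          fix i
          have "dyadic_side P \<le> \<delta> * scale (Suc s) (dyadic_centre P)" using P by (simp add: cells_def)
          also have "\<dots> \<le> \<delta> * dyadic_side \<alpha>" using scale_le_tile[OF \<alpha>] \<delta>_pos by (intro mult_left_mono) auto
          also have "\<dots> < lam * dyadic_side \<alpha>"
          proof (intro mult_strict_right_mono)
            have "(2::real) ^ k0 < 2 ^ (2 * k0 + 2 * CARD('n) + 8)" by (intro power_strict_increasing) auto
            then show "\<delta> < lam" unfolding \<delta>_def lam by (intro divide_strict_left_mono) auto
          qed simp
          finally have "dyadic_side P < lam * dyadic_side \<alpha>" .
          moreover have "\<bar>x $ i - dyadic_centre P $ i\<bar> \<le> dyadic_side P / 2" using x by (simp add: mem_closure_dyadic_cube)
          moreover have "\<bar>dyadic_centre P $ i - dyadic_centre \<alpha> $ i\<bar> \<le> dyadic_side \<alpha> / 2" using \<alpha>(2) by (simp add: mem_closure_dyadic_cube)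
          moreover have "dyadic_side \<alpha> / 2 + lam * dyadic_side \<alpha> / 2 = (1 + lam) * dyadic_side \<alpha> / 2" by (simp add: field_simps)
          ultimately show "\<bar>x $ i - dyadic_centre \<alpha> $ i\<bar> < (1 + lam) * dyadic_side \<alpha> / 2" by linarith
        qed
        moreover have "x \<in> enlarged lam (0, m)" using m cube_subset_closure closure_in_enlarged by blast
        moreover have "(0, m) \<in> A s" using 0 level_0 by simp
        ultimately have "wm \<alpha> \<le> ?q * wm (0, m)" using level_comparable[OF \<alpha>(1)] by blast
        then show "ennreal (wm \<alpha>) * ennreal \<bar>cell_value s \<alpha>' - \<phi> x\<bar> \<le> ennreal ?q * density s x"
          using density_0_ge[OF m] 0 by (intro comparability_transfer[OF _ q0]) (auto simp: cell_value_def)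
      qed
    qed
  qed
qed

lemma closure_cube_lmeasurable: "closure (dyadic_cube P) \<in> lmeasurable" for P :: "'n dyadic"
  by (simp add: closure_dyadic_cube)

definition osc_const :: real where "osc_const = real (overlap TYPE('n)) * (c1 ^ 2 * c2)"

lemma osc_le:
  assumes P: "P \<in> cells \<delta> (scale (Suc s))" and \<alpha>: "\<alpha> \<in> A (Suc s)" "dyadic_centre P \<in> closure (dyadic_cube \<alpha>)"
  shows "ennreal (wm \<alpha> * dyadic_side P ^ CARD('n) * osc s P)
    \<le> ennreal osc_const * (\<integral>\<^sup>+x\<in>closure (dyadic_cube P). (density (Suc s) x + density s x) \<partial>lebesgue)"
proof -
  define D where "D = closure (dyadic_cube P)"
  define q where "q = c1 ^ 2 * c2"
  let ?N = "real (overlap TYPE('n))"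
  let ?r = "dyadic_side P ^ CARD('n)"
  have q0: "0 \<le> q" using c_const_ge_1 by (simp add: q_def)
  have Dm: "D \<in> lmeasurable" unfolding D_def by (rule closure_cube_lmeasurable)
  have Ds[measurable]: "D \<in> sets lebesgue" using Dm by (simp add: fmeasurable_def)
  have D\<phi>: "set_integrable lebesgue D \<phi>"
    unfolding D_def by (intro locally_integrable_UNIV_bounded[OF \<phi>]) (auto simp: closure_dyadic_cube)
  have md: "measure lebesgue D = ?r" by (simp add: D_def measure_closure_cube)
  have one: "ennreal (wm \<alpha> * ?r * \<bar>c - cell_mean P\<bar>) \<le> ennreal q * (\<integral>\<^sup>+x\<in>D. Y x \<partial>lebesgue)"
    if AE: "AE x in lebesgue. x \<in> D \<longrightarrow> ennreal (wm \<alpha>) * ennreal \<bar>c - \<phi> x\<bar> \<le> ennreal q * Y x"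
      and [measurable]: "Y \<in> borel_measurable lebesgue" for c Y
  proof -
    have "ennreal (wm \<alpha> * ?r * \<bar>c - cell_mean P\<bar>) = ennreal (wm \<alpha>) * ennreal (measure lebesgue D * \<bar>c - mean D \<phi>\<bar>)"
      using wm_pos[of \<alpha>] unfolding md by (simp add: ennreal_mult[symmetric] cell_mean_def D_def mult.assoc)
    also have "\<dots> \<le> ennreal (wm \<alpha>) * (\<integral>\<^sup>+x\<in>D. ennreal \<bar>c - \<phi> x\<bar> \<partial>lebesgue)"
      using abs_diff_mean_le[OF D\<phi> Dm, of c] by (intro mult_left_mono) (auto simp: D_def measure_closure_cube)
    also have "\<dots> = (\<integral>\<^sup>+x. ennreal (wm \<alpha>) * (ennreal \<bar>c - \<phi> x\<bar> * indicator D x) \<partial>lebesgue)"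
      by (rule nn_integral_cmult[symmetric]) (rule density_summand_measurable(2)[OF Ds])
    also have "\<dots> \<le> (\<integral>\<^sup>+x. ennreal q * (Y x * indicator D x) \<partial>lebesgue)"
      by (rule nn_integral_mono_AE, use AE in eventually_elim) (auto simp: indicator_def)
    also have "\<dots> = ennreal q * (\<integral>\<^sup>+x\<in>D. Y x \<partial>lebesgue)" by (rule nn_integral_cmult) measurable
    finally show ?thesis .
  qed
  have sum: "ennreal (wm \<alpha> * ?r * (\<Sum>\<alpha>'\<in>T. \<bar>c \<alpha>' - cell_mean P\<bar>)) \<le> ennreal osc_const * (\<integral>\<^sup>+x\<in>D. Y x \<partial>lebesgue)"
    if AE: "\<And>\<alpha>'. \<alpha>' \<in> T \<Longrightarrow> AE x in lebesgue. x \<in> D \<longrightarrow> ennreal (wm \<alpha>) * ennreal \<bar>c \<alpha>' - \<phi> x\<bar> \<le> ennreal q * Y x"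
      and Y: "Y \<in> borel_measurable lebesgue" and T: "finite T" "card T \<le> overlap TYPE('n)" for T c Y
  proof -
    have "ennreal (wm \<alpha> * ?r * (\<Sum>\<alpha>'\<in>T. \<bar>c \<alpha>' - cell_mean P\<bar>)) = (\<Sum>\<alpha>'\<in>T. ennreal (wm \<alpha> * ?r * \<bar>c \<alpha>' - cell_mean P\<bar>))"
      unfolding sum_distrib_left using wm_pos[of \<alpha>] by (intro sum_ennreal[symmetric]) (simp add: less_imp_le)
    also have "\<dots> \<le> (\<Sum>\<alpha>'\<in>T. ennreal q * (\<integral>\<^sup>+x\<in>D. Y x \<partial>lebesgue))"
      by (intro sum_mono one AE Y)
    also have "\<dots> = ennreal (real (card T)) * (ennreal q * (\<integral>\<^sup>+x\<in>D. Y x \<partial>lebesgue))"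
      by (simp add: ennreal_of_nat_eq_real_of_nat)
    also have "\<dots> \<le> ennreal ?N * (ennreal q * (\<integral>\<^sup>+x\<in>D. Y x \<partial>lebesgue))"
      using T(2) by (intro mult_right_mono ennreal_leI) auto
    also have "\<dots> = ennreal osc_const * (\<integral>\<^sup>+x\<in>D. Y x \<partial>lebesgue)"
      using q0 by (simp add: osc_const_def q_def[symmetric] ennreal_mult mult.assoc)
    finally show ?thesis .
  qed
  note f1 = touching_finite_card[OF slow_scale slow_scale order_refl P]
  note f2 = touching_finite_card[OF slow_scale slow_scale scale_antimono P]
  have "ennreal (wm \<alpha> * ?r * osc s P) = ennreal (wm \<alpha> * ?r * (\<Sum>\<alpha>\<in>touching \<delta> (scale (Suc s)) P. \<bar>cell_value (Suc s) \<alpha> - cell_mean P\<bar>))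
      + ennreal (wm \<alpha> * ?r * (\<Sum>\<alpha>\<in>touching \<delta> (scale s) P. \<bar>cell_value s \<alpha> - cell_mean P\<bar>))"
    unfolding osc_def distrib_left using wm_pos[of \<alpha>]
    by (intro ennreal_plus mult_nonneg_nonneg sum_nonneg) (auto simp: less_imp_le)
  also have "\<dots> \<le> ennreal osc_const * (\<integral>\<^sup>+x\<in>D. density (Suc s) x \<partial>lebesgue) + ennreal osc_const * (\<integral>\<^sup>+x\<in>D. density s x \<partial>lebesgue)"
    using level_value_AE[OF P \<alpha>] f1 f2 unfolding D_def q_def by (intro add_mono sum[unfolded D_def q_def] density_measurable) auto
  also have "\<dots> = ennreal osc_const * (\<integral>\<^sup>+x\<in>D. (density (Suc s) x + density s x) \<partial>lebesgue)"
    unfolding distrib_left[symmetric] distrib_right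
    by (subst nn_integral_add) auto
  finally show ?thesis by (simp add: D_def)
qed

section \<open>The extension and its norm\<close>

definition piece :: "nat \<Rightarrow> (real^'n) \<times> real \<Rightarrow> real" where
  "piece s = layer \<delta> (scale (Suc s)) (scale s) (cell_value (Suc s)) (cell_value s)"

definition box_over :: "'n dyadic \<Rightarrow> ((real^'n) \<times> real) set" where
  "box_over P = closure (dyadic_cube P) \<times> {0<..<14 * dyadic_side P}"

definition slope :: "nat \<Rightarrow> 'n dyadic \<Rightarrow> real" where
  "slope s P = layer_const TYPE('n) / dyadic_side P * osc s P"

text \<open>A bound for both the term number \<open>s\<close> and its derivatives which is constant on each box over a cell, so that its weighted
  integral only involves the weight of these boxes. That cells overlap only increases it.\<close>

definition majorant :: "nat \<Rightarrow> (real^'n) \<times> real \<Rightarrow> ennreal" where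
  "majorant s z = (\<integral>\<^sup>+P. ennreal (slope s P) * indicator (box_over P) z \<partial>count_space (cells \<delta> (scale (Suc s))))"

lemma slope_nonneg: "0 \<le> slope s P"
  unfolding slope_def using layer_const_nonneg[of "TYPE('n)"] osc_nonneg by simp

lemma box_over_sets [measurable]: "box_over P \<in> sets lebesgue"
proof -
  have "box_over P \<in> sets borel" unfolding box_over_def by (intro borel_Times) auto
  then show ?thesis by simp
qed

lemma C1_on_piece: "C1_on UNIV (piece s)"
  unfolding piece_def by (rule C1_on_layer[OF slow_scale slow_scale])

lemma piece_bounds:
  assumes "0 < t"
  shows "ennreal \<bar>piece s (x, t)\<bar> \<le> majorant s (x, t)"
    "norm w \<le> 1 \<Longrightarrow> ennreal \<bar>frechet_derivative (piece s) (at (x, t)) w\<bar> \<le> majorant s (x, t)"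
    "1 / 2 ^ s \<le> t \<Longrightarrow> piece s (x, t) = 0"
proof -
  obtain P where P: "P \<in> cells \<delta> (scale (Suc s))" "x \<in> closure (dyadic_cube P)"
    using cells_cover[OF slow_scale] by blast
  let ?I = "if t < 14 * dyadic_side P then 1 else (0::real)"
  note b = layer_bounds[OF slow_scale slow_scale scale_antimono P assms,
      where a = "cell_mean P" and c = "cell_value (Suc s)" and c' = "cell_value s", folded piece_def osc_def slope_def]
  have "ennreal (slope s P) * indicator (box_over P) (x, t) \<le> majorant s (x, t)"
    unfolding majorant_def by (rule nn_integral_ge_point[OF P(1)])
  moreover have "ennreal (slope s P * ?I) = ennreal (slope s P) * indicator (box_over P) (x, t)"
    using P(2) assms by (simp add: box_over_def)
  ultimately have m: "ennreal (slope s P * ?I) \<le> majorant s (x, t)" by simp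
  show "ennreal \<bar>piece s (x, t)\<bar> \<le> majorant s (x, t)"
    using ennreal_leI[OF b(1)] m by (rule order_trans)
  show "ennreal \<bar>frechet_derivative (piece s) (at (x, t)) w\<bar> \<le> majorant s (x, t)" if "norm w \<le> 1"
  proof -
    have "slope s P * ?I * norm w \<le> slope s P * ?I" using that slope_nonneg[of s P] by (intro mult_left_le) auto
    then have "\<bar>frechet_derivative (piece s) (at (x, t)) w\<bar> \<le> slope s P * ?I" using b(2)[of w] by linarith
    from ennreal_leI[OF this] m show ?thesis by (rule order_trans)
  qed
  assume t: "1 / 2 ^ s \<le> t"
  have "14 * dyadic_side P \<le> 1 / 2 ^ s"
  proof -
    have "dyadic_side P \<le> \<delta> * scale (Suc s) (dyadic_centre P)" using P by (simp add: cells_def)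
    also have "\<dots> \<le> 1 / 256 * (1 / 2 ^ Suc s)"
      by (rule mult_mono[OF \<delta>_le scale_upper]) (auto intro: less_imp_le scale_pos)
    finally have "dyadic_side P \<le> 1 / 256 * (1 / 2 ^ Suc s)" .
    moreover have "14 * (1 / 256 * (1 / 2 ^ Suc s)) \<le> (1::real) / 2 ^ s" by (simp add: field_simps)
    ultimately show ?thesis by linarith
  qed
  then have "?I = 0" using t by simp
  then show "piece s (x, t) = 0" using b(1) by simp
qed

definition level_const :: real where
  "level_const = layer_const TYPE('n) * weight_const * osc_const * real (overlap TYPE('n))"

lemma consts_nonneg: "0 \<le> weight_const" "0 \<le> osc_const" "0 \<le> level_const"
  using layer_const_nonneg[of "TYPE('n)"] C c1 c2 \<delta>_pos unfolding level_const_def weight_const_def osc_const_def by simp_all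

text \<open>Closed cells overlap boundedly.\<close>

lemma cells_containing_le:
  "(\<integral>\<^sup>+P. indicator (closure (dyadic_cube P)) x \<partial>count_space (cells \<delta> (scale s))) \<le> ennreal (real (overlap TYPE('n)))"
proof -
  let ?F = "{P \<in> cells \<delta> (scale s). x \<in> closure (dyadic_cube P)}"
  have sub: "?F \<subseteq> near \<delta> (scale s) x" using cell_near by blast
  have fin: "finite ?F" using finite_subset[OF sub near_finite_card(1)[OF slow_scale]] .
  have "(\<integral>\<^sup>+P. indicator (closure (dyadic_cube P)) x \<partial>count_space (cells \<delta> (scale s))) = (\<Sum>P\<in>?F. indicator (closure (dyadic_cube P)) x)"
    using fin by (intro nn_integral_count_space') auto
  also have "\<dots> = of_nat (card ?F)" by simp
  also have "\<dots> \<le> ennreal (real (overlap TYPE('n)))"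
    using card_mono[OF near_finite_card(1)[OF slow_scale] sub] near_finite_card(2)[OF slow_scale, of s x]
    by (simp add: ennreal_of_nat_eq_real_of_nat)
  finally show ?thesis .
qed

lemma majorant_measurable [measurable]: "majorant s \<in> borel_measurable lebesgue"
  unfolding majorant_def[abs_def] by (intro borel_measurable_count_space_integral) auto

text \<open>The powers of the side cancel: the slope carries \<open>1 / side P\<close>, the weight of the box \<open>side P ^ (n + 1)\<close>, and \<open>osc_le\<close> consumes
  the remaining \<open>side P ^ n\<close>.\<close>

lemma integral_majorant_le:
  "(\<integral>\<^sup>+z. ennreal (\<gamma> z) * majorant s z \<partial>lebesgue)
    \<le> ennreal level_const * (\<integral>\<^sup>+x. density (Suc s) x + density s x \<partial>lebesgue)"
proof -
  let ?I = "cells \<delta> (scale (Suc s))"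
  let ?Y = "\<lambda>x. density (Suc s) x + density s x"
  let ?k = "layer_const TYPE('n) * weight_const"
  have ci: "countable ?I" by simp
  have "(\<integral>\<^sup>+z. ennreal (\<gamma> z) * majorant s z \<partial>lebesgue)
      = (\<integral>\<^sup>+z. (\<integral>\<^sup>+P. ennreal (slope s P) * (ennreal (\<gamma> z) * indicator (box_over P) z) \<partial>count_space ?I) \<partial>lebesgue)"
    unfolding majorant_def by (subst nn_integral_cmult[symmetric]) (auto intro!: nn_integral_cong simp: mult_ac)
  also have "\<dots> = (\<integral>\<^sup>+P. (\<integral>\<^sup>+z. ennreal (slope s P) * (ennreal (\<gamma> z) * indicator (box_over P) z) \<partial>lebesgue) \<partial>count_space ?I)"
    by (rule nn_integral_count_space_nn_integral[OF ci]) measurable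
  also have "\<dots> \<le> (\<integral>\<^sup>+P. ennreal (?k * osc_const) * (\<integral>\<^sup>+x\<in>closure (dyadic_cube P). ?Y x \<partial>lebesgue) \<partial>count_space ?I)"
  proof (rule nn_integral_mono)
    fix P assume "P \<in> space (count_space ?I)"
    then have P: "P \<in> ?I" by simp
    obtain \<alpha> where \<alpha>: "\<alpha> \<in> A (Suc s)" "dyadic_centre P \<in> closure (dyadic_cube \<alpha>)" using tile_cover by blast
    have "(\<integral>\<^sup>+z. ennreal (slope s P) * (ennreal (\<gamma> z) * indicator (box_over P) z) \<partial>lebesgue)
        = ennreal (slope s P) * (\<integral>\<^sup>+z\<in>box_over P. ennreal (\<gamma> z) \<partial>lebesgue)"
      by (rule nn_integral_cmult) measurable
    also have "\<dots> \<le> ennreal (slope s P) * ennreal (weight_const * wm \<alpha> * dyadic_side P ^ (CARD('n) + 1))"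
      unfolding box_over_def by (intro mult_left_mono weight_above_cell[OF P \<alpha>]) simp
    also have "\<dots> = ennreal (?k * (wm \<alpha> * dyadic_side P ^ CARD('n) * osc s P))"
      using slope_nonneg[of s P] consts_nonneg(1) wm_pos[of \<alpha>]
      by (subst ennreal_mult[symmetric]) (auto simp: slope_def less_imp_le field_simps)
    also have "\<dots> = ennreal ?k * ennreal (wm \<alpha> * dyadic_side P ^ CARD('n) * osc s P)"
      using layer_const_nonneg[of "TYPE('n)"] consts_nonneg(1) wm_pos[of \<alpha>] osc_nonneg[of s P]
      by (intro ennreal_mult) (auto simp: less_imp_le)
    also have "\<dots> \<le> ennreal ?k * (ennreal osc_const * (\<integral>\<^sup>+x\<in>closure (dyadic_cube P). ?Y x \<partial>lebesgue))"
      by (intro mult_left_mono osc_le[OF P \<alpha>]) simp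
    also have "\<dots> = ennreal (?k * osc_const) * (\<integral>\<^sup>+x\<in>closure (dyadic_cube P). ?Y x \<partial>lebesgue)"
      using layer_const_nonneg[of "TYPE('n)"] consts_nonneg by (simp add: ennreal_mult mult.assoc)
    finally show "(\<integral>\<^sup>+z. ennreal (slope s P) * (ennreal (\<gamma> z) * indicator (box_over P) z) \<partial>lebesgue)
      \<le> ennreal (?k * osc_const) * (\<integral>\<^sup>+x\<in>closure (dyadic_cube P). ?Y x \<partial>lebesgue)" .
  qed
  also have "\<dots> = ennreal (?k * osc_const) * (\<integral>\<^sup>+P. (\<integral>\<^sup>+x. ?Y x * indicator (closure (dyadic_cube P)) x \<partial>lebesgue) \<partial>count_space ?I)"
    by (rule nn_integral_cmult) simp
  also have "(\<integral>\<^sup>+P. (\<integral>\<^sup>+x. ?Y x * indicator (closure (dyadic_cube P)) x \<partial>lebesgue) \<partial>count_space ?I)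
      = (\<integral>\<^sup>+x. (\<integral>\<^sup>+P. ?Y x * indicator (closure (dyadic_cube P)) x \<partial>count_space ?I) \<partial>lebesgue)"
  proof (rule nn_integral_count_space_nn_integral[OF ci, symmetric])
    fix P :: "'n dyadic"
    have [measurable]: "closure (dyadic_cube P) \<in> sets lebesgue" by simp
    show "(\<lambda>x. ?Y x * indicator (closure (dyadic_cube P)) x) \<in> borel_measurable lebesgue" by measurable
  qed
  also have "\<dots> \<le> (\<integral>\<^sup>+x. ?Y x * ennreal (real (overlap TYPE('n))) \<partial>lebesgue)"
    by (intro nn_integral_mono) (subst nn_integral_cmult, simp, intro mult_left_mono cells_containing_le, simp)
  also have "\<dots> = ennreal (real (overlap TYPE('n))) * (\<integral>\<^sup>+x. ?Y x \<partial>lebesgue)"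
    by (subst nn_integral_multc) (auto simp: mult.commute)
  finally have "(\<integral>\<^sup>+z. ennreal (\<gamma> z) * majorant s z \<partial>lebesgue)
    \<le> ennreal (?k * osc_const) * (ennreal (real (overlap TYPE('n))) * (\<integral>\<^sup>+x. ?Y x \<partial>lebesgue))"
    by (meson mult_left_mono order_trans zero_le)
  also have "\<dots> = ennreal level_const * (\<integral>\<^sup>+x. ?Y x \<partial>lebesgue)"
    using layer_const_nonneg[of "TYPE('n)"] consts_nonneg by (simp add: level_const_def ennreal_mult mult.assoc)
  finally show ?thesis .
qed

text \<open>Each level is used by two consecutive terms of the extension, which gives the factor 2.\<close>

lemma suminf_majorant_le:
  "(\<integral>\<^sup>+z. ennreal (\<gamma> z) * (\<Sum>s. majorant s z) \<partial>lebesgue) \<le> ennreal (2 * level_const) * trace_energy lam \<gamma> A e \<phi>"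
proof -
  let ?E = "\<lambda>s. \<integral>\<^sup>+x. density s x \<partial>lebesgue" and ?T = "trace_energy lam \<gamma> A e \<phi>"
  have "(\<integral>\<^sup>+z. ennreal (\<gamma> z) * (\<Sum>s. majorant s z) \<partial>lebesgue) = (\<integral>\<^sup>+z. (\<Sum>s. ennreal (\<gamma> z) * majorant s z) \<partial>lebesgue)"
    by simp
  also have "\<dots> = (\<Sum>s. \<integral>\<^sup>+z. ennreal (\<gamma> z) * majorant s z \<partial>lebesgue)"
    by (rule nn_integral_suminf) measurable
  also have "\<dots> \<le> ennreal (2 * level_const) * ?T"
  proof (rule ennreal_suminf_le)
    fix k
    have "(\<Sum>s<k. \<integral>\<^sup>+z. ennreal (\<gamma> z) * majorant s z \<partial>lebesgue) \<le> (\<Sum>s<k. ennreal level_const * (?E (Suc s) + ?E s))"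
    proof (rule sum_mono)
      fix s
      show "(\<integral>\<^sup>+z. ennreal (\<gamma> z) * majorant s z \<partial>lebesgue) \<le> ennreal level_const * (?E (Suc s) + ?E s)"
        using integral_majorant_le[of s] nn_integral_add[of "density (Suc s)" lebesgue "density s"] by simp
    qed
    also have "\<dots> = ennreal level_const * ((\<Sum>s<k. ?E (Suc s)) + (\<Sum>s<k. ?E s))"
      by (simp add: sum_distrib_left[symmetric] sum.distrib)
    also have "\<dots> \<le> ennreal level_const * (?T + ?T)"
    proof (intro mult_left_mono add_mono)
      have le: "(\<Sum>s<k. ?E s) \<le> ?T" for k
        by (rule order_trans[OF sum_le_suminf suminf_density_le]) auto
      then show "(\<Sum>s<k. ?E s) \<le> ?T" .
      have "(\<Sum>s<k. ?E (Suc s)) \<le> (\<Sum>s<Suc k. ?E s)" unfolding sum.lessThan_Suc_shift by simp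
      then show "(\<Sum>s<k. ?E (Suc s)) \<le> ?T" using le[of "Suc k"] by (rule order_trans)
    qed simp
    also have "\<dots> = ennreal (2 * level_const) * ?T"
      using consts_nonneg(3) by (simp add: ennreal_mult mult_2[symmetric] mult_ac)
    finally show "(\<Sum>s<k. \<integral>\<^sup>+z. ennreal (\<gamma> z) * majorant s z \<partial>lebesgue) \<le> ennreal (2 * level_const) * ?T" .
  qed
  finally show ?thesis .
qed

definition extension :: "(real^'n) \<times> real \<Rightarrow> real" where
  "extension z = (\<Sum>s. piece s z)"

text \<open>At height \<open>t\<close> only the terms with \<open>2\<^sup>-\<^sup>s > t\<close> contribute, since twice the height at which the term number \<open>s\<close> sets in is below \<open>2\<^sup>-\<^sup>s\<close>.\<close>

lemma extension_eq_sum: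
  assumes "0 < snd z" "1 / 2 ^ k \<le> snd z" shows "extension z = (\<Sum>s<k. piece s z)"
  unfolding extension_def
proof (rule suminf_finite)
  fix s assume "s \<notin> {..<k}"
  then have "(2::real) ^ k \<le> 2 ^ s" by (intro power_increasing) auto
  then have "1 / 2 ^ s \<le> (1::real) / 2 ^ k" by (intro divide_left_mono) auto
  then have "1 / 2 ^ s \<le> snd z" using assms(2) by linarith
  then show "piece s z = 0" using piece_bounds(3)[OF assms(1), of s "fst z"] by simp
qed simp

lemma ex_dyadic_below: "0 < t \<Longrightarrow> \<exists>k. 1 / 2 ^ k < (t::real)"
  using real_arch_pow_inv[of t "1/2"] by (auto simp: power_one_over)

lemma extension_locally:
  assumes "0 < snd z"
  shows "\<exists>U k. open U \<and> z \<in> U \<and> (\<forall>y\<in>U. extension y = (\<Sum>s<k. piece s y))"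
proof -
  obtain k where k: "1 / 2 ^ k < snd z" using ex_dyadic_below[OF assms] by blast
  have "open ((UNIV :: (real^'n) set) \<times> {(1::real) / 2 ^ k<..})" by (intro open_Times) auto
  moreover have "z \<in> UNIV \<times> {(1::real) / 2 ^ k<..}" using k by (cases z) auto
  moreover have "extension y = (\<Sum>s<k. piece s y)" if "y \<in> UNIV \<times> {(1::real) / 2 ^ k<..}" for y
  proof (rule extension_eq_sum)
    have "1 / 2 ^ k < snd y" using that by auto
    moreover have "(0::real) < 1 / 2 ^ k" by simp
    ultimately show "0 < snd y" "1 / 2 ^ k \<le> snd y" by linarith+
  qed
  ultimately show ?thesis by blast
qed

lemma open_upper_half: "open (upper_half :: ((real^'n) \<times> real) set)"
  unfolding upper_half_def by (intro open_Times) auto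

lemma C1_on_extension: "C1_on upper_half extension"
proof (rule C1_on_local)
  fix z :: "(real^'n) \<times> real" assume "z \<in> upper_half"
  then have "0 < snd z" by (auto simp: upper_half_def)
  from extension_locally[OF this] obtain U k where U: "open U" "z \<in> U" "\<And>y. y \<in> U \<Longrightarrow> extension y = (\<Sum>s<k. piece s y)" by blast
  show "\<exists>U g. open U \<and> z \<in> U \<and> C1_on U g \<and> (\<forall>y\<in>U. extension y = g y)"
    using U by (intro exI[of _ U] exI[of _ "\<lambda>y. \<Sum>s<k. piece s y"])
      (auto intro!: C1_on_sum C1_on_subset[OF C1_on_piece])
qed

lemma extension_bounds:
  assumes z: "z \<in> upper_half"
  shows "ennreal \<bar>extension z\<bar> \<le> (\<Sum>s. majorant s z)"
    "norm w \<le> 1 \<Longrightarrow> ennreal \<bar>frechet_derivative extension (at z) w\<bar> \<le> (\<Sum>s. majorant s z)"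
proof -
  obtain x t where zt: "z = (x, t)" "0 < t" using z by (auto simp: upper_half_def)
  obtain U k where U: "open U" "z \<in> U" "\<And>y. y \<in> U \<Longrightarrow> extension y = (\<Sum>s<k. piece s y)"
    using extension_locally[of z] zt by auto
  have le: "ennreal \<bar>\<Sum>s<k. a s\<bar> \<le> (\<Sum>s. majorant s z)" if "\<And>s. ennreal \<bar>a s\<bar> \<le> majorant s z" for a
  proof -
    have "ennreal \<bar>\<Sum>s<k. a s\<bar> \<le> ennreal (\<Sum>s<k. \<bar>a s\<bar>)" by (intro ennreal_leI sum_abs)
    also have "\<dots> = (\<Sum>s<k. ennreal \<bar>a s\<bar>)" by (rule sum_ennreal[symmetric]) simp
    also have "\<dots> \<le> (\<Sum>s<k. majorant s z)" by (intro sum_mono that)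
    also have "\<dots> \<le> (\<Sum>s. majorant s z)" by (rule sum_le_suminf) auto
    finally show ?thesis .
  qed
  show "ennreal \<bar>extension z\<bar> \<le> (\<Sum>s. majorant s z)"
    using le[of "\<lambda>s. piece s z"] piece_bounds(1)[OF zt(2)] U(3)[OF U(2)] zt(1) by simp
  assume w: "norm w \<le> 1"
  have "(extension has_derivative (\<lambda>v. \<Sum>s<k. frechet_derivative (piece s) (at z) v)) (at z)"
    by (rule has_derivative_transform_within_open[OF _ U(1,2)])
       (use U(3) in \<open>auto intro!: has_derivative_sum C1_on_frechet(1)[OF C1_on_piece]\<close>)
  from frechet_derivative_at[OF this, symmetric]
  have "frechet_derivative extension (at z) w = (\<Sum>s<k. frechet_derivative (piece s) (at z) w)" by simp
  then show "ennreal \<bar>frechet_derivative extension (at z) w\<bar> \<le> (\<Sum>s. majorant s z)"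
    unfolding zt(1) using le[unfolded zt(1)] piece_bounds(2)[OF zt(2) w] by simp
qed

lemma weighted_integral_le:
  assumes "\<And>z. z \<in> upper_half \<Longrightarrow> ennreal \<bar>F z\<bar> \<le> (\<Sum>s. majorant s z)"
  shows "(\<integral>\<^sup>+z\<in>upper_half. ennreal \<bar>\<gamma> z * F z\<bar> \<partial>lebesgue) \<le> ennreal (2 * level_const) * trace_energy lam \<gamma> A e \<phi>"
proof -
  have pos: "AE z in lebesgue. 0 < \<gamma> z" using weight by (simp add: weight_def)
  have "(\<integral>\<^sup>+z\<in>upper_half. ennreal \<bar>\<gamma> z * F z\<bar> \<partial>lebesgue) \<le> (\<integral>\<^sup>+z. ennreal (\<gamma> z) * (\<Sum>s. majorant s z) \<partial>lebesgue)"
  proof (rule nn_integral_mono_AE, use pos in eventually_elim)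
    fix z assume p: "0 < \<gamma> z"
    show "ennreal \<bar>\<gamma> z * F z\<bar> * indicator upper_half z \<le> ennreal (\<gamma> z) * (\<Sum>s. majorant s z)"
    proof (cases "z \<in> upper_half")
      case True
      have "ennreal \<bar>\<gamma> z * F z\<bar> = ennreal (\<gamma> z) * ennreal \<bar>F z\<bar>" using p by (simp add: abs_mult ennreal_mult)
      also have "\<dots> \<le> ennreal (\<gamma> z) * (\<Sum>s. majorant s z)" by (intro mult_left_mono assms True) simp
      finally show ?thesis using True by simp
    qed simp
  qed
  then show ?thesis using suminf_majorant_le by (rule order_trans)
qed

lemma W11_norm_extension:
  "W11_norm upper_half \<gamma> extension \<le> ennreal ((real CARD('n) + 2) * (2 * level_const)) * trace_energy lam \<gamma> A e \<phi>"
proof -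
  let ?K = "ennreal (2 * level_const) * trace_energy lam \<gamma> A e \<phi>"
  have "W11_norm upper_half \<gamma> extension \<le> ?K + (\<Sum>b\<in>(Basis :: ((real^'n) \<times> real) set). ?K)"
    unfolding W11_norm_C1[OF open_upper_half C1_on_extension]
    by (intro add_mono sum_mono weighted_integral_le extension_bounds) auto
  also have "\<dots> = (ennreal 1 + ennreal (real (CARD('n) + 1))) * ?K"
    by (simp add: distrib_right ennreal_of_nat_eq_real_of_nat del: ennreal_1) (simp add: ennreal_of_nat_eq_real_of_nat)
  also have "ennreal 1 + ennreal (real (CARD('n) + 1)) = ennreal (real CARD('n) + 2)"
    by (subst ennreal_plus[symmetric]) (auto simp: add_ac)
  also have "ennreal (real CARD('n) + 2) * ?K = ennreal ((real CARD('n) + 2) * (2 * level_const)) * trace_energy lam \<gamma> A e \<phi>"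
    using consts_nonneg(3) by (subst ennreal_mult) (auto simp: mult.assoc)
  finally show ?thesis .
qed

lemma extension_in_W11:
  assumes "trace_energy lam \<gamma> A e \<phi> < \<infinity>" shows "extension \<in> W11 upper_half \<gamma>"
  unfolding W11_def
proof (intro CollectI conjI ballI)
  show "locally_integrable upper_half extension"
    by (rule continuous_locally_integrable[OF C1_on_continuous[OF C1_on_extension]])
  show "\<exists>g. has_weak_deriv upper_half b extension g" for b
    using C1_has_weak_deriv[OF open_upper_half C1_on_extension] by blast
  show "W11_norm upper_half \<gamma> extension < \<infinity>"
    using W11_norm_extension assms by (simp add: ennreal_mult_less_top le_less_trans)
qed

section \<open>The trace of the extension\<close>

lemma unit_ancestor: "\<alpha> \<in> A s \<Longrightarrow> \<exists>m. closure (dyadic_cube \<alpha>) \<subseteq> closure (dyadic_cube (0, m))"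
proof (induction s arbitrary: \<alpha>)
  case 0
  then have "\<alpha> = (0, snd \<alpha>)" using level_0[of \<alpha>] by (simp add: prod_eq_iff)
  then have "closure (dyadic_cube \<alpha>) \<subseteq> closure (dyadic_cube (0, snd \<alpha>))" by simp
  then show ?case by blast
next
  case (Suc s)
  obtain \<beta> where "\<beta> \<in> A s" "closure (dyadic_cube \<alpha>) \<subseteq> closure (dyadic_cube \<beta>)" using parent[OF Suc.prems] by blast
  moreover from Suc.IH[OF this(1)] obtain m where "closure (dyadic_cube \<beta>) \<subseteq> closure (dyadic_cube (0, m))" by blast
  ultimately show ?case by blast
qed

text \<open>Each tile lies in a unit cube, only finitely many unit cubes are near a bounded set, and by the A1 condition a tile has
  a weight mean of at least \<open>1 / C\<close> times that of the unit cube around it.\<close>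

lemma weight_mean_lower_bound:
  fixes z :: "real^'n"
  assumes "0 < r"
  shows "\<exists>w>0. \<forall>s x \<beta>. x \<in> ocube z r \<and> \<beta> \<in> A s \<and> x \<in> enlarged lam \<beta> \<longrightarrow> w \<le> wm \<beta>"
proof -
  define M where "M = {m :: int^'n. \<forall>i. \<bar>z $ i - dyadic_centre (0, m) $ i\<bar> \<le> (r / 2 + 1) * dyadic_side (0, m)}"
  have finM: "finite M" unfolding M_def by (rule card_dyadic_near(1))
  define w where "w = Min (insert 1 ((\<lambda>m. wm (0, m)) ` M)) / (C * c1)"
  have Cc: "0 < C * c1" using C c1 by simp
  have "0 < w" unfolding w_def using finM wm_pos Cc by (intro divide_pos_pos) auto
  moreover have "w \<le> wm \<beta>" if x: "x \<in> ocube z r" "\<beta> \<in> A s" "x \<in> enlarged lam \<beta>" for s x \<beta>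
  proof -
    obtain \<alpha> where \<alpha>: "\<alpha> \<in> A s" "x \<in> closure (dyadic_cube \<alpha>)" using tile_cover by blast
    obtain m where m: "closure (dyadic_cube \<alpha>) \<subseteq> closure (dyadic_cube (0, m))" using unit_ancestor[OF \<alpha>(1)] by blast
    have side1: "dyadic_side (0, m) = 1" by (simp add: dyadic_side_def)
    have mM: "m \<in> M" unfolding M_def
    proof (intro CollectI allI)
      fix i
      have "\<bar>x $ i - z $ i\<bar> < r / 2" using x(1) by (simp add: mem_ocube_cart)
      moreover have "x \<in> closure (dyadic_cube (0, m))" using \<alpha>(2) m by blast
      then have "\<bar>x $ i - dyadic_centre (0, m) $ i\<bar> \<le> 1 / 2" by (simp add: mem_closure_dyadic_cube side1)
      moreover have "\<bar>z $ i - dyadic_centre (0, m) $ i\<bar> \<le> \<bar>x $ i - z $ i\<bar> + \<bar>x $ i - dyadic_centre (0, m) $ i\<bar>" by linarith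
      ultimately have "\<bar>z $ i - dyadic_centre (0, m) $ i\<bar> \<le> r / 2 + 1" by linarith
      then show "\<bar>z $ i - dyadic_centre (0, m) $ i\<bar> \<le> (r / 2 + 1) * dyadic_side (0, m)" by (simp add: side1)
    qed
    have "dyadic_cube \<alpha> \<subseteq> dyadic_cube (0, m)" using interior_mono[OF m] by (simp add: interior_closure_dyadic_cube)
    then have sub: "ocube (dyadic_centre \<alpha>, dyadic_side \<alpha> / 2) (dyadic_side \<alpha>) \<subseteq> ocube (dyadic_centre (0, m), 1 / 2) 1"
      using dyadic_side_le_1[of \<alpha>] by (auto simp: ocube_Pair dyadic_cube_ocube side1)
    have "wm (0, m) \<le> C * wm \<alpha>"
      unfolding weight_mean_ocube side1
      by (rule A1_loc_mean_le[OF A1 C _ _ sub]) (auto simp: measure_ocube)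
    also have "\<dots> \<le> C * (c1 * wm \<beta>)"
      using neighbours_comparable[OF \<alpha>(1) x(2) closure_in_enlarged[OF \<alpha>(2)] x(3)] C by (intro mult_left_mono) auto
    finally have "wm (0, m) / (C * c1) \<le> wm \<beta>" using Cc by (simp add: pos_divide_le_eq mult_ac)
    moreover have "Min (insert 1 ((\<lambda>m. wm (0, m)) ` M)) \<le> wm (0, m)" using finM mM by (intro Min_le) auto
    then have "w \<le> wm (0, m) / (C * c1)" unfolding w_def using Cc by (intro divide_right_mono) auto
    ultimately show ?thesis by linarith
  qed
  ultimately show ?thesis by blast
qed

definition level_average :: "nat \<Rightarrow> real^'n \<Rightarrow> real" where
  "level_average s = avg \<delta> (scale s) (cell_value s)"

lemma level_average_0: "level_average 0 x = 0"
  by (simp add: level_average_def avg_def cell_value_def)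

text \<open>On a bounded set, where the weight means are at least \<open>w\<close>, the energy density dominates the approximation error pointwise.\<close>

lemma level_average_error:
  assumes w: "0 < w" "\<And>s x \<beta>. x \<in> Q \<Longrightarrow> \<beta> \<in> A s \<Longrightarrow> x \<in> enlarged lam \<beta> \<Longrightarrow> w \<le> wm \<beta>" and x: "x \<in> Q"
  shows "ennreal (w * \<bar>level_average (Suc s) x - \<phi> x\<bar>) \<le> ennreal (real (overlap TYPE('n))) * density (Suc s) x"
proof -
  let ?T = "active \<delta> (scale (Suc s)) x" and ?c = "cell_value (Suc s)"
  have fT: "finite ?T" by (rule finite_active[OF slow_scale])
  have "w * \<bar>level_average (Suc s) x - \<phi> x\<bar> \<le> w * (\<Sum>\<alpha>\<in>?T. \<bar>?c \<alpha> - \<phi> x\<bar>)"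
    unfolding level_average_def using avg_diff_le[OF slow_scale] w(1) by (intro mult_left_mono) auto
  then have "ennreal (w * \<bar>level_average (Suc s) x - \<phi> x\<bar>) \<le> (\<Sum>\<alpha>\<in>?T. ennreal (w * \<bar>?c \<alpha> - \<phi> x\<bar>))"
    using w(1) by (subst sum_ennreal) (auto simp: sum_distrib_left intro: ennreal_leI)
  also have "\<dots> \<le> (\<Sum>\<alpha>\<in>?T. density (Suc s) x)"
  proof (rule sum_mono)
    fix \<alpha> assume "\<alpha> \<in> ?T"
    then have n: "\<alpha> \<in> near \<delta> (scale (Suc s)) x" using active_subset_near by blast
    then have cell: "\<alpha> \<in> cells \<delta> (scale (Suc s))" using near_subset_cells by blast
    have "w \<le> wm (host (Suc s) \<alpha>)" using w(2)[OF x host(2)[OF cell] near_in_host[OF n]] .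
    then have "ennreal (w * \<bar>?c \<alpha> - \<phi> x\<bar>) \<le> ennreal (wm (host (Suc s) \<alpha>) * \<bar>?c \<alpha> - \<phi> x\<bar>)"
      by (intro ennreal_leI mult_right_mono) auto
    also have "\<dots> = ennreal (wm (host (Suc s) \<alpha>)) * ennreal \<bar>?c \<alpha> - \<phi> x\<bar>"
      using wm_pos[of "host (Suc s) \<alpha>"] by (intro ennreal_mult) auto
    also have "\<dots> \<le> density (Suc s) x" by (rule density_Suc_ge[OF n])
    finally show "ennreal (w * \<bar>?c \<alpha> - \<phi> x\<bar>) \<le> density (Suc s) x" .
  qed
  also have "\<dots> = ennreal (real (card ?T)) * density (Suc s) x" by (simp add: ennreal_of_nat_eq_real_of_nat)
  also have "\<dots> \<le> ennreal (real (overlap TYPE('n))) * density (Suc s) x"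
    using order_trans[OF card_mono[OF near_finite_card(1)[OF slow_scale] active_subset_near] near_finite_card(2)[OF slow_scale]]
    by (intro mult_right_mono ennreal_leI of_nat_mono) auto
  finally show ?thesis .
qed

lemma piece_eq: "piece s (x, t) = cutoff (t / height \<delta> (scale (Suc s)) x) * (level_average (Suc s) x - level_average s x)"
  by (simp add: piece_def layer_def level_average_def)

text \<open>The scale of level \<open>S\<close> is bounded below on the whole space because the tiles of a level have sides bounded below. Under this bound
  all cutoffs up to level \<open>S\<close> are 1, the first \<open>S\<close> terms of the extension telescope to \<open>u\<^sub>S\<close>, and each further term is
  at most \<open>\<bar>u\<^sub>s\<^sub>+\<^sub>1 - \<phi>\<bar> + \<bar>u\<^sub>s - \<phi>\<bar>\<close>.\<close>

lemma extension_minus_trace: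
  "\<exists>\<tau>>0. \<forall>x t. 0 < t \<and> t < \<tau> \<longrightarrow>
     (\<exists>k\<ge>S. \<bar>\<phi> x - extension (x, t)\<bar> \<le> 2 * (\<Sum>s\<in>{S..k}. \<bar>level_average s x - \<phi> x\<bar>))"
proof -
  let ?u = "level_average"
  obtain l where l: "\<And>x. 1 / 2 ^ l \<le> scale S x" using scale_lower[of S] by blast
  define \<tau> where "\<tau> = \<delta> * (1 / 2 ^ l) / 5"
  have "0 < \<tau>" using \<delta>_pos by (simp add: \<tau>_def)
  moreover have "\<exists>k\<ge>S. \<bar>\<phi> x - extension (x, t)\<bar> \<le> 2 * (\<Sum>s\<in>{S..k}. \<bar>?u s x - \<phi> x\<bar>)" if t: "0 < t" "t < \<tau>" for x t
  proof -
    obtain k0 where k0: "1 / 2 ^ k0 < t" using ex_dyadic_below[OF t(1)] by blast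
    define k where "k = max k0 S"
    have "(2::real) ^ k0 \<le> 2 ^ k" unfolding k_def by (intro power_increasing) auto
    then have "1 / 2 ^ k \<le> (1::real) / 2 ^ k0" by (intro divide_left_mono) auto
    then have "extension (x, t) = (\<Sum>s<k. piece s (x, t))" using k0 t(1) by (intro extension_eq_sum) auto
    also have "\<dots> = (\<Sum>s<S. piece s (x, t)) + (\<Sum>s\<in>{S..<k}. piece s (x, t))"
      using sum.union_disjoint[of "{..<S}" "{S..<k}" "\<lambda>s. piece s (x, t)"] ivl_disj_un(8)[of S k] by (simp add: k_def ivl_disj_int)
    also have "(\<Sum>s<S. piece s (x, t)) = (\<Sum>s<S. ?u (Suc s) x - ?u s x)"
    proof (rule sum.cong)
      fix s assume "s \<in> {..<S}"
      then have "scale S x \<le> scale (Suc s) x"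
        using lift_Suc_antimono_le[of "\<lambda>s. scale s x" "Suc s" S] scale_antimono by simp
      then have "1 / 2 ^ l \<le> scale (Suc s) x" using l[of x] by linarith
      then have "\<tau> \<le> \<delta> * scale (Suc s) x / 5"
        unfolding \<tau>_def using \<delta>_pos by (intro divide_right_mono mult_left_mono) auto
      then have "t \<le> height \<delta> (scale (Suc s)) x" using height_bounds(1)[OF slow_scale, of "Suc s" x] t(2) by linarith
      then have "cutoff (t / height \<delta> (scale (Suc s)) x) = 1"
        using height_bounds(3)[OF slow_scale, of "Suc s" x] by (intro cutoff_eq_1) simp
      then show "piece s (x, t) = ?u (Suc s) x - ?u s x" by (simp add: piece_eq)
    qed simp
    also have "\<dots> = ?u S x" using sum_lessThan_telescope[of "\<lambda>s. ?u s x" S] by (simp add: level_average_0)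
    finally have ext: "extension (x, t) = ?u S x + (\<Sum>s\<in>{S..<k}. piece s (x, t))" .
    have sum_le: "\<bar>\<Sum>s\<in>{S..<k}. piece s (x, t)\<bar> \<le> (\<Sum>s\<in>{S..<k}. \<bar>?u (Suc s) x - \<phi> x\<bar> + \<bar>?u s x - \<phi> x\<bar>)"
    proof (rule order_trans[OF sum_abs sum_mono])
      fix s
      have "\<bar>piece s (x, t)\<bar> \<le> 1 * \<bar>?u (Suc s) x - ?u s x\<bar>"
        unfolding piece_eq abs_mult using cutoff_bounds(1,2) by (intro mult_right_mono) auto
      also have "\<dots> \<le> \<bar>?u (Suc s) x - \<phi> x\<bar> + \<bar>?u s x - \<phi> x\<bar>" by simp
      finally show "\<bar>piece s (x, t)\<bar> \<le> \<bar>?u (Suc s) x - \<phi> x\<bar> + \<bar>?u s x - \<phi> x\<bar>" .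
    qed
    have "\<bar>\<phi> x - extension (x, t)\<bar> \<le> \<bar>?u S x - \<phi> x\<bar> + \<bar>\<Sum>s\<in>{S..<k}. piece s (x, t)\<bar>"
      unfolding ext by linarith
    also have "\<dots> \<le> \<bar>?u S x - \<phi> x\<bar> + ((\<Sum>s\<in>{S..<k}. \<bar>?u (Suc s) x - \<phi> x\<bar>) + (\<Sum>s\<in>{S..<k}. \<bar>?u s x - \<phi> x\<bar>))"
      using sum_le unfolding sum.distrib by (rule add_left_mono)
    finally have "\<bar>\<phi> x - extension (x, t)\<bar> \<le> (\<bar>?u S x - \<phi> x\<bar> + (\<Sum>s\<in>{S..<k}. \<bar>?u (Suc s) x - \<phi> x\<bar>)) + (\<Sum>s\<in>{S..<k}. \<bar>?u s x - \<phi> x\<bar>)"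
      by (simp only: add.assoc)
    also have "\<bar>?u S x - \<phi> x\<bar> + (\<Sum>s\<in>{S..<k}. \<bar>?u (Suc s) x - \<phi> x\<bar>) = (\<Sum>s\<in>{S..k}. \<bar>?u s x - \<phi> x\<bar>)"
    proof -
      have "S \<le> k" by (simp add: k_def)
      then show ?thesis
        using sum.atLeast_Suc_atMost[of S k "\<lambda>s. \<bar>?u s x - \<phi> x\<bar>"]
          sum.shift_bounds_Suc_ivl[of "\<lambda>s. \<bar>?u s x - \<phi> x\<bar>" S k] by (simp add: atLeastLessThanSuc_atLeastAtMost)
    qed
    also have "(\<Sum>s\<in>{S..<k}. \<bar>?u s x - \<phi> x\<bar>) \<le> (\<Sum>s\<in>{S..k}. \<bar>?u s x - \<phi> x\<bar>)" by (intro sum_mono2) auto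
    finally show ?thesis by (intro exI[of _ k]) (auto simp: k_def)
  qed
  ultimately show ?thesis by blast
qed

lemma extension_slice_integrable:
  assumes "0 < t" shows "(\<lambda>x. \<phi> x - extension (x, t)) absolutely_integrable_on ocube z r"
proof -
  have "continuous_on UNIV (\<lambda>x. extension (x, t))"
    by (rule continuous_on_compose2[OF C1_on_continuous[OF C1_on_extension]])
       (use assms in \<open>auto simp: upper_half_def intro!: continuous_intros\<close>)
  then have "set_integrable lebesgue (ocube z r) (\<lambda>x. extension (x, t))"
    by (intro locally_integrable_UNIV_bounded continuous_locally_integrable) auto
  moreover have "set_integrable lebesgue (ocube z r) \<phi>" by (intro locally_integrable_UNIV_bounded[OF \<phi>]) auto
  ultimately show ?thesis by (intro set_integral_diff)
qed

text \<open>Integrating the pointwise bound over the cube leaves a tail of the convergent sum of the energies of the levels.\<close>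

lemma trace_extension:
  assumes fin: "trace_energy lam \<gamma> A e \<phi> < \<infinity>" shows "is_trace \<phi> extension"
  unfolding is_trace_def
proof (intro allI impI conjI)
  fix z :: "real^'n" and r :: real assume r: "0 < r"
  show "\<forall>\<^sub>F t in at_right 0. (\<lambda>x. \<phi> x - extension (x, t)) absolutely_integrable_on ocube z r"
    using extension_slice_integrable by (auto simp: eventually_at_right_field intro!: exI[of _ 1])
  let ?Q = "ocube z r" and ?N = "real (overlap TYPE('n))"
  obtain w where w: "0 < w" "\<And>s x \<beta>. x \<in> ?Q \<Longrightarrow> \<beta> \<in> A s \<Longrightarrow> x \<in> enlarged lam \<beta> \<Longrightarrow> w \<le> wm \<beta>"
    using weight_mean_lower_bound[OF r, of z] by blast
  let ?L = "\<lambda>t. LINT x:?Q|lebesgue. \<bar>\<phi> x - extension (x, t)\<bar>"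
  show "(?L \<longlongrightarrow> 0) (at_right 0)"
  proof (rule tendstoI)
    fix \<epsilon> :: real assume \<epsilon>: "0 < \<epsilon>"
    define b where "b = w * \<epsilon> / (2 * ?N + 1)"
    have b: "0 < b" "2 * ?N * b < w * \<epsilon>" using w(1) \<epsilon> by (auto simp: b_def field_simps)
    have "(\<Sum>s. \<integral>\<^sup>+x. density s x \<partial>lebesgue) < \<infinity>" using suminf_density_le fin by (rule le_less_trans)
    from ennreal_tail_small[OF this b(1)] obtain S where S: "1 \<le> S"
      "(\<Sum>s. \<integral>\<^sup>+x. density (s + S) x \<partial>lebesgue) < ennreal b" by blast
    obtain \<tau> where \<tau>: "0 < \<tau>" "\<And>x t. 0 < t \<Longrightarrow> t < \<tau> \<Longrightarrow>
        \<exists>k\<ge>S. \<bar>\<phi> x - extension (x, t)\<bar> \<le> 2 * (\<Sum>s\<in>{S..k}. \<bar>level_average s x - \<phi> x\<bar>)"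
      using extension_minus_trace[of S] by blast
    have "dist (?L t) 0 < \<epsilon>" if t: "0 < t" "t < \<tau>" for t
    proof -
      have pt: "ennreal w * ennreal \<bar>\<phi> x - extension (x, t)\<bar> \<le> ennreal (2 * ?N) * (\<Sum>s. density (s + S) x)" if x: "x \<in> ?Q" for x
      proof -
        obtain k where k: "S \<le> k" "\<bar>\<phi> x - extension (x, t)\<bar> \<le> 2 * (\<Sum>s\<in>{S..k}. \<bar>level_average s x - \<phi> x\<bar>)" using \<tau>(2)[OF t] by blast
        have "w * \<bar>\<phi> x - extension (x, t)\<bar> \<le> 2 * (\<Sum>s\<in>{S..k}. w * \<bar>level_average s x - \<phi> x\<bar>)"
          using mult_left_mono[OF k(2), of w] w(1) by (simp add: sum_distrib_left mult_ac)
        then have "ennreal (w * \<bar>\<phi> x - extension (x, t)\<bar>) \<le> ennreal (2 * (\<Sum>s\<in>{S..k}. w * \<bar>level_average s x - \<phi> x\<bar>))"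
          by (rule ennreal_leI)
        also have "\<dots> = ennreal 2 * ennreal (\<Sum>s\<in>{S..k}. w * \<bar>level_average s x - \<phi> x\<bar>)"
          using w(1) by (intro ennreal_mult sum_nonneg) auto
        also have "ennreal (\<Sum>s\<in>{S..k}. w * \<bar>level_average s x - \<phi> x\<bar>) = (\<Sum>s\<in>{S..k}. ennreal (w * \<bar>level_average s x - \<phi> x\<bar>))"
          using w(1) by (intro sum_ennreal[symmetric]) simp
        also have "ennreal 2 * (\<Sum>s\<in>{S..k}. ennreal (w * \<bar>level_average s x - \<phi> x\<bar>)) \<le> ennreal 2 * (\<Sum>s\<in>{S..k}. ennreal ?N * density s x)"
        proof (intro mult_left_mono sum_mono)
          fix s assume "s \<in> {S..k}"
          then obtain s' where "s = Suc s'" using S(1) by (cases s) auto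
          then show "ennreal (w * \<bar>level_average s x - \<phi> x\<bar>) \<le> ennreal ?N * density s x"
            using level_average_error[OF w x] by simp
        qed simp
        also have "\<dots> = ennreal 2 * ennreal ?N * (\<Sum>s\<in>{S..k}. density s x)" by (simp add: sum_distrib_left mult.assoc)
        also have "(\<Sum>s\<in>{S..k}. density s x) = (\<Sum>s\<le>k - S. density (s + S) x)"
          using k(1) sum.shift_bounds_cl_nat_ivl[of "\<lambda>s. density s x" 0 S "k - S"] by (simp add: atLeast0AtMost)
        also have "\<dots> \<le> (\<Sum>s. density (s + S) x)" by (rule sum_le_suminf) auto
        finally show ?thesis using w(1) by (simp add: ennreal_mult mult_left_mono)
      qed
      have i: "set_integrable lebesgue ?Q (\<lambda>x. \<bar>\<phi> x - extension (x, t)\<bar>)"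
        using set_integrable_norm[OF extension_slice_integrable[OF t(1)]] by simp
      have L0: "0 \<le> ?L t" unfolding set_lebesgue_integral_def by (intro integral_nonneg_AE) (auto simp: indicator_def)
      have Leq: "ennreal (?L t) = (\<integral>\<^sup>+x\<in>?Q. ennreal \<bar>\<phi> x - extension (x, t)\<bar> \<partial>lebesgue)"
      proof -
        have "ennreal (?L t) = (\<integral>\<^sup>+x. ennreal (indicator ?Q x *\<^sub>R \<bar>\<phi> x - extension (x, t)\<bar>) \<partial>lebesgue)"
          unfolding set_lebesgue_integral_def
          using i by (intro nn_integral_eq_integral[symmetric]) (auto simp: set_integrable_def indicator_def)
        also have "\<dots> = (\<integral>\<^sup>+x\<in>?Q. ennreal \<bar>\<phi> x - extension (x, t)\<bar> \<partial>lebesgue)"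
          by (intro nn_integral_cong) (auto simp: indicator_def)
        finally show ?thesis .
      qed
      have "ennreal (w * ?L t) = ennreal w * (\<integral>\<^sup>+x\<in>?Q. ennreal \<bar>\<phi> x - extension (x, t)\<bar> \<partial>lebesgue)"
        using w(1) L0 by (simp add: ennreal_mult Leq)
      also have "\<dots> = (\<integral>\<^sup>+x. ennreal w * (ennreal \<bar>\<phi> x - extension (x, t)\<bar> * indicator ?Q x) \<partial>lebesgue)"
      proof (rule nn_integral_cmult[symmetric])
        have "(\<lambda>x. ennreal (indicator ?Q x *\<^sub>R \<bar>\<phi> x - extension (x, t)\<bar>)) \<in> borel_measurable lebesgue"
          using i by (intro measurable_compose[OF borel_measurable_integrable measurable_ennreal]) (simp add: set_integrable_def)
        moreover have "(\<lambda>x. ennreal (indicator ?Q x *\<^sub>R \<bar>\<phi> x - extension (x, t)\<bar>)) = (\<lambda>x. ennreal \<bar>\<phi> x - extension (x, t)\<bar> * indicator ?Q x)"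
          by (auto simp: fun_eq_iff indicator_def)
        ultimately show "(\<lambda>x. ennreal \<bar>\<phi> x - extension (x, t)\<bar> * indicator ?Q x) \<in> borel_measurable lebesgue" by (rule back_subst)
      qed
      also have "\<dots> \<le> (\<integral>\<^sup>+x. ennreal (2 * ?N) * (\<Sum>s. density (s + S) x) \<partial>lebesgue)"
        using pt by (intro nn_integral_mono) (auto simp: indicator_def)
      also have "\<dots> = ennreal (2 * ?N) * (\<Sum>s. \<integral>\<^sup>+x. density (s + S) x \<partial>lebesgue)"
        by (subst nn_integral_cmult) (auto simp: nn_integral_suminf)
      also have "\<dots> \<le> ennreal (2 * ?N) * ennreal b" using S(2) by (intro mult_left_mono) auto
      also have "\<dots> = ennreal (2 * ?N * b)" using b(1) by (simp add: ennreal_mult)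
      also have "\<dots> < ennreal (w * \<epsilon>)" using b by (intro ennreal_lessI) (use w \<epsilon> in auto)
      finally have "w * ?L t < w * \<epsilon>" using w(1) L0 by (simp add: ennreal_less_iff)
      then show ?thesis using w(1) L0 by (simp add: dist_real_def)
    qed
    then show "\<forall>\<^sub>F t in at_right 0. dist (?L t) 0 < \<epsilon>"
      using \<tau>(1) by (auto simp: eventually_at_right_field)
  qed
qed

end

section \<open>The extension theorem\<close>

theorem theorem4p2:
  fixes C\<gamma> c1 c2 lam :: real and k0 :: nat
  assumes "C\<gamma> \<ge> 1" and "c1 \<ge> 1" and "c2 \<ge> 1" and "lam = 1 / 2 ^ k0"
  shows "\<exists>C>0. \<forall>(\<gamma> :: (real^'n) \<times> real \<Rightarrow> real) (\<phi> :: real^'n \<Rightarrow> real)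
           (A :: nat \<Rightarrow> 'n dyadic set) (e :: nat \<Rightarrow> nat \<Rightarrow> 'n dyadic).
           A1_loc C\<gamma> \<gamma> \<and> locally_integrable UNIV \<phi> \<and> admissible lam c1 c2 \<gamma> A \<and>
           (\<forall>s. enumeration (e s) (A s)) \<and> trace_energy lam \<gamma> A e \<phi> < \<infinity> \<longrightarrow>
           (\<exists>f. f \<in> W11 upper_half \<gamma> \<and> is_trace \<phi> f \<and>
              ennreal C * W11_norm upper_half \<gamma> f \<le> trace_energy lam \<gamma> A e \<phi>)"
proof -
  define \<delta> :: real where "\<delta> = 1 / 2 ^ (2 * k0 + 2 * CARD('n) + 8)"
  define N where "N = real (overlap TYPE('n))"
  define L where "L = layer_const TYPE('n) * (C\<gamma> * c1 * (6 / \<delta>) ^ (CARD('n) + 1)) * (N * (c1 ^ 2 * c2)) * N"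
  \<comment> \<open>The norm consists of \<open>n + 2\<close> integrals; adding 1 makes the bound positive.\<close>
  define M where "M = (real CARD('n) + 2) * (2 * L) + 1"
  have "0 \<le> L"
    unfolding L_def N_def \<delta>_def using assms layer_const_nonneg
    by (intro mult_nonneg_nonneg) auto
  then have M: "0 < M" by (simp add: M_def add_nonneg_pos)
  show ?thesis
  proof (intro exI[of _ "1 / M"] conjI allI impI)
    show "0 < 1 / M" using M by simp
    fix \<gamma> :: "(real^'n) \<times> real \<Rightarrow> real" and \<phi> :: "real^'n \<Rightarrow> real"
      and A :: "nat \<Rightarrow> 'n dyadic set" and e :: "nat \<Rightarrow> nat \<Rightarrow> 'n dyadic"
    assume h: "A1_loc C\<gamma> \<gamma> \<and> locally_integrable UNIV \<phi> \<and> admissible lam c1 c2 \<gamma> A \<and>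
           (\<forall>s. enumeration (e s) (A s)) \<and> trace_energy lam \<gamma> A e \<phi> < \<infinity>"
    interpret trace_setting C\<gamma> c1 c2 lam \<delta> k0 \<gamma> \<phi> A e
      using assms h by unfold_locales (auto simp: \<delta>_def)
    have fin: "trace_energy lam \<gamma> A e \<phi> < \<infinity>" using h by blast
    have "(real CARD('n) + 2) * (2 * level_const) \<le> M"
      by (simp add: M_def L_def N_def level_const_def weight_const_def osc_const_def)
    then have "W11_norm upper_half \<gamma> extension \<le> ennreal M * trace_energy lam \<gamma> A e \<phi>"
      by (intro order_trans[OF W11_norm_extension] mult_right_mono ennreal_leI) auto
    then have "ennreal (1 / M) * W11_norm upper_half \<gamma> extension \<le> ennreal (1 / M) * (ennreal M * trace_energy lam \<gamma> A e \<phi>)"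
      by (intro mult_left_mono) auto
    also have "\<dots> = trace_energy lam \<gamma> A e \<phi>"
      using M by (simp add: mult.assoc[symmetric] ennreal_mult[symmetric])
    finally show "\<exists>f. f \<in> W11 upper_half \<gamma> \<and> is_trace \<phi> f \<and> ennreal (1 / M) * W11_norm upper_half \<gamma> f \<le> trace_energy lam \<gamma> A e \<phi>"
      using extension_in_W11[OF fin] trace_extension[OF fin] by blast
  qed
qed

end
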